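(* Let $d\in\mathbb{N}$, $a>0$, $b\in\mathbb{R}$. There exist constants $c(a,d)$, $c'(a,d)$ and $C'(a,b,d)$ such that for every $v\in\mathbb{N}$ there is $M$ with $|\Gamma(M)|\le v^{c(a,d)}$ such that, with $\Phi_N:=\{e^{i(\mathbf{k},\mathbf{x})}\}_{\mathbf{k}\in\Gamma(M)}$ and $N=|\Gamma(M)|$, $$\varrho^{ls}_{m,v}(\mathbf{W}^{a,b}_A,\Phi_N,L_2(\mathbb{T}^d))\le C'(a,b,d)\,v^{-a-1/2}(\log v)^{(d-1)(a+b)+1/2}$$ for any $m\ge c'(a,d)\,v(\log(2v))^4$.
   Context: $\mathbb{T}^d=[0,2\pi)^d$ with normalized Lebesgue measure $\mu$, $\|f\|_p=((2\pi)^{-d}\int_{\mathbb{T}^d}|f|^p)^{1/p}$, $\hat f(\mathbf{k})=(2\pi)^{-d}\int_{\mathbb{T}^d}f(\mathbf{x})e^{-i(\mathbf{k},\mathbf{x})}d\mathbf{x}$. $\Gamma(M)=\{\mathbf{k}\in\mathbb{Z}^d:\prod_{j=1}^d\max(|k_j|,1)\le M\}$. For $\mathbf{s}\in\mathbb{N}_0^d$, $\rho(\mathbf{s})=\{\mathbf{k}\in\mathbb{Z}^d:[2^{s_j-1}]\le|k_j|<2^{s_j},\ j=1,\dots,d\}$ ($[\cdot]$ = integer part), $\delta_{\mathbf{s}}(f,\mathbf{x})=\sum_{\mathbf{k}\in\rho(\mathbf{s})}\hat f(\mathbf{k})e^{i(\mathbf{k},\mathbf{x})}$, $f_j=\sum_{\|\mathbf{s}\|_1=j}\delta_{\mathbf{s}}(f)$,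 $\|g\|_A=\sum_{\mathbf{k}}|\hat g(\mathbf{k})|$. $\mathbf{W}^{a,b}_A:=\{f\in L_1(\mathbb{T}^d):\|f_j\|_A\le2^{-aj}\bar j^{(d-1)b},\ \bar j=\max(j,1),\ j\in\mathbb{N}_0\}$. For a dictionary $\Phi_N$, $\mathcal{X}_v(\Phi_N)$ is the collection of spans of $v$-element subsets of $\Phi_N$. For $\xi=(\xi^1,\dots,\xi^m)$ and a finite-dimensional subspace $L$, $LS(\xi,L)(f)$ is an element $u\in L$ minimizing $\frac1m\sum_{j}|f(\xi^j)-u(\xi^j)|^2$, and $\varrho^{ls}_{m,v}(\mathbf{F},\Phi_N,L_2(\mathbb{T}^d)):=\inf_{\xi\in(\mathbb{T}^d)^m}\sup_{f\in\mathbf{F}}\min_{L\in\mathcal{X}_v(\Phi_N)}\|f-LS(\xi,L)(f)\|_2$.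
   Formalization: The claim is proved for v ≥ 2: at v = 1 the condition |Γ(M)| ≤ 1 forces Γ(M) to be empty (Γ(1) has 3^d elements), so there is no 1-element subset of the dictionary and the bound fails; functions in W^{a,b}_A are taken as their continuous periodic representatives. *)

theory Defs
  imports "HOL-Analysis.Analysis"
begin

definition torus_cube :: "(real^'d) set" where
  "torus_cube = {x. \<forall>i. 0 \<le> x$i \<and> x$i < 2*pi}"

definition kx :: "int^'d \<Rightarrow> real^'d \<Rightarrow> real" where
  "kx k x = (\<Sum>i\<in>UNIV. real_of_int (k$i) * x$i)"

definition expk :: "int^'d \<Rightarrow> real^'d \<Rightarrow> complex" where
  "expk k x = exp (\<i> * complex_of_real (kx k x))"

definition fhat :: "(real^'d \<Rightarrow> complex) \<Rightarrow> int^'d \<Rightarrow> complex" where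
  "fhat f k = (1 / (2*pi) ^ CARD('d)) *\<^sub>R
      (LINT x:torus_cube|lborel. f x * exp (- \<i> * complex_of_real (kx k x)))"

definition L2norm :: "(real^'d \<Rightarrow> complex) \<Rightarrow> ennreal" where
  "L2norm g = (let I = ennreal (1 / (2*pi) ^ CARD('d)) *
                 (\<integral>\<^sup>+ x. ennreal ((cmod (g x))\<^sup>2) * indicator torus_cube x \<partial>lborel)
               in if I = top then top else ennreal (sqrt (enn2real I)))"

definition Anorm :: "(real^'d \<Rightarrow> complex) \<Rightarrow> ennreal" where
  "Anorm g = infsum (\<lambda>k. ennreal (cmod (fhat g k))) UNIV"

definition hyp_cross :: "real \<Rightarrow> (int^'d) set" where
  "hyp_cross M = {k. real_of_int (\<Prod>i\<in>UNIV. max \<bar>k$i\<bar> 1) \<le> M}"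

definition rho_block :: "nat^'d \<Rightarrow> (int^'d) set" where
  "rho_block s = {k. \<forall>i. \<lfloor>(2::real) powr (real (s$i) - 1)\<rfloor> \<le> \<bar>k$i\<bar> \<and> \<bar>k$i\<bar> < 2 ^ (s$i)}"

definition delta_s :: "nat^'d \<Rightarrow> (real^'d \<Rightarrow> complex) \<Rightarrow> real^'d \<Rightarrow> complex" where
  "delta_s s f x = (\<Sum>k\<in>rho_block s. fhat f k * expk k x)"

definition f_level :: "(real^'d \<Rightarrow> complex) \<Rightarrow> nat \<Rightarrow> real^'d \<Rightarrow> complex" where
  "f_level f j x = (\<Sum>s\<in>{s::nat^'d. (\<Sum>i\<in>UNIV. s$i) = j}. delta_s s f x)"

text \<open>The class W^{a,b}_A; functions on the torus are continuous 2pi-periodic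
  functions (the continuous representative, needed for point evaluation).\<close>
definition W_class :: "real \<Rightarrow> real \<Rightarrow> (real^'d \<Rightarrow> complex) set" where
  "W_class a b = {f. continuous_on UNIV f
      \<and> (\<forall>x i. f (x + (2*pi) *\<^sub>R axis i 1) = f x)
      \<and> set_integrable lborel torus_cube f
      \<and> (\<forall>j::nat. Anorm (f_level f j) \<le>
           ennreal (2 powr (- a * real j) * real (max j 1) powr ((real CARD('d) - 1) * b)))}"

definition trig_span :: "(int^'d) set \<Rightarrow> (real^'d \<Rightarrow> complex) set" where
  "trig_span K = {u. \<exists>c. u = (\<lambda>x. \<Sum>k\<in>K. c k * expk k x)}"

definition emp_err :: "nat \<Rightarrow> (nat \<Rightarrow> real^'d) \<Rightarrow> (real^'d \<Rightarrow> complex) \<Rightarrow> (real^'d \<Rightarrow> complex) \<Rightarrow> real" where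
  "emp_err m \<xi> f u = (1 / real m) * (\<Sum>j<m. (cmod (f (\<xi> j) - u (\<xi> j)))\<^sup>2)"

definition LS_set :: "nat \<Rightarrow> (nat \<Rightarrow> real^'d) \<Rightarrow> (real^'d \<Rightarrow> complex) set \<Rightarrow> (real^'d \<Rightarrow> complex) \<Rightarrow> (real^'d \<Rightarrow> complex) set" where
  "LS_set m \<xi> L f = {u \<in> L. \<forall>w\<in>L. emp_err m \<xi> f u \<le> emp_err m \<xi> f w}"

text \<open>rho^ls_{m,v}(F, Phi_N, L_2) for Phi_N = exponentials with frequencies in Gamma(M).
  Conservative reading: worst case over all least squares solutions.\<close>
definition rho_ls :: "nat \<Rightarrow> nat \<Rightarrow> (real^'d \<Rightarrow> complex) set \<Rightarrow> real \<Rightarrow> ennreal" where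
  "rho_ls m v F M =
     (INF \<xi>\<in>{\<xi>. \<forall>j<m. \<xi> j \<in> (torus_cube :: (real^'d) set)}.
        SUP f\<in>F. INF K\<in>{K. K \<subseteq> (hyp_cross M :: (int^'d) set) \<and> card K = v}.
           SUP u\<in>LS_set m \<xi> (trig_span K) f. L2norm (\<lambda>x. f x - u x))"

end

theory Submission
  imports Defs "HOL-Real_Asymp.Real_Asymp"
begin

text \<open>
  The key is to find \<open>m\<close> points, about \<open>v (log v)^3\<close> being enough, such that the empirical
  \<open>L\<^sub>2\<close>-norm of every trigonometric polynomial \<open>h\<close> with frequencies in a fixed box of size
  polynomial in \<open>v\<close> is comparable to its \<open>L\<^sub>2\<close>-norm up to an error of order \<open>\<parallel>h\<parallel>\<^sub>A\<^sup>2 / v\<close>.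
  If \<open>\<parallel>h\<parallel>\<^sub>A \<le> 1\<close>, then \<open>|h|\<^sup>2\<close> is comparable to the sum of \<open>4^(-i)\<close> times the
  indicators of the level sets \<open>|h| \<ge> 2^(-i)\<close>. At level \<open>i\<close>, Maurey sampling replaces \<open>h\<close> by an
  average of about \<open>4^i log v\<close> exponentials, so only few sets have to be sampled well at each
  level, and Chernoff bounds with a union bound apply. Both probabilistic steps are
  derandomised, and the torus is replaced by a finite grid on which the exponentials in
  question stay orthogonal.

  Given such points and \<open>f\<close> in the class, let \<open>2^n n^(d-1)\<close> be about \<open>v\<close>. The levels from \<open>n\<close> on have
  total Wiener norm at most \<open>D\<close>, a constant times \<open>2^(-an) n^((d-1)b)\<close>. Let \<open>K\<close> contain all
  frequencies of level below \<open>n\<close> together with those carrying a coefficient larger than \<open>2D/v\<close>.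
  Then the discarded part is of order \<open>D v^(-1/2)\<close> both in \<open>L\<^sub>2\<close> and empirically, and by the lower
  discretization bound on the span of \<open>K\<close> so is the least squares error.
\<close>

section \<open>Derandomised sampling\<close>

text \<open>The points must be fixed before f and K, and the discarded part of f need not be sparse;
  hence a discretization for all h at once, with an error in
  \<open>\<parallel>h\<parallel>_A\<close>. Least squares tolerates constant distortion, so level
  sets need only be compared up to a factor 2 and an additive slack, for which the Chernoff exponent
  is linear in the slack. The count \<open>v (log v)^3\<close> arises as follows. An approximant at
  level i is a word of about \<open>4^i log v\<close> letters over an alphabet of size polynomial in
  v, so the family has entropy \<open>4^i (log v)^2\<close>, and a slack of order
  \<open>4^i (log v)^2 / m\<close> beats it. The weight \<open>4^(-i)\<close> turns this into
  \<open>(log v)^2 / m\<close> for each of about log v levels, and the total has to stay below a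
  constant over v. Finiteness of the grid matters in its own right: Maurey approximation has to be
  accurate at points that are not chosen yet, so it is made uniform over the grid, at the price of
  the logarithm of its size. Grid and box can be polynomial in v because the Fourier tail is bounded
  in the supremum norm, hence at the points and in \<open>L_2\<close> alike, and of order log v
  further levels bring in the factor \<open>v^(-1/2)\<close>.\<close>

text \<open>A derandomised union bound: the points are chosen one after another, each time
  keeping the weighted sum at most its average over the next choice.\<close>

lemma weighted_sampling:
  fixes p :: "'z \<Rightarrow> real" and \<phi> :: "'s \<Rightarrow> 'z \<Rightarrow> real" and \<omega> :: "'s \<Rightarrow> real"
  assumes Z: "finite Z" and p: "\<And>z. z \<in> Z \<Longrightarrow> 0 \<le> p z" "sum p Z = 1"
    and \<phi>: "\<And>s z. s \<in> I \<Longrightarrow> z \<in> Z \<Longrightarrow> 0 \<le> \<phi> s z" and \<omega>: "\<And>s. s \<in> I \<Longrightarrow> 0 \<le> \<omega> s"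
    and avg: "\<And>s. s \<in> I \<Longrightarrow> (\<Sum>z\<in>Z. p z * \<phi> s z) \<le> 1"
  shows "\<exists>\<zeta>::nat \<Rightarrow> 'z. (\<forall>l. \<zeta> l \<in> Z) \<and> (\<Sum>s\<in>I. \<omega> s * (\<Prod>l<m. \<phi> s (\<zeta> l))) \<le> sum \<omega> I"
proof (induction m)
  case 0
  have "Z \<noteq> {}" using p(2) by auto
  then show ?case by (auto intro: exI[of _ "\<lambda>_. SOME z. z \<in> Z"] simp: some_in_eq)
next
  case (Suc m)
  then obtain \<zeta> where \<zeta>: "\<forall>l. \<zeta> l \<in> Z" "(\<Sum>s\<in>I. \<omega> s * (\<Prod>l<m. \<phi> s (\<zeta> l))) \<le> sum \<omega> I"
    by blast
  define \<omega>' where "\<omega>' s = \<omega> s * (\<Prod>l<m. \<phi> s (\<zeta> l))" for s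
  have \<omega>': "0 \<le> \<omega>' s" if "s \<in> I" for s
    unfolding \<omega>'_def using that \<omega> \<phi> \<zeta> by (intro mult_nonneg_nonneg prod_nonneg) auto
  define T where "T z = (\<Sum>s\<in>I. \<omega>' s * \<phi> s z)" for z
  have "\<exists>z\<in>Z. T z \<le> sum \<omega>' I"
  proof (rule ccontr)
    assume "\<not> ?thesis"
    then have gt: "sum \<omega>' I < T z" if "z \<in> Z" for z using that by (auto simp: not_le)
    have "(\<Sum>z\<in>Z. p z * T z) = (\<Sum>s\<in>I. \<omega>' s * (\<Sum>z\<in>Z. p z * \<phi> s z))"
      unfolding T_def sum_distrib_left by (subst sum.swap) (simp add: mult_ac)
    also have "\<dots> \<le> (\<Sum>s\<in>I. \<omega>' s * 1)"
      using \<omega>' avg by (intro sum_mono mult_left_mono)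
    finally have 1: "(\<Sum>z\<in>Z. p z * (T z - sum \<omega>' I)) \<le> 0"
      using p(2) by (simp add: right_diff_distrib sum_subtractf flip: sum_distrib_right)
    have 2: "0 \<le> p z * (T z - sum \<omega>' I)" if "z \<in> Z" for z
      using gt[OF that] p(1)[OF that] by simp
    have "(\<Sum>z\<in>Z. p z * (T z - sum \<omega>' I)) = 0"
      by (rule antisym[OF 1 sum_nonneg[OF 2]])
    then have "\<forall>z\<in>Z. p z * (T z - sum \<omega>' I) = 0"
      by (subst (asm) sum_nonneg_eq_0_iff[OF Z 2])
    then have "p z = 0" if "z \<in> Z" for z using gt[OF that] that by auto
    then show False using p(2) by simp
  qed
  then obtain z where z: "z \<in> Z" "T z \<le> sum \<omega>' I" by blast
  have "(\<Sum>s\<in>I. \<omega> s * (\<Prod>l<Suc m. \<phi> s ((\<zeta>(m := z)) l))) = T z"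
    unfolding T_def \<omega>'_def by (intro sum.cong refl) (simp add: mult_ac)
  also have "\<dots> \<le> sum \<omega> I" using z(2) \<zeta>(2) unfolding \<omega>'_def by simp
  finally show ?case using \<zeta>(1) z(1) by (intro exI[of _ "\<zeta>(m := z)"]) auto
qed

text \<open>Chernoff bounds with a factor 2 and an additive slack. Thanks to the factor, the failure
  probability is exp(-m \<delta>); a purely additive comparison would in general have \<delta>^2 in
  the exponent.\<close>

lemma sampling_sets:
  fixes S :: "'s \<Rightarrow> 'g set" and \<delta> :: "'s \<Rightarrow> real"
  assumes G: "finite G" "G \<noteq> {}" and I: "finite I" and m: "m > 0"
    and small: "(\<Sum>s\<in>I. 2 * exp (- real m * \<delta> s)) < 1"
  shows "\<exists>\<xi>::nat \<Rightarrow> 'g. (\<forall>j. \<xi> j \<in> G) \<and> (\<forall>s\<in>I.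
      (\<Sum>g\<in>G. of_bool (g \<in> S s)) / real (card G) \<le> 2 * ((\<Sum>j<m. of_bool (\<xi> j \<in> S s)) / real m) + 2 * \<delta> s \<and>
      (\<Sum>j<m. of_bool (\<xi> j \<in> S s)) / real m \<le> 2 * ((\<Sum>g\<in>G. of_bool (g \<in> S s)) / real (card G)) + \<delta> s)"
proof -
  define \<mu> :: "'s \<Rightarrow> real" where "\<mu> s = (\<Sum>g\<in>G. of_bool (g \<in> S s)) / card G" for s
  \<comment> \<open>The two exponential moments of the Chernoff bounds, normalised to have mean at most 1.\<close>
  define \<phi> where "\<phi> sb g = (if snd sb then exp (of_bool (g \<in> S (fst sb)) - 2 * \<mu> (fst sb))
       else exp (\<mu> (fst sb) / 2 - of_bool (g \<in> S (fst sb))))" for sb :: "'s \<times> bool" and g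
  have cG: "real (card G) > 0" using G by (simp add: card_gt_0_iff)
  have e1: "exp (1::real) \<le> 3" and e2: "exp (- 1 :: real) \<le> 1/2"
    using exp_le exp_ge_add_one_self[of "1::real"] by (auto simp: exp_minus field_simps)
  have avg: "(\<Sum>g\<in>G. 1 / real (card G) * \<phi> sb g) \<le> 1" for sb
  proof -
    obtain s b where sb: "sb = (s, b)" by force
    have \<mu>: "\<mu> s \<ge> 0" unfolding \<mu>_def by (simp add: sum_nonneg)
    have \<mu>': "(\<Sum>g\<in>G. 1 / real (card G) * of_bool (g \<in> S s)) = \<mu> s"
      unfolding \<mu>_def by (simp add: sum_divide_distrib)
    have lin: "(\<Sum>g\<in>G. 1 / real (card G) * (1 + K * of_bool (g \<in> S s))) = 1 + K * \<mu> s" for K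
    proof -
      have "(\<Sum>g\<in>G. 1 / real (card G) * (1 + K * of_bool (g \<in> S s)))
          = (\<Sum>g\<in>G. 1 / real (card G)) + K * (\<Sum>g\<in>G. 1 / real (card G) * of_bool (g \<in> S s))"
        by (simp add: distrib_left sum.distrib sum_distrib_left mult_ac)
      then show ?thesis using \<mu>' cG by simp
    qed
    show ?thesis
    proof (cases b)
      case True
      have "(\<Sum>g\<in>G. 1 / real (card G) * \<phi> sb g)
          = exp (- 2 * \<mu> s) * (\<Sum>g\<in>G. 1 / real (card G) * (1 + (exp 1 - 1) * of_bool (g \<in> S s)))"
        unfolding sum_distrib_left \<phi>_def sb using True
        by (intro sum.cong refl) (auto simp: mult_exp_exp simp flip: exp_add)
      also have "\<dots> = exp (- 2 * \<mu> s) * (1 + (exp 1 - 1) * \<mu> s)" by (simp only: lin)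
      also have "\<dots> \<le> exp (- 2 * \<mu> s) * exp (2 * \<mu> s)"
      proof (intro mult_left_mono)
        have "1 + (exp 1 - 1) * \<mu> s \<le> 1 + 2 * \<mu> s" using \<mu> e1 by (intro add_left_mono mult_right_mono) auto
        then show "1 + (exp 1 - 1) * \<mu> s \<le> exp (2 * \<mu> s)" using exp_ge_add_one_self[of "2 * \<mu> s"] by linarith
      qed auto
      also have "\<dots> = 1" by (simp flip: exp_add)
      finally show ?thesis .
    next
      case False
      have "(\<Sum>g\<in>G. 1 / real (card G) * \<phi> sb g)
          = exp (\<mu> s / 2) * (\<Sum>g\<in>G. 1 / real (card G) * (1 + (exp (- 1) - 1) * of_bool (g \<in> S s)))"
        unfolding sum_distrib_left \<phi>_def sb using False
        by (intro sum.cong refl) (auto simp: mult_exp_exp simp flip: exp_add)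
      also have "\<dots> = exp (\<mu> s / 2) * (1 + (exp (- 1) - 1) * \<mu> s)" by (simp only: lin)
      also have "\<dots> \<le> exp (\<mu> s / 2) * exp (- \<mu> s / 2)"
      proof (intro mult_left_mono)
        have "1 + (exp (- 1) - 1) * \<mu> s \<le> 1 + (- 1/2) * \<mu> s" using \<mu> e2 by (intro add_left_mono mult_right_mono) auto
        then show "1 + (exp (- 1) - 1) * \<mu> s \<le> exp (- \<mu> s / 2)" using exp_ge_add_one_self[of "- \<mu> s / 2"] by linarith
      qed auto
      also have "\<dots> = 1" by (simp flip: exp_add)
      finally show ?thesis .
    qed
  qed
  \<comment> \<open>The boolean selects the direction of the inequality. With weights exp(-m
    \<delta>) the total is below 1 by \<open>small\<close>, so each nonnegative term is below 1 and
    its exponent is negative, which is the claimed inequality.\<close>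
  let ?I = "I \<times> (UNIV :: bool set)"
  let ?\<omega> = "\<lambda>sb. exp (- real m * \<delta> (fst sb))"
  have "\<exists>\<xi>::nat \<Rightarrow> 'g. (\<forall>j. \<xi> j \<in> G) \<and> (\<Sum>sb\<in>?I. ?\<omega> sb * (\<Prod>j<m. \<phi> sb (\<xi> j))) \<le> sum ?\<omega> ?I"
    by (rule weighted_sampling[where p = "\<lambda>_. 1 / real (card G)"]) (use G cG avg in \<open>auto simp: \<phi>_def\<close>)
  then obtain \<xi> where \<xi>: "\<forall>j. \<xi> j \<in> G" and le: "(\<Sum>sb\<in>?I. ?\<omega> sb * (\<Prod>j<m. \<phi> sb (\<xi> j))) \<le> sum ?\<omega> ?I"
    by blast
  have "sum ?\<omega> ?I = (\<Sum>s\<in>I. 2 * exp (- real m * \<delta> s))"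
    by (subst sum.cartesian_product') (simp add: UNIV_bool)
  then have lt: "(\<Sum>sb\<in>?I. ?\<omega> sb * (\<Prod>j<m. \<phi> sb (\<xi> j))) < 1" using le small by simp
  have nn: "0 \<le> ?\<omega> sb * (\<Prod>j<m. \<phi> sb (\<xi> j))" for sb
    by (intro mult_nonneg_nonneg prod_nonneg) (auto simp: \<phi>_def)
  have each: "?\<omega> sb * (\<Prod>j<m. \<phi> sb (\<xi> j)) < 1" if "sb \<in> ?I" for sb
    using lt member_le_sum[OF that, of "\<lambda>sb. ?\<omega> sb * (\<Prod>j<m. \<phi> sb (\<xi> j))"] nn I by fastforce
  have "\<mu> s \<le> 2 * ((\<Sum>j<m. of_bool (\<xi> j \<in> S s)) / real m) + 2 * \<delta> s \<and>
      (\<Sum>j<m. of_bool (\<xi> j \<in> S s)) / real m \<le> 2 * \<mu> s + \<delta> s" if "s \<in> I" for s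
  proof
    let ?X = "\<Sum>j<m. of_bool (\<xi> j \<in> S s) :: real"
    have "exp (- real m * \<delta> s + (?X - real m * (2 * \<mu> s))) < 1"
      using each[of "(s, True)"] that by (simp add: \<phi>_def exp_sum[symmetric] sum_subtractf flip: exp_add)
    then show "?X / real m \<le> 2 * \<mu> s + \<delta> s" using m by (simp add: field_simps)
    have "exp (- real m * \<delta> s + (real m * (\<mu> s / 2) - ?X)) < 1"
      using each[of "(s, False)"] that by (simp add: \<phi>_def exp_sum[symmetric] sum_subtractf flip: exp_add)
    then show "\<mu> s \<le> 2 * (?X / real m) + 2 * \<delta> s" using m by (simp add: field_simps)
  qed
  then show ?thesis using \<xi> unfolding \<mu>_def by blast
qed

section \<open>Maurey sampling in the uniform norm\<close>

lemma exp_le_quadratic: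
  fixes x :: real
  assumes "\<bar>x\<bar> \<le> 1"
  shows "exp x \<le> 1 + x + x\<^sup>2"
proof (cases "x \<ge> 0")
  case True
  then show ?thesis using exp_bound assms by auto
next
  case False
  \<comment> \<open>For negative x the left side is at least 1, while 1 - x is at most
    exp(-x).\<close>
  have "1 + (- x) ^ 3 = (1 + x + x\<^sup>2) * (1 - x)" by (simp add: algebra_simps power2_eq_square power3_eq_cube)
  also have "\<dots> \<le> (1 + x + x\<^sup>2) * exp (- x)"
    using exp_ge_add_one_self[of "- x"] assms by (intro mult_left_mono) (auto simp: add_nonneg_nonneg)
  finally have "1 \<le> (1 + x + x\<^sup>2) * exp (- x)" using False by (smt (verit) zero_le_power)
  then show ?thesis by (simp add: exp_minus field_simps)
qed

text \<open>A sum with coefficient norm 1 is the mean of a random term of modulus at most 1, and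
  independent samples of that term concentrate. A union bound over G makes one selection accurate at
  every point of G, hence also at sample points picked from G later; it costs only the factor ln(4
  |G|) in the number of terms.\<close>

lemma sparse_uniform_approximation:
  fixes c :: "'k \<Rightarrow> complex" and e :: "'k \<Rightarrow> 'g \<Rightarrow> complex" and \<tau> :: real
  assumes B: "finite B" and G: "finite G" "G \<noteq> {}"
    and e: "\<And>k g. k \<in> B \<Longrightarrow> g \<in> G \<Longrightarrow> cmod (e k g) \<le> 1"
    and c: "(\<Sum>k\<in>B. \<bar>Re (c k)\<bar> + \<bar>Im (c k)\<bar>) = 1"
    and \<tau>: "0 < \<tau>" "\<tau> \<le> 1" and \<kappa>: "real \<kappa> \<ge> 16 * ln (4 * real (card G)) / \<tau>\<^sup>2"
  shows "\<exists>\<zeta>::nat \<Rightarrow> nat \<times> 'k. (\<forall>l. \<zeta> l \<in> {..<4} \<times> B) \<and>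
    (\<forall>g\<in>G. cmod ((\<Sum>k\<in>B. c k * e k g) - (\<Sum>l<\<kappa>. \<i> ^ fst (\<zeta> l) * e (snd (\<zeta> l)) g) / of_nat \<kappa>) \<le> 2 * \<tau>)"
proof -
  let ?Z = "{..<4::nat} \<times> B"
  define h where "h g = (\<Sum>k\<in>B. c k * e k g)" for g
  define E where "E z g = \<i> ^ fst z * e (snd z) g" for z :: "nat \<times> 'k" and g
  \<comment> \<open>Splitting each coefficient into its positive and negative real and imaginary parts turns the
    sum into a convex combination of the functions \<open>\<i>^n * e k\<close>, from which Maurey sampling is possible.\<close>
  define p where "p z = [max (Re (c (snd z))) 0, max (Im (c (snd z))) 0,
      max (- Re (c (snd z))) 0, max (- Im (c (snd z))) 0] ! fst z" for z :: "nat \<times> 'k"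
  \<comment> \<open>With this choice both \<open>4 * \<theta>^2 * \<kappa>\<close> and
    \<open>ln (4 * card G)\<close> are at most \<open>\<kappa> * \<tau>^2 / 16\<close>, and together
    they give \<open>\<theta> * \<kappa> * \<tau>\<close>.\<close>
  define \<theta> where "\<theta> = \<tau> / 8"
  have \<theta>: "0 < \<theta>" "\<theta> \<le> 1/8" using \<tau> by (auto simp: \<theta>_def)
  have four: "{..<4::nat} = {0,1,2,3}" by auto
  have i3: "\<i> ^ 3 = - \<i>" by (simp add: eval_nat_numeral)
  have Re_of: "Re (complex_of_real r * z) = r * Re z" for r z by simp
  have p0: "0 \<le> p z" if "z \<in> ?Z" for z
    using that unfolding p_def four by (auto simp: nth_Cons')
  have p1: "sum p ?Z = 1"
  proof -
    have "sum p ?Z = (\<Sum>k\<in>B. \<Sum>i<4. p (i, k))"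
      by (subst sum.cartesian_product') (rule sum.swap)
    also have "\<dots> = (\<Sum>k\<in>B. \<bar>Re (c k)\<bar> + \<bar>Im (c k)\<bar>)"
      unfolding p_def four by (intro sum.cong refl) (auto simp: nth_Cons')
    finally show ?thesis using c by simp
  qed
  have mean: "(\<Sum>z\<in>?Z. of_real (p z) * E z g) = h g" for g
  proof -
    have "(\<Sum>z\<in>?Z. of_real (p z) * E z g) = (\<Sum>k\<in>B. \<Sum>i<4. of_real (p (i, k)) * E (i, k) g)"
      by (subst sum.cartesian_product') (rule sum.swap)
    also have "\<dots> = h g"
      unfolding p_def E_def h_def four
      by (intro sum.cong refl) (auto simp: nth_Cons' i3 max_def complex_eq_iff algebra_simps)
    finally show ?thesis .
  qed
  have E1: "cmod (E z g) \<le> 1" if "z \<in> ?Z" "g \<in> G" for z g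
    using that e unfolding E_def by (auto simp: norm_mult norm_power)
  have h1: "cmod (h g) \<le> 1" if "g \<in> G" for g
  proof -
    have "cmod (h g) \<le> (\<Sum>z\<in>?Z. p z * cmod (E z g))"
      unfolding mean[symmetric] by (rule sum_norm_le) (use p0 in \<open>auto simp: norm_mult\<close>)
    also have "\<dots> \<le> (\<Sum>z\<in>?Z. p z * 1)" using p0 E1 that by (intro sum_mono mult_left_mono)
    finally show ?thesis using p1 by simp
  qed
  \<comment> \<open>Multiplying by the four powers of the imaginary unit yields plus and minus the
    real and imaginary part of the deviation. So one-sided bounds by \<tau> suffice, and they give
    modulus at most 2 \<tau>.\<close>
  define x where "x s z = Re (\<i> ^ snd s * (h (fst s) - E z (fst s)))" for s :: "'g \<times> nat" and z
  have x2: "\<bar>x s z\<bar> \<le> 2" if "fst s \<in> G" "z \<in> ?Z" for s z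
  proof -
    have "\<bar>x s z\<bar> \<le> cmod (\<i> ^ snd s * (h (fst s) - E z (fst s)))"
      unfolding x_def by (rule abs_Re_le_cmod)
    also have "\<dots> \<le> cmod (h (fst s)) + cmod (E z (fst s))"
      by (simp add: norm_mult norm_power norm_triangle_ineq4)
    finally show ?thesis using h1 E1 that by fastforce
  qed
  have x0: "(\<Sum>z\<in>?Z. p z * x s z) = 0" for s
  proof -
    have "(\<Sum>z\<in>?Z. p z * x s z) = Re (\<Sum>z\<in>?Z. of_real (p z) * (\<i> ^ snd s * (h (fst s) - E z (fst s))))"
      by (simp only: Re_sum x_def Re_of)
    also have "(\<Sum>z\<in>?Z. of_real (p z) * (\<i> ^ snd s * (h (fst s) - E z (fst s))))
        = \<i> ^ snd s * (h (fst s) * of_real (sum p ?Z) - (\<Sum>z\<in>?Z. of_real (p z) * E z (fst s)))"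
      unfolding of_real_sum sum_distrib_left right_diff_distrib sum_subtractf by (simp add: mult_ac)
    finally show ?thesis using p1 mean by simp
  qed
  define \<phi> where "\<phi> s z = exp (\<theta> * x s z - 4 * \<theta>\<^sup>2)" for s z
  have avg: "(\<Sum>z\<in>?Z. p z * \<phi> s z) \<le> 1" if "fst s \<in> G" for s
  proof -
    have "p z * \<phi> s z \<le> exp (- 4 * \<theta>\<^sup>2) * (p z * (1 + 4 * \<theta>\<^sup>2) + \<theta> * (p z * x s z))" if z: "z \<in> ?Z" for z
    proof -
      let ?y = "\<theta> * x s z"
      have "\<bar>?y\<bar> \<le> (1/8) * 2" unfolding abs_mult using x2[OF \<open>fst s \<in> G\<close> z] \<theta> by (intro mult_mono) auto
      then have "exp ?y \<le> 1 + ?y + ?y\<^sup>2" by (intro exp_le_quadratic) simp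
      also have "?y\<^sup>2 \<le> 4 * \<theta>\<^sup>2"
        using x2[OF \<open>fst s \<in> G\<close> z] abs_le_square_iff[of "x s z" 2] mult_left_mono[of "(x s z)\<^sup>2" 4 "\<theta>\<^sup>2"]
        by (auto simp: power_mult_distrib)
      finally have "p z * exp ?y \<le> p z * (1 + ?y + 4 * \<theta>\<^sup>2)" using p0[OF z] by (intro mult_left_mono) auto
      then have "exp (- 4 * \<theta>\<^sup>2) * (p z * exp ?y) \<le> exp (- 4 * \<theta>\<^sup>2) * (p z * (1 + ?y + 4 * \<theta>\<^sup>2))"
        by (rule mult_left_mono) simp
      then show ?thesis unfolding \<phi>_def exp_diff by (simp add: exp_minus field_simps)
    qed
    then have "(\<Sum>z\<in>?Z. p z * \<phi> s z) \<le> (\<Sum>z\<in>?Z. exp (- 4 * \<theta>\<^sup>2) * (p z * (1 + 4 * \<theta>\<^sup>2) + \<theta> * (p z * x s z)))"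
      by (rule sum_mono)
    also have "\<dots> = exp (- 4 * \<theta>\<^sup>2) * (sum p ?Z * (1 + 4 * \<theta>\<^sup>2) + \<theta> * (\<Sum>z\<in>?Z. p z * x s z))"
      by (simp only: sum_distrib_left[symmetric] sum_distrib_right[symmetric] sum.distrib)
    also have "\<dots> = exp (- 4 * \<theta>\<^sup>2) * (1 + 4 * \<theta>\<^sup>2)" using p1 x0 by simp
    also have "\<dots> \<le> exp (- 4 * \<theta>\<^sup>2) * exp (4 * \<theta>\<^sup>2)" by (intro mult_left_mono exp_ge_add_one_self) auto
    finally show ?thesis by (simp flip: exp_add)
  qed
  let ?I = "G \<times> {..<4::nat}"
  have "\<exists>\<zeta>::nat \<Rightarrow> nat \<times> 'k. (\<forall>l. \<zeta> l \<in> ?Z) \<and> (\<Sum>s\<in>?I. 1 * (\<Prod>l<\<kappa>. \<phi> s (\<zeta> l))) \<le> (\<Sum>s\<in>?I. 1)"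
    by (rule weighted_sampling[where p = p]) (use B p0 p1 avg in \<open>auto simp: \<phi>_def\<close>)
  then obtain \<zeta> where \<zeta>: "\<forall>l. \<zeta> l \<in> ?Z" and le: "(\<Sum>s\<in>?I. \<Prod>l<\<kappa>. \<phi> s (\<zeta> l)) \<le> 4 * real (card G)"
    by (auto simp: card_cartesian_product mult.commute)
  have cG: "real (card G) \<ge> 1" using G by (simp add: Suc_le_eq card_gt_0_iff)
  have "real \<kappa> \<ge> 16 * ln (4 * real (card G)) / \<tau>\<^sup>2" "16 * ln (4 * real (card G)) / \<tau>\<^sup>2 > 0" using \<kappa> cG \<tau> by auto
  then have \<kappa>0: "real \<kappa> > 0" by linarith
  define w where "w g = (\<Sum>l<\<kappa>. E (\<zeta> l) g) / of_nat \<kappa>" for g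
  have main: "Re (\<i> ^ n * (h g - w g)) \<le> \<tau>" if "g \<in> G" "n < 4" for g n
  proof -
    let ?s = "(g, n)"
    have "(\<Prod>l<\<kappa>. \<phi> ?s (\<zeta> l)) \<le> (\<Sum>s\<in>?I. \<Prod>l<\<kappa>. \<phi> s (\<zeta> l))"
      using that G by (intro member_le_sum[of ?s ?I "\<lambda>s. \<Prod>l<\<kappa>. \<phi> s (\<zeta> l)"]) (auto intro!: prod_nonneg simp: \<phi>_def)
    then have "exp (\<theta> * (\<Sum>l<\<kappa>. x ?s (\<zeta> l)) - real \<kappa> * (4 * \<theta>\<^sup>2)) \<le> 4 * real (card G)"
      using le by (simp add: \<phi>_def exp_sum[symmetric] sum_subtractf sum_distrib_left)
    then have "\<theta> * (\<Sum>l<\<kappa>. x ?s (\<zeta> l)) - real \<kappa> * (4 * \<theta>\<^sup>2) \<le> ln (4 * real (card G))"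
      using cG by (subst ln_ge_iff) auto
    also have "\<dots> \<le> real \<kappa> * \<tau>\<^sup>2 / 16" using \<kappa> \<tau> by (simp add: field_simps)
    finally have "\<theta> * (\<Sum>l<\<kappa>. x ?s (\<zeta> l)) \<le> \<theta> * (real \<kappa> * \<tau>)"
      unfolding \<theta>_def by (simp add: field_simps power2_eq_square)
    then have "(\<Sum>l<\<kappa>. x ?s (\<zeta> l)) \<le> real \<kappa> * \<tau>" using \<theta> by simp
    also have "(\<Sum>l<\<kappa>. x ?s (\<zeta> l)) = Re (\<i> ^ n * (of_nat \<kappa> * (h g - w g)))"
      unfolding x_def Re_sum[symmetric] w_def using \<kappa>0
      by (simp add: sum_distrib_left[symmetric] sum_subtractf right_diff_distrib)
    also have "\<i> ^ n * (of_nat \<kappa> * (h g - w g)) = of_real (real \<kappa>) * (\<i> ^ n * (h g - w g))" by simp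
    also have "Re \<dots> = real \<kappa> * Re (\<i> ^ n * (h g - w g))" by (rule Re_of)
    finally show ?thesis using \<kappa>0 by simp
  qed
  have "cmod (h g - w g) \<le> 2 * \<tau>" if "g \<in> G" for g
    using main[OF that, of 0] main[OF that, of 1] main[OF that, of 2] main[OF that, of 3]
      cmod_le[of "h g - w g"] by (auto simp: i3)
  then show ?thesis using \<zeta> unfolding w_def h_def E_def by blast
qed

section \<open>Universal discretization\<close>

text \<open>If n is the first index that counts, the geometric series from n on is at most 4/3 *
  4^(-n), and 2^(-n) <= 2 a. The threshold here is 2^(-i) lowered by the approximation error 2^(-i)
  / 2; in the converse estimate below it is raised by the same amount.\<close>

lemma sum_dyadic_layers_le:
  fixes a :: real
  shows "(\<Sum>i\<le>t. (1/4) ^ i * of_bool (a \<ge> (1/2) ^ i / 2)) \<le> 6 * a\<^sup>2"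
proof (cases "\<exists>i. a \<ge> (1/2) ^ i / 2")
  case False
  then show ?thesis by simp
next
  case True
  define n where "n = (LEAST i. a \<ge> (1/2) ^ i / 2)"
  have n: "a \<ge> (1/2) ^ n / 2" unfolding n_def using True by (rule LeastI_ex)
  have less: "\<not> a \<ge> (1/2) ^ i / 2" if "i < n" for i using that unfolding n_def by (rule not_less_Least)
  have "(\<Sum>i\<le>t. (1/4) ^ i * of_bool (a \<ge> (1/2) ^ i / 2)) \<le> (\<Sum>i\<in>{n..n+t}. (1/4::real) ^ i)"
  proof -
    have "(\<Sum>i\<le>t. (1/4) ^ i * of_bool (a \<ge> (1/2) ^ i / 2))
        = (\<Sum>i\<in>{i. i \<le> t \<and> a \<ge> (1/2) ^ i / 2}. (1/4::real) ^ i)"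
      by (rule sum.mono_neutral_cong_right) auto
    also have "\<dots> \<le> (\<Sum>i\<in>{n..n+t}. (1/4::real) ^ i)"
      using less by (intro sum_mono2) (auto simp: not_less[symmetric])
    finally show ?thesis .
  qed
  also have "\<dots> \<le> 4/3 * (1/4) ^ n"
    by (simp add: sum_gp)
  also have "(1/4::real) ^ n = ((1/2) ^ n)\<^sup>2" by (simp add: power_mult[symmetric] mult.commute power_divide power2_eq_square flip: power_mult_distrib)
  also have "((1/2::real) ^ n)\<^sup>2 \<le> (2 * a)\<^sup>2" using n by (intro power_mono) auto
  also have "4/3 * (2 * a)\<^sup>2 \<le> 6 * a\<^sup>2" by (simp add: power2_eq_square)
  finally show ?thesis by simp
qed

lemma le_sum_dyadic_layers:
  fixes a :: real
  assumes "0 \<le> a" "a \<le> 1"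
  shows "a\<^sup>2 \<le> 9 * (\<Sum>i\<le>t. (1/4) ^ i * of_bool (a \<ge> 3/2 * (1/2) ^ i)) + 3 * (1/4) ^ t"
proof (cases "a \<ge> 3/2 * (1/2) ^ t")
  case False
  have sq: "(1/4::real) ^ t = ((1/2) ^ t)\<^sup>2" by (simp add: power_mult[symmetric] mult.commute power_divide power2_eq_square flip: power_mult_distrib)
  have "a\<^sup>2 \<le> (3/2 * (1/2) ^ t)\<^sup>2" using False assms by (intro power_mono) auto
  also have "\<dots> = 9/4 * (1/4) ^ t" unfolding sq by (simp add: power2_eq_square)
  also have "\<dots> \<le> 3 * (1/4) ^ t" by simp
  also have "\<dots> \<le> 9 * (\<Sum>i\<le>t. (1/4) ^ i * of_bool (a \<ge> 3/2 * (1/2) ^ i)) + 3 * (1/4) ^ t"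
    by (simp add: sum_nonneg)
  finally show ?thesis .
next
  case True
  define n where "n = (LEAST i. a \<ge> 3/2 * (1/2) ^ i)"
  have n: "a \<ge> 3/2 * (1/2) ^ n" unfolding n_def using True by (rule LeastI)
  have nt: "n \<le> t" unfolding n_def using True by (rule Least_le)
  have sq: "(1/4::real) ^ n = ((1/2) ^ n)\<^sup>2" by (simp add: power_mult[symmetric] mult.commute power_divide power2_eq_square flip: power_mult_distrib)
  \<comment> \<open>As a <= 1 < 3/2, index 0 is excluded, so n has a predecessor whose threshold a
    misses. Hence a <= 3 * 2^(-n), and the single layer n with factor 9 accounts for the
    square.\<close>
  have "n \<noteq> 0" using n assms by (cases n) auto
  then obtain k where k: "n = Suc k" using not0_implies_Suc by blast
  have "\<not> a \<ge> 3/2 * (1/2) ^ k" using k unfolding n_def by (intro not_less_Least) simp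
  then have "a \<le> 3 * (1/2) ^ n" using k by simp
  then have "a\<^sup>2 \<le> (3 * (1/2) ^ n)\<^sup>2" using assms by (intro power_mono) auto
  also have "\<dots> = 9 * ((1/4) ^ n * of_bool (a \<ge> 3/2 * (1/2) ^ n))" using n unfolding sq by (simp add: power2_eq_square)
  also have "\<dots> \<le> 9 * (\<Sum>i\<le>t. (1/4) ^ i * of_bool (a \<ge> 3/2 * (1/2) ^ i))"
    using nt by (intro mult_left_mono member_le_sum) auto
  finally show ?thesis by (smt (verit) zero_le_power zero_le_divide_1_iff)
qed

text \<open>Each layer has its own approximant, whose error is half its threshold; its level set
  lies between two level sets of y. Applied to the grid and to the sample indices, this reduces
  comparing sums of squares to comparing counts.\<close>

lemma layer_comparison:
  fixes W :: "nat \<Rightarrow> 'x \<Rightarrow> real" and y :: "'x \<Rightarrow> real"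
  assumes y: "\<And>x. x \<in> X \<Longrightarrow> 0 \<le> y x \<and> y x \<le> 1"
    and W: "\<And>i x. i \<le> t \<Longrightarrow> x \<in> X \<Longrightarrow> \<bar>y x - W i x\<bar> \<le> (1/2) ^ i / 2"
  shows "(\<Sum>x\<in>X. (y x)\<^sup>2) \<le> 9 * (\<Sum>i\<le>t. (1/4) ^ i * (\<Sum>x\<in>X. of_bool (W i x \<ge> (1/2) ^ i))) + 3 * (1/4) ^ t * real (card X)"
    and "(\<Sum>i\<le>t. (1/4) ^ i * (\<Sum>x\<in>X. of_bool (W i x \<ge> (1/2) ^ i))) \<le> 6 * (\<Sum>x\<in>X. (y x)\<^sup>2)"
proof -
  have sw: "(\<Sum>i\<le>t. (1/4) ^ i * (\<Sum>x\<in>X. of_bool (W i x \<ge> (1/2) ^ i)))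
      = (\<Sum>x\<in>X. \<Sum>i\<le>t. (1/4::real) ^ i * of_bool (W i x \<ge> (1/2) ^ i))"
    unfolding sum_distrib_left by (rule sum.swap)
  have "(y x)\<^sup>2 \<le> 9 * (\<Sum>i\<le>t. (1/4) ^ i * of_bool (W i x \<ge> (1/2) ^ i)) + 3 * (1/4) ^ t" if "x \<in> X" for x
  proof -
    have "(\<Sum>i\<le>t. (1/4) ^ i * of_bool (y x \<ge> 3/2 * (1/2) ^ i)) \<le> (\<Sum>i\<le>t. (1/4::real) ^ i * of_bool (W i x \<ge> (1/2) ^ i))"
    proof (intro sum_mono mult_left_mono)
      fix i assume "i \<in> {..t}"
      then have "y x \<ge> 3/2 * (1/2) ^ i \<Longrightarrow> W i x \<ge> (1/2) ^ i" using abs_le_D1[OF W[of i x]] abs_le_D2[OF W[of i x]] that by simp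
      then show "of_bool (y x \<ge> 3/2 * (1/2) ^ i) \<le> (of_bool (W i x \<ge> (1/2) ^ i) :: real)" by simp
    qed simp
    then show ?thesis using le_sum_dyadic_layers[where a = "y x" and t = t] y[OF that] by linarith
  qed
  then have "(\<Sum>x\<in>X. (y x)\<^sup>2) \<le> (\<Sum>x\<in>X. 9 * (\<Sum>i\<le>t. (1/4) ^ i * of_bool (W i x \<ge> (1/2) ^ i)) + 3 * (1/4) ^ t)"
    by (rule sum_mono)
  also have "\<dots> = 9 * (\<Sum>x\<in>X. \<Sum>i\<le>t. (1/4::real) ^ i * of_bool (W i x \<ge> (1/2) ^ i)) + 3 * (1/4) ^ t * real (card X)"
    unfolding sum.distrib sum_distrib_left[symmetric] by (simp add: mult_ac)
  finally show "(\<Sum>x\<in>X. (y x)\<^sup>2) \<le> 9 * (\<Sum>i\<le>t. (1/4) ^ i * (\<Sum>x\<in>X. of_bool (W i x \<ge> (1/2) ^ i))) + 3 * (1/4) ^ t * real (card X)"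
    unfolding sw .
  have "(\<Sum>i\<le>t. (1/4::real) ^ i * of_bool (W i x \<ge> (1/2) ^ i)) \<le> 6 * (y x)\<^sup>2" if "x \<in> X" for x
  proof -
    have "(\<Sum>i\<le>t. (1/4) ^ i * of_bool (W i x \<ge> (1/2) ^ i)) \<le> (\<Sum>i\<le>t. (1/4::real) ^ i * of_bool (y x \<ge> (1/2) ^ i / 2))"
    proof (intro sum_mono mult_left_mono)
      fix i assume "i \<in> {..t}"
      then have "W i x \<ge> (1/2) ^ i \<Longrightarrow> y x \<ge> (1/2) ^ i / 2" using abs_le_D1[OF W[of i x]] abs_le_D2[OF W[of i x]] that by simp
      then show "of_bool (W i x \<ge> (1/2) ^ i) \<le> (of_bool (y x \<ge> (1/2) ^ i / 2) :: real)" by simp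
    qed simp
    then show ?thesis using sum_dyadic_layers_le[where a = "y x" and t = t] by linarith
  qed
  then show "(\<Sum>i\<le>t. (1/4) ^ i * (\<Sum>x\<in>X. of_bool (W i x \<ge> (1/2) ^ i))) \<le> 6 * (\<Sum>x\<in>X. (y x)\<^sup>2)"
    unfolding sw sum_distrib_left[of 6] by (rule sum_mono)
qed

text \<open>The union bound runs over the finitely many approximants and not over c, so the points
  are good for every c. In \<epsilon> the first term is the slack collected over t + 1 layers, the
  second comes from values below the last threshold.\<close>

lemma universal_discretization_unit:
  fixes e :: "'k \<Rightarrow> 'g \<Rightarrow> complex" and q m t :: nat
  assumes B: "finite B" "B \<noteq> {}" and G: "finite G" "G \<noteq> {}"
    and e: "\<And>k g. k \<in> B \<Longrightarrow> g \<in> G \<Longrightarrow> cmod (e k g) \<le> 1"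
    and qG: "ln (4 * real (card G)) \<le> real q" and qB: "ln (4 * real (card B)) \<le> real q" and m: "m > 0"
  defines "\<epsilon> \<equiv> 18 * (real t + 1) * (256 * (real q)\<^sup>2 + real t + 2) / real m + 3 * (1/4) ^ t"
  shows "\<exists>\<xi>::nat \<Rightarrow> 'g. (\<forall>j. \<xi> j \<in> G) \<and> (\<forall>c. (\<Sum>k\<in>B. \<bar>Re (c k)\<bar> + \<bar>Im (c k)\<bar>) = 1 \<longrightarrow>
      (\<Sum>g\<in>G. (cmod (\<Sum>k\<in>B. c k * e k g))\<^sup>2) / real (card G)
        \<le> 108 * ((\<Sum>j<m. (cmod (\<Sum>k\<in>B. c k * e k (\<xi> j)))\<^sup>2) / real m) + \<epsilon> \<and>
      (\<Sum>j<m. (cmod (\<Sum>k\<in>B. c k * e k (\<xi> j)))\<^sup>2) / real m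
        \<le> 108 * ((\<Sum>g\<in>G. (cmod (\<Sum>k\<in>B. c k * e k g))\<^sup>2) / real (card G)) + \<epsilon>)"
proof -
  \<comment> \<open>With \<open>\<kappa> i\<close> samples Maurey approximation is accurate to \<open>2^(-i) / 2\<close> on all of \<open>G\<close>. There are few
    such approximants, and the level set \<open>|w| \<ge> 2^(-i)\<close> carries weight \<open>4^(-i)\<close> only, so its empirical
    measure may be off by \<open>4^i * \<beta>\<close>; this balances the union bound over all levels.\<close>
  define \<kappa> where "\<kappa> i = 256 * 4 ^ i * q" for i :: nat
  define \<beta> where "\<beta> = (256 * (real q)\<^sup>2 + real t + 2) / real m"
  define w where "w i \<zeta> g = (\<Sum>l<\<kappa> i. \<i> ^ fst (\<zeta> l) * e (snd (\<zeta> l)) g) / of_nat (\<kappa> i)"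
    for i and \<zeta> :: "nat \<Rightarrow> nat \<times> 'k" and g
  define F where "F i = PiE {..<\<kappa> i} (\<lambda>_. {..<4::nat} \<times> B)" for i
  define I where "I = Sigma {..t} F"
  define S where "S s = {g. cmod (w (fst s) (snd s) g) \<ge> (1/2) ^ fst s}" for s
  have cG: "real (card G) \<ge> 1" using G by (simp add: Suc_le_eq card_gt_0_iff)
  have cB: "real (card B) \<ge> 1" using B by (simp add: Suc_le_eq card_gt_0_iff)
  have finF: "finite (F i)" for i unfolding F_def using B by (intro finite_PiE) auto
  have finI: "finite I" unfolding I_def using finF by auto
  have cardF: "real (card (F i)) \<le> exp (256 * 4 ^ i * (real q)\<^sup>2)" for i
  proof -
    have "real (card (F i)) = (4 * real (card B)) ^ \<kappa> i"
      unfolding F_def using B by (subst card_PiE) (auto simp: card_cartesian_product)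
    also have "\<dots> \<le> (exp (real q)) ^ \<kappa> i"
      using exp_le_cancel_iff[THEN iffD2, OF qB] cB by (intro power_mono) auto
    also have "\<dots> = exp (256 * 4 ^ i * (real q)\<^sup>2)"
      unfolding \<kappa>_def by (simp add: power2_eq_square mult_ac flip: exp_of_nat_mult)
    finally show ?thesis .
  qed
  have small: "(\<Sum>s\<in>I. 2 * exp (- real m * (4 ^ fst s * \<beta>))) < 1"
  proof -
    have "(\<Sum>s\<in>I. 2 * exp (- real m * (4 ^ fst s * \<beta>)))
        = (\<Sum>i\<le>t. \<Sum>\<zeta>\<in>F i. 2 * exp (- real m * (4 ^ i * \<beta>)))"
      unfolding I_def using finF by (subst sum.Sigma) (auto simp: case_prod_unfold)
    also have "\<dots> = (\<Sum>i\<le>t. real (card (F i)) * (2 * exp (- real m * (4 ^ i * \<beta>))))"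
      by simp
    \<comment> \<open>The part 256 q^2 of \<beta> cancels the number of approximants; the remaining
      t + 2 pays for the summation over t + 1 levels.\<close>
    also have "\<dots> \<le> (\<Sum>i\<le>t. 2 * exp (- (real t + 2)))"
    proof (intro sum_mono)
      fix i :: nat
      have m\<beta>: "real m * (4 ^ i * \<beta>) = 4 ^ i * (256 * (real q)\<^sup>2 + real t + 2)"
        unfolding \<beta>_def using m by simp
      have "real (card (F i)) * (2 * exp (- real m * (4 ^ i * \<beta>)))
          \<le> exp (256 * 4 ^ i * (real q)\<^sup>2) * (2 * exp (- real m * (4 ^ i * \<beta>)))"
        using cardF by (intro mult_right_mono) auto
      also have "exp (256 * 4 ^ i * (real q)\<^sup>2) * (2 * exp (- real m * (4 ^ i * \<beta>)))
          = 2 * exp (256 * 4 ^ i * (real q)\<^sup>2 - real m * (4 ^ i * \<beta>))" by (simp add: exp_diff exp_minus field_simps)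
      also have "256 * 4 ^ i * (real q)\<^sup>2 - real m * (4 ^ i * \<beta>) = - (4 ^ i * (real t + 2))"
        unfolding m\<beta> by (simp add: algebra_simps)
      also have "2 * exp (- (4 ^ i * (real t + 2))) \<le> 2 * exp (- (real t + 2))"
      proof -
        have "1 * (real t + 2) \<le> 4 ^ i * (real t + 2)"
          by (intro mult_right_mono) auto
        then have "- (4 ^ i * (real t + 2)) \<le> - (real t + 2)" by (simp only: neg_le_iff_le mult_1)
        then show ?thesis by (simp only: exp_le_cancel_iff mult_le_cancel_left_pos zero_less_numeral)
      qed
      finally show "real (card (F i)) * (2 * exp (- real m * (4 ^ i * \<beta>))) \<le> 2 * exp (- (real t + 2))" .
    qed
    also have "\<dots> = 2 * (real t + 1) * exp (- (real t + 2))" by (simp add: algebra_simps)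
    also have "\<dots> < 1"
    proof -
      have "2 * (real t + 1) < 2 * (real t + 2)" by simp
      also have "\<dots> \<le> exp 1 * exp (real t + 1)"
        using exp_ge_add_one_self[of "1::real"] exp_ge_add_one_self[of "real t + 1"] by (intro mult_mono) auto
      also have "\<dots> = exp (real t + 2)" by (simp flip: exp_add add: algebra_simps)
      finally show ?thesis unfolding exp_minus by (simp add: field_simps)
    qed
    finally show ?thesis .
  qed
  obtain \<xi> where \<xi>: "\<forall>j. \<xi> j \<in> G" and cmp: "\<forall>s\<in>I.
      (\<Sum>g\<in>G. of_bool (g \<in> S s)) / real (card G) \<le> 2 * ((\<Sum>j<m. of_bool (\<xi> j \<in> S s)) / real m) + 2 * (4 ^ fst s * \<beta>) \<and>
      (\<Sum>j<m. of_bool (\<xi> j \<in> S s)) / real m \<le> 2 * ((\<Sum>g\<in>G. of_bool (g \<in> S s)) / real (card G)) + 4 ^ fst s * \<beta>"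
    using sampling_sets[OF G finI m small, of S] by blast
  have main: "(\<Sum>g\<in>G. (cmod (\<Sum>k\<in>B. c k * e k g))\<^sup>2) / real (card G)
        \<le> 108 * ((\<Sum>j<m. (cmod (\<Sum>k\<in>B. c k * e k (\<xi> j)))\<^sup>2) / real m) + \<epsilon> \<and>
      (\<Sum>j<m. (cmod (\<Sum>k\<in>B. c k * e k (\<xi> j)))\<^sup>2) / real m
        \<le> 108 * ((\<Sum>g\<in>G. (cmod (\<Sum>k\<in>B. c k * e k g))\<^sup>2) / real (card G)) + \<epsilon>"
    if c: "(\<Sum>k\<in>B. \<bar>Re (c k)\<bar> + \<bar>Im (c k)\<bar>) = 1" for c
  proof -
    define h where "h g = (\<Sum>k\<in>B. c k * e k g)" for g
    have h1: "cmod (h g) \<le> 1" if "g \<in> G" for g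
    proof -
      have "cmod (h g) \<le> (\<Sum>k\<in>B. (\<bar>Re (c k)\<bar> + \<bar>Im (c k)\<bar>) * 1)"
        unfolding h_def
      proof (rule sum_norm_le)
        fix k assume "k \<in> B"
        then show "cmod (c k * e k g) \<le> (\<bar>Re (c k)\<bar> + \<bar>Im (c k)\<bar>) * 1"
          unfolding norm_mult using e that by (intro mult_mono cmod_le) auto
      qed
      then show ?thesis using c by simp
    qed
    have "\<exists>\<zeta>\<in>F i. \<forall>g\<in>G. cmod (h g - w i \<zeta> g) \<le> (1/2) ^ i / 2" for i
    proof -
      \<comment> \<open>Accuracy 2 \<tau> has to be half the threshold 2^(-i). Then 16 / \<tau>^2 =
        256 * 4^i, which is the origin of \<open>\<kappa> i\<close>.\<close>
      let ?\<tau> = "(1/2) ^ i / 4 :: real"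
      have "?\<tau>\<^sup>2 = (1/4) ^ i / 16"
        by (simp add: power_divide power2_eq_square flip: power_mult_distrib)
      then have "16 * ln (4 * real (card G)) / ?\<tau>\<^sup>2 = 256 * 4 ^ i * ln (4 * real (card G))"
        by (simp add: power_divide)
      also have "\<dots> \<le> real (\<kappa> i)" unfolding \<kappa>_def using qG by simp
      finally have k: "16 * ln (4 * real (card G)) / ?\<tau>\<^sup>2 \<le> real (\<kappa> i)" .
      have \<tau>1: "?\<tau> \<le> 1" using power_le_one[of "1/2::real" i] by simp
      have "\<exists>\<zeta>::nat \<Rightarrow> nat \<times> 'k. (\<forall>l. \<zeta> l \<in> {..<4} \<times> B) \<and> (\<forall>g\<in>G. cmod (h g - w i \<zeta> g) \<le> 2 * ?\<tau>)"
        unfolding h_def w_def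
        by (rule sparse_uniform_approximation[OF B(1) G e c _ \<tau>1 k]) auto
      then obtain \<zeta> where \<zeta>: "\<forall>l. \<zeta> l \<in> {..<4::nat} \<times> B"
        "\<forall>g\<in>G. cmod (h g - w i \<zeta> g) \<le> 2 * ?\<tau>" by blast
      have "w i (restrict \<zeta> {..<\<kappa> i}) = w i \<zeta>" unfolding w_def by (auto intro!: ext sum.cong)
      moreover have "restrict \<zeta> {..<\<kappa> i} \<in> F i" using \<zeta>(1) unfolding F_def by auto
      ultimately show ?thesis using \<zeta>(2) by (intro bexI[of _ "restrict \<zeta> {..<\<kappa> i}"]) auto
    qed
    then obtain \<zeta> where \<zeta>: "\<And>i. \<zeta> i \<in> F i" "\<And>i g. g \<in> G \<Longrightarrow> cmod (h g - w i (\<zeta> i) g) \<le> (1/2) ^ i / 2"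
      by metis
    define aG where "aG i = (\<Sum>g\<in>G. of_bool (cmod (w i (\<zeta> i) g) \<ge> (1/2) ^ i)) / real (card G)" for i
    define aQ where "aQ i = (\<Sum>j<m. of_bool (cmod (w i (\<zeta> i) (\<xi> j)) \<ge> (1/2) ^ i)) / real m" for i
    have cmp': "aG i \<le> 2 * aQ i + 2 * (4 ^ i * \<beta>)" "aQ i \<le> 2 * aG i + 4 ^ i * \<beta>" if "i \<le> t" for i
      using cmp[rule_format, of "(i, \<zeta> i)"] that \<zeta>(1) unfolding I_def S_def aG_def aQ_def by auto
    have near: "\<bar>cmod (h g) - cmod (w i (\<zeta> i) g)\<bar> \<le> (1/2) ^ i / 2" if "g \<in> G" for i g
      using \<zeta>(2)[OF that, of i] norm_triangle_ineq3[of "h g" "w i (\<zeta> i) g"] by linarith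
    have lG: "(\<Sum>g\<in>G. (cmod (h g))\<^sup>2) / real (card G) \<le> 9 * (\<Sum>i\<le>t. (1/4) ^ i * aG i) + 3 * (1/4) ^ t"
      "(\<Sum>i\<le>t. (1/4) ^ i * aG i) \<le> 6 * ((\<Sum>g\<in>G. (cmod (h g))\<^sup>2) / real (card G))"
    proof -
      note l = layer_comparison[of G "\<lambda>g. cmod (h g)" t "\<lambda>i g. cmod (w i (\<zeta> i) g)"]
      have s: "(\<Sum>i\<le>t. (1/4) ^ i * aG i) = (\<Sum>i\<le>t. (1/4) ^ i * (\<Sum>g\<in>G. of_bool (cmod (w i (\<zeta> i) g) \<ge> (1/2) ^ i))) / real (card G)"
        by (simp only: aG_def times_divide_eq_right sum_divide_distrib[symmetric])
      show "(\<Sum>g\<in>G. (cmod (h g))\<^sup>2) / real (card G) \<le> 9 * (\<Sum>i\<le>t. (1/4) ^ i * aG i) + 3 * (1/4) ^ t"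
        unfolding s using l(1) h1 near cG by (simp add: field_simps)
      show "(\<Sum>i\<le>t. (1/4) ^ i * aG i) \<le> 6 * ((\<Sum>g\<in>G. (cmod (h g))\<^sup>2) / real (card G))"
        unfolding s using l(2) h1 near cG by (simp add: field_simps)
    qed
    have lQ: "(\<Sum>j<m. (cmod (h (\<xi> j)))\<^sup>2) / real m \<le> 9 * (\<Sum>i\<le>t. (1/4) ^ i * aQ i) + 3 * (1/4) ^ t"
      "(\<Sum>i\<le>t. (1/4) ^ i * aQ i) \<le> 6 * ((\<Sum>j<m. (cmod (h (\<xi> j)))\<^sup>2) / real m)"
    proof -
      note l = layer_comparison[of "{..<m}" "\<lambda>j. cmod (h (\<xi> j))" t "\<lambda>i j. cmod (w i (\<zeta> i) (\<xi> j))"]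
      have s: "(\<Sum>i\<le>t. (1/4) ^ i * aQ i) = (\<Sum>i\<le>t. (1/4) ^ i * (\<Sum>j<m. of_bool (cmod (w i (\<zeta> i) (\<xi> j)) \<ge> (1/2) ^ i))) / real m"
        by (simp only: aQ_def times_divide_eq_right sum_divide_distrib[symmetric])
      show "(\<Sum>j<m. (cmod (h (\<xi> j)))\<^sup>2) / real m \<le> 9 * (\<Sum>i\<le>t. (1/4) ^ i * aQ i) + 3 * (1/4) ^ t"
        unfolding s using l(1) h1 near \<xi> m by (simp add: field_simps)
      show "(\<Sum>i\<le>t. (1/4) ^ i * aQ i) \<le> 6 * ((\<Sum>j<m. (cmod (h (\<xi> j)))\<^sup>2) / real m)"
        unfolding s using l(2) h1 near \<xi> m by (simp add: field_simps)
    qed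
    have four: "(1/4::real) ^ i * 4 ^ i = 1" for i by (simp add: power_divide)
    have "(\<Sum>i\<le>t. (1/4) ^ i * aG i) \<le> (\<Sum>i\<le>t. (1/4) ^ i * (2 * aQ i + 2 * (4 ^ i * \<beta>)))"
      using cmp' by (intro sum_mono mult_left_mono) auto
    also have "\<dots> = (\<Sum>i\<le>t. 2 * ((1/4) ^ i * aQ i) + 2 * \<beta>)"
      using four by (intro sum.cong refl) (simp add: distrib_left mult.assoc[symmetric] mult.commute[of _ 2])
    also have "\<dots> = 2 * (\<Sum>i\<le>t. (1/4) ^ i * aQ i) + 2 * (real t + 1) * \<beta>"
      by (simp add: sum.distrib sum_distrib_left algebra_simps)
    finally have GQ: "(\<Sum>i\<le>t. (1/4) ^ i * aG i) \<le> 2 * (\<Sum>i\<le>t. (1/4) ^ i * aQ i) + 2 * (real t + 1) * \<beta>" .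
    have "(\<Sum>i\<le>t. (1/4) ^ i * aQ i) \<le> (\<Sum>i\<le>t. (1/4) ^ i * (2 * aG i + 4 ^ i * \<beta>))"
      using cmp' by (intro sum_mono mult_left_mono) auto
    also have "\<dots> = (\<Sum>i\<le>t. 2 * ((1/4) ^ i * aG i) + \<beta>)"
      using four by (intro sum.cong refl) (simp add: distrib_left mult.assoc[symmetric] mult.commute[of _ 2])
    also have "\<dots> = 2 * (\<Sum>i\<le>t. (1/4) ^ i * aG i) + (real t + 1) * \<beta>"
      by (simp add: sum.distrib sum_distrib_left algebra_simps)
    finally have QG: "(\<Sum>i\<le>t. (1/4) ^ i * aQ i) \<le> 2 * (\<Sum>i\<le>t. (1/4) ^ i * aG i) + (real t + 1) * \<beta>" .
    \<comment> \<open>Chaining the two layer estimates (9 and 6) with the sampling comparison (2)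
      gives 108 = 9 * 2 * 6, and 18 = 9 * 2 for the slack.\<close>
    have \<epsilon>: "\<epsilon> = 18 * ((real t + 1) * \<beta>) + 3 * (1/4) ^ t" unfolding \<epsilon>_def \<beta>_def by simp
    have "0 \<le> (real t + 1) * \<beta>" unfolding \<beta>_def by simp
    then show ?thesis using lG lQ GQ QG unfolding \<epsilon> h_def by linarith
  qed
  show ?thesis using \<xi> main by blast
qed

text \<open>A restricted isometry property of Haviv and Regev type. The error is stated in terms of the
  \<open>\<ell>\<^sub>1\<close>-norm of the coefficients, so it covers sparse sums (by Cauchy-Schwarz) as well as the
  non-sparse remainders that occur in the least squares estimate.\<close>

lemma universal_discretization:
  fixes e :: "'k \<Rightarrow> 'g \<Rightarrow> complex" and q m t :: nat
  assumes B: "finite B" and G: "finite G" "G \<noteq> {}"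
    and e: "\<And>k g. k \<in> B \<Longrightarrow> g \<in> G \<Longrightarrow> cmod (e k g) \<le> 1"
    and qG: "ln (4 * real (card G)) \<le> real q" and qB: "ln (4 * real (card B)) \<le> real q" and m: "m > 0"
  defines "\<epsilon> \<equiv> 18 * (real t + 1) * (256 * (real q)\<^sup>2 + real t + 2) / real m + 3 * (1/4) ^ t"
  shows "\<exists>\<xi>::nat \<Rightarrow> 'g. (\<forall>j. \<xi> j \<in> G) \<and> (\<forall>c.
      (\<Sum>g\<in>G. (cmod (\<Sum>k\<in>B. c k * e k g))\<^sup>2) / real (card G)
        \<le> 108 * ((\<Sum>j<m. (cmod (\<Sum>k\<in>B. c k * e k (\<xi> j)))\<^sup>2) / real m) + 4 * \<epsilon> * (\<Sum>k\<in>B. cmod (c k))\<^sup>2 \<and>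
      (\<Sum>j<m. (cmod (\<Sum>k\<in>B. c k * e k (\<xi> j)))\<^sup>2) / real m
        \<le> 108 * ((\<Sum>g\<in>G. (cmod (\<Sum>k\<in>B. c k * e k g))\<^sup>2) / real (card G)) + 4 * \<epsilon> * (\<Sum>k\<in>B. cmod (c k))\<^sup>2)"
proof (cases "B = {}")
  case True
  then show ?thesis using G by (intro exI[of _ "\<lambda>_. SOME g. g \<in> G"]) (auto simp: some_in_eq)
next
  case False
  obtain \<xi> where \<xi>: "\<forall>j. \<xi> j \<in> G" and unit:
    "\<forall>c. (\<Sum>k\<in>B. \<bar>Re (c k)\<bar> + \<bar>Im (c k)\<bar>) = 1 \<longrightarrow>
      (\<Sum>g\<in>G. (cmod (\<Sum>k\<in>B. c k * e k g))\<^sup>2) / real (card G)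
        \<le> 108 * ((\<Sum>j<m. (cmod (\<Sum>k\<in>B. c k * e k (\<xi> j)))\<^sup>2) / real m) + \<epsilon> \<and>
      (\<Sum>j<m. (cmod (\<Sum>k\<in>B. c k * e k (\<xi> j)))\<^sup>2) / real m
        \<le> 108 * ((\<Sum>g\<in>G. (cmod (\<Sum>k\<in>B. c k * e k g))\<^sup>2) / real (card G)) + \<epsilon>"
    using universal_discretization_unit[OF B False G _ qG qB m, where e = e and t = t] e unfolding \<epsilon>_def by blast
  have \<epsilon>0: "\<epsilon> \<ge> 0" unfolding \<epsilon>_def by simp
  have main: "(\<Sum>g\<in>G. (cmod (\<Sum>k\<in>B. c k * e k g))\<^sup>2) / real (card G)
        \<le> 108 * ((\<Sum>j<m. (cmod (\<Sum>k\<in>B. c k * e k (\<xi> j)))\<^sup>2) / real m) + 4 * \<epsilon> * (\<Sum>k\<in>B. cmod (c k))\<^sup>2 \<and>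
      (\<Sum>j<m. (cmod (\<Sum>k\<in>B. c k * e k (\<xi> j)))\<^sup>2) / real m
        \<le> 108 * ((\<Sum>g\<in>G. (cmod (\<Sum>k\<in>B. c k * e k g))\<^sup>2) / real (card G)) + 4 * \<epsilon> * (\<Sum>k\<in>B. cmod (c k))\<^sup>2" for c
  proof (cases "\<forall>k\<in>B. c k = 0")
    case True
    then show ?thesis by simp
  next
    case False
    define A where "A = (\<Sum>k\<in>B. \<bar>Re (c k)\<bar> + \<bar>Im (c k)\<bar>)"
    obtain k0 where k0: "k0 \<in> B" "c k0 \<noteq> 0" using False by blast
    have A0: "A > 0" unfolding A_def using k0 B
      by (intro sum_pos2[of _ k0]) (auto simp: complex_eq_iff)
    \<comment> \<open>Both inequalities are homogeneous of degree 2 in c. The normalisation by real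
      and imaginary parts is at most twice the sum of moduli, hence the factor 4 at
      \<epsilon>.\<close>
    have A2: "A\<^sup>2 \<le> 4 * (\<Sum>k\<in>B. cmod (c k))\<^sup>2"
    proof -
      have "A \<le> (\<Sum>k\<in>B. 2 * cmod (c k))"
        unfolding A_def using abs_Re_le_cmod abs_Im_le_cmod by (intro sum_mono) (smt (verit))
      then have "A\<^sup>2 \<le> (2 * (\<Sum>k\<in>B. cmod (c k)))\<^sup>2" using A0 by (intro power_mono) (auto simp: sum_distrib_left)
      then show ?thesis by (simp add: power_mult_distrib)
    qed
    define c' where "c' k = c k / of_real A" for k
    have c': "(\<Sum>k\<in>B. \<bar>Re (c' k)\<bar> + \<bar>Im (c' k)\<bar>) = 1"
      using A0 unfolding c'_def
      by (simp add: Re_divide_of_real Im_divide_of_real add_divide_distrib[symmetric] sum_divide_distrib[symmetric] flip: A_def)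
    have sc: "(cmod (\<Sum>k\<in>B. c' k * e k g))\<^sup>2 = (cmod (\<Sum>k\<in>B. c k * e k g))\<^sup>2 / A\<^sup>2" for g
    proof -
      have "(\<Sum>k\<in>B. c' k * e k g) = (\<Sum>k\<in>B. c k * e k g) / of_real A"
        unfolding c'_def by (simp add: sum_divide_distrib)
      then show ?thesis using A0 by (simp add: norm_divide power_divide)
    qed
    have *: "X \<le> 108 * Y + 4 * \<epsilon> * (\<Sum>k\<in>B. cmod (c k))\<^sup>2" if "X / A\<^sup>2 \<le> 108 * (Y / A\<^sup>2) + \<epsilon>" for X Y
    proof -
      have "X \<le> 108 * Y + \<epsilon> * A\<^sup>2" using that A0 by (simp add: field_simps)
      also have "\<dots> \<le> 108 * Y + \<epsilon> * (4 * (\<Sum>k\<in>B. cmod (c k))\<^sup>2)" using A2 \<epsilon>0 by (intro add_left_mono mult_left_mono)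
      finally show ?thesis by (simp add: mult_ac)
    qed
    show ?thesis
      using unit[rule_format, OF c'] by (intro conjI *) (simp_all add: sc sum_divide_distrib[symmetric] mult.commute)
  qed
  show ?thesis using \<xi> main by blast
qed

section \<open>Fourier analysis on the torus\<close>

lemma expk_add: "expk (k + l) x = expk k x * expk l x"
  by (simp add: expk_def kx_def distrib_left distrib_right sum.distrib flip: exp_add)

lemma expk_zero [simp]: "expk 0 x = 1"
  by (simp add: expk_def kx_def)

lemma kx_uminus: "kx (- k) x = - kx k x"
  by (simp add: kx_def sum_negf)

lemma cnj_expk: "cnj (expk k x) = expk (- k) x"
  by (simp add: expk_def kx_uminus exp_cnj)

lemma norm_expk [simp]: "cmod (expk k x) = 1"
  by (simp add: expk_def)

lemma fhat_alt: "fhat f k = (1 / (2*pi) ^ CARD('d)) *\<^sub>R (LINT x:torus_cube|lborel. f x * expk (- k) x)"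
  for f :: "real^'d \<Rightarrow> complex"
  unfolding fhat_def expk_def by (simp add: kx_uminus)

lemma continuous_expk [continuous_intros]: "continuous_on S (expk k)"
  unfolding expk_def kx_def by (intro continuous_intros)

lemma norm_trig_sum_square:
  "complex_of_real ((cmod (\<Sum>k\<in>B. c k * expk k x))\<^sup>2)
    = (\<Sum>k\<in>B. \<Sum>l\<in>B. c k * cnj (c l) * expk (k - l) x)"
proof -
  have "complex_of_real ((cmod (\<Sum>k\<in>B. c k * expk k x))\<^sup>2)
      = (\<Sum>k\<in>B. c k * expk k x) * cnj (\<Sum>l\<in>B. c l * expk l x)"
    by (rule complex_norm_square)
  also have "\<dots> = (\<Sum>k\<in>B. \<Sum>l\<in>B. c k * cnj (c l) * expk (k - l) x)"
    unfolding cnj_sum sum_product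
    by (intro sum.cong refl) (simp add: cnj_expk expk_add[of _ "- _", simplified] mult_ac)
  finally show ?thesis .
qed

text \<open>Kept abstract in E because orthogonality is used twice, for sums over the grid and for
  integrals over the torus.\<close>

lemma sum_sum_diagonal:
  fixes c :: "(int^'d) \<Rightarrow> complex"
  assumes "finite B" and "\<And>k l. k \<in> B \<Longrightarrow> l \<in> B \<Longrightarrow> E (k - l) = (if k - l = 0 then K else 0)"
  shows "(\<Sum>k\<in>B. \<Sum>l\<in>B. c k * cnj (c l) * E (k - l)) = of_real (\<Sum>k\<in>B. (cmod (c k))\<^sup>2) * K"
proof -
  have "(\<Sum>k\<in>B. \<Sum>l\<in>B. c k * cnj (c l) * E (k - l)) = (\<Sum>k\<in>B. \<Sum>l\<in>B. if k = l then c k * cnj (c k) * K else 0)"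
    using assms(2) by (intro sum.cong refl) auto
  also have "\<dots> = (\<Sum>k\<in>B. c k * cnj (c k) * K)"
    using assms(1) by (simp add: sum.delta)
  also have "\<dots> = of_real (\<Sum>k\<in>B. (cmod (c k))\<^sup>2) * K"
    by (simp add: sum_distrib_right complex_norm_square del: of_real_power)
  finally show ?thesis .
qed

section \<open>Orthogonality on an equidistant grid\<close>

definition grid :: "nat \<Rightarrow> ('d \<Rightarrow> nat) set" where
  "grid P = PiE UNIV (\<lambda>_. {..<P})"

definition grid_point :: "nat \<Rightarrow> ('d \<Rightarrow> nat) \<Rightarrow> real^'d" where
  "grid_point P g = (\<chi> i. 2 * pi * real (g i) / real P)"

lemma finite_grid: "finite (grid P :: ('d::finite \<Rightarrow> nat) set)"
  unfolding grid_def by (intro finite_PiE) auto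

lemma card_grid: "card (grid P :: ('d::finite \<Rightarrow> nat) set) = P ^ CARD('d)"
  unfolding grid_def by (subst card_PiE) auto

lemma grid_point_in_torus_cube: "g \<in> grid P \<Longrightarrow> grid_point P g \<in> torus_cube"
  unfolding grid_def grid_point_def torus_cube_def
proof safe
  fix i assume "g \<in> PiE UNIV (\<lambda>_. {..<P})"
  then have "g i < P" by auto
  then have "2 * pi * (real (g i) / real P) < 2 * pi * 1" by (intro mult_strict_left_mono) auto
  then show "(\<chi> i. 2 * pi * real (g i) / real P) $ i < 2 * pi" by simp
qed simp

text \<open>The sum factors over the coordinates, which is why grid points are indexed by functions.
  A coordinate with k_i nonzero contributes a geometric sum over a P-th root of unity, different
  from 1 because |k_i| < P.\<close>

lemma sum_grid_expk:
  fixes k :: "int^'d"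
  assumes "\<And>i. \<bar>k$i\<bar> < int P"
  shows "(\<Sum>g\<in>grid P. expk k (grid_point P g)) = (if k = 0 then of_nat (card (grid P :: ('d \<Rightarrow> nat) set)) else 0)"
proof (cases "k = 0")
  case False
  then obtain i0 where i0: "k$i0 \<noteq> 0" by (auto simp: vec_eq_iff)
  have P: "P > 0" using assms[of i0] by (cases P) auto
  define z where "z i = exp (\<i> * of_real (2 * pi * real_of_int (k$i) / real P))" for i
  have "expk k (grid_point P g) = (\<Prod>i\<in>UNIV. z i ^ g i)" for g
    unfolding expk_def kx_def grid_point_def z_def
    by (simp add: sum_distrib_left exp_sum mult_ac flip: exp_of_nat_mult)
  then have "(\<Sum>g\<in>grid P. expk k (grid_point P g)) = (\<Prod>i\<in>UNIV. \<Sum>n<P. z i ^ n)"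
    unfolding grid_def by (simp add: prod_sum_PiE)
  also have "(\<Sum>n<P. z i0 ^ n) = 0"
  proof -
    have "z i0 \<noteq> 1"
    proof
      assume "z i0 = 1"
      then obtain n :: int where "2 * pi * real_of_int (k$i0) / real P = 2 * of_int n * pi"
        unfolding z_def by (auto simp: exp_eq_1)
      then have "real_of_int (k$i0) = real_of_int (n * int P)" using P by (simp add: field_simps)
      then have "k$i0 = n * int P" by linarith
      then show False using assms[of i0] i0
        by (metis abs_mult abs_of_nat dvd_imp_le_int dvd_triv_right not_less)
    qed
    moreover have "z i0 ^ P = 1"
    proof -
      have "z i0 ^ P = exp (\<i> * of_real (2 * pi * real_of_int (k$i0)))"
        unfolding z_def using P by (simp flip: exp_of_nat_mult)
      also have "\<dots> = 1" by (auto simp: exp_eq_1)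
      finally show ?thesis .
    qed
    ultimately show ?thesis by (simp add: sum_gp_strict)
  qed
  then have "(\<Prod>i\<in>UNIV. \<Sum>n<P. z i ^ n) = 0" by (auto intro!: prod_zero)
  finally show ?thesis using False by simp
qed simp

text \<open>There is no aliasing: differences of frequencies are at most 2 H < P in each
  coordinate.\<close>

lemma grid_parseval:
  fixes c :: "int^'d \<Rightarrow> complex"
  assumes B: "finite B" "\<And>k i. k \<in> B \<Longrightarrow> \<bar>k$i\<bar> \<le> int H" and P: "2 * H < P"
  shows "(\<Sum>g\<in>grid P. (cmod (\<Sum>k\<in>B. c k * expk k (grid_point P g)))\<^sup>2) / real (card (grid P :: ('d \<Rightarrow> nat) set))
    = (\<Sum>k\<in>B. (cmod (c k))\<^sup>2)"
proof -
  let ?G = "grid P :: ('d \<Rightarrow> nat) set"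
  have orth: "(\<Sum>g\<in>?G. expk (k - l) (grid_point P g)) = (if k - l = 0 then of_nat (card ?G) else 0)"
    if "k \<in> B" "l \<in> B" for k l
  proof (rule sum_grid_expk)
    show "\<bar>(k - l)$i\<bar> < int P" for i
      using B(2)[OF that(1), of i] B(2)[OF that(2), of i] P by auto
  qed
  have "complex_of_real (\<Sum>g\<in>?G. (cmod (\<Sum>k\<in>B. c k * expk k (grid_point P g)))\<^sup>2)
      = (\<Sum>k\<in>B. \<Sum>l\<in>B. c k * cnj (c l) * (\<Sum>g\<in>?G. expk (k - l) (grid_point P g)))"
    unfolding of_real_sum norm_trig_sum_square sum_distrib_left
    by (subst sum.swap, intro sum.cong refl, rule sum.swap)
  also have "\<dots> = of_real (\<Sum>k\<in>B. (cmod (c k))\<^sup>2) * of_nat (card ?G)"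
    by (rule sum_sum_diagonal[where E = "\<lambda>k. \<Sum>g\<in>?G. expk k (grid_point P g)", OF B(1) orth])
  also have "\<dots> = complex_of_real ((\<Sum>k\<in>B. (cmod (c k))\<^sup>2) * real (card ?G))" by simp
  finally have "(\<Sum>g\<in>?G. (cmod (\<Sum>k\<in>B. c k * expk k (grid_point P g)))\<^sup>2) = (\<Sum>k\<in>B. (cmod (c k))\<^sup>2) * real (card ?G)"
    unfolding of_real_eq_iff .
  moreover have "card ?G > 0" using P by (simp add: card_grid)
  ultimately show ?thesis by simp
qed

section \<open>Integration over the cube and Parseval's identity\<close>

lemma torus_cube_borel [measurable]: "torus_cube \<in> sets borel"
proof -
  have "torus_cube = (\<Inter>i. {x::real^'a. 0 \<le> x$i} \<inter> {x. x$i < 2*pi})"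
    by (auto simp: torus_cube_def)
  also have "\<dots> \<in> sets borel" by measurable
  finally show ?thesis .
qed

lemma indicator_torus_cube:
  "indicator (torus_cube :: (real^'d) set) x = (\<Prod>b\<in>Basis. indicator {0..<2*pi} (x \<bullet> b) :: real)"
proof (cases "x \<in> torus_cube")
  case True
  then show ?thesis unfolding torus_cube_def by (auto simp: Basis_vec_def inner_axis intro!: prod.neutral)
next
  case False
  then obtain i where "\<not> (0 \<le> x$i \<and> x$i < 2*pi)" by (auto simp: torus_cube_def)
  then have "indicator {0..<2*pi} (x \<bullet> axis i 1) = (0::real)" by (simp add: inner_axis)
  moreover have "axis i (1::real) \<in> Basis" by (auto simp: Basis_vec_def)
  ultimately have "(\<Prod>b\<in>Basis. indicator {0..<2*pi} (x \<bullet> b)) = (0::real)"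
    by (intro prod_zero bexI[of _ "axis i 1"]) auto
  then show ?thesis using False by simp
qed

lemma integral_exp_period:
  fixes n :: int
  shows "integrable lborel (\<lambda>t. indicator {0..<2*pi} t *\<^sub>R exp (\<i> * complex_of_real (real_of_int n * t)))"
    and "(\<integral>t. indicator {0..<2*pi} t *\<^sub>R exp (\<i> * complex_of_real (real_of_int n * t)) \<partial>lborel)
      = (if n = 0 then complex_of_real (2 * pi) else 0)"
proof -
  let ?f = "\<lambda>t. exp (\<i> * complex_of_real (real_of_int n * t))"
  let ?F = "\<lambda>t. if n = 0 then complex_of_real t else ?f t / (\<i> * of_int n)"
  have "(?F has_vector_derivative ?f t) (at t within {0..2*pi})" for t
  proof (cases "n = 0")
    case True
    then show ?thesis by (auto intro!: derivative_eq_intros simp: has_vector_derivative_def scaleR_conv_of_real)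
  next
    case False
    have "((\<lambda>z. exp (\<i> * of_int n * z) / (\<i> * of_int n)) has_field_derivative ?f t) (at (complex_of_real t))"
      using False by (auto intro!: derivative_eq_intros simp: mult_ac)
    then have "((\<lambda>t. exp (\<i> * of_int n * complex_of_real t) / (\<i> * of_int n)) has_vector_derivative ?f t) (at t within {0..2*pi})"
      by (rule has_vector_derivative_real_field)
    then show ?thesis using False by (simp add: mult.assoc)
  qed
  then have "has_bochner_integral lborel (\<lambda>t. indicator {0..2*pi} t *\<^sub>R ?f t) (?F (2*pi) - ?F 0)"
    by (intro has_bochner_integral_FTC_Icc) (auto intro!: continuous_intros)
  moreover have "?F (2*pi) - ?F 0 = (if n = 0 then complex_of_real (2 * pi) else 0)"
  proof -
    have "?f (2*pi) = 1" by (auto simp: exp_eq_1)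
    then show ?thesis by auto
  qed
  ultimately have h: "has_bochner_integral lborel (\<lambda>t. indicator {0..2*pi} t *\<^sub>R ?f t) (if n = 0 then complex_of_real (2 * pi) else 0)"
    by simp
  have ae: "AE t in lborel. indicator {0..<2*pi} t *\<^sub>R ?f t = indicator {0..2*pi} t *\<^sub>R ?f t"
    using AE_lborel_singleton[of "2*pi"] by eventually_elim (auto simp: indicator_def)
  have [measurable]: "?f \<in> borel_measurable borel"
    by (intro borel_measurable_continuous_onI continuous_intros)
  have "has_bochner_integral lborel (\<lambda>t. indicator {0..<2*pi} t *\<^sub>R ?f t) (if n = 0 then complex_of_real (2 * pi) else 0)"
    by (rule has_bochner_integralI_AE[OF h]) (use ae in \<open>auto elim: AE_mp\<close>)
  then show "integrable lborel (\<lambda>t. indicator {0..<2*pi} t *\<^sub>R ?f t)"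
    and "(\<integral>t. indicator {0..<2*pi} t *\<^sub>R ?f t \<partial>lborel) = (if n = 0 then complex_of_real (2 * pi) else 0)"
    by (auto simp: has_bochner_integral_iff)
qed

text \<open>The integrand is a product of functions of single coordinates, so writing Lebesgue
  measure as the image of a product measure reduces the claim to one-dimensional integrals over a
  period.\<close>

lemma integral_expk:
  fixes k :: "int^'d"
  shows "(LINT x:torus_cube|lborel. expk k x) = (if k = 0 then (2*pi) ^ CARD('d) else 0)"
proof -
  define K :: "real^'d" where "K = (\<chi> i. real_of_int (k$i))"
  \<comment> \<open>The product runs over basis vectors instead of indices; the floor recovers the
    integer k_i from the basis vector \<open>axis i 1\<close>.\<close>
  define n where "n b = \<lfloor>K \<bullet> b\<rfloor>" for b
  define \<phi> where "\<phi> b t = indicator {0..<2*pi} t *\<^sub>R exp (\<i> * complex_of_real (real_of_int (n b) * t))" for b t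
  have Kn: "K \<bullet> b = real_of_int (n b)" if "b \<in> Basis" for b
    using that by (auto simp: Basis_vec_def K_def n_def inner_axis)
  have n0: "k = 0 \<longleftrightarrow> (\<forall>b\<in>Basis. n b = 0)"
  proof -
    have "n (axis i 1) = k$i" for i by (simp add: n_def K_def inner_axis)
    then show ?thesis by (auto simp: Basis_vec_def vec_eq_iff)
  qed
  have point: "indicator torus_cube x *\<^sub>R expk k x = (\<Prod>b\<in>Basis. \<phi> b (x \<bullet> b))" for x
  proof -
    have "kx k x = K \<bullet> x" by (simp add: kx_def K_def inner_vec_def)
    also have "\<dots> = (\<Sum>b\<in>Basis. real_of_int (n b) * (x \<bullet> b))"
      unfolding euclidean_inner[of K x] using Kn by (intro sum.cong refl) auto
    finally have "expk k x = (\<Prod>b\<in>Basis. exp (\<i> * complex_of_real (real_of_int (n b) * (x \<bullet> b))))"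
      unfolding expk_def by (simp add: sum_distrib_left exp_sum)
    then show ?thesis
      unfolding \<phi>_def indicator_torus_cube scaleR_conv_of_real of_real_prod prod.distrib by simp
  qed
  interpret product_sigma_finite "\<lambda>_::real^'d. lborel :: real measure" by standard
  have meas: "(\<lambda>x. indicator torus_cube x *\<^sub>R expk k x) \<in> borel_measurable borel"
    by (intro borel_measurable_scaleR borel_measurable_indicator torus_cube_borel
        borel_measurable_continuous_onI continuous_intros)
  have "(LINT x:torus_cube|lborel. expk k x)
      = (\<integral>f. indicator torus_cube (\<Sum>b\<in>Basis. f b *\<^sub>R b) *\<^sub>R expk k (\<Sum>b\<in>Basis. f b *\<^sub>R b) \<partial>(\<Pi>\<^sub>M b\<in>(Basis::(real^'d) set). lborel))"
    unfolding set_lebesgue_integral_def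
    by (subst lborel_eq) (intro integral_distr, use meas in measurable)
  also have "\<dots> = (\<integral>f. (\<Prod>b\<in>Basis. \<phi> b (f b)) \<partial>(\<Pi>\<^sub>M b\<in>(Basis::(real^'d) set). lborel))"
    unfolding point by (intro Bochner_Integration.integral_cong refl prod.cong) simp
  also have "\<dots> = (\<Prod>b\<in>(Basis::(real^'d) set). \<integral>t. \<phi> b t \<partial>lborel)"
    unfolding \<phi>_def by (intro product_integral_prod integral_exp_period) simp
  also have "\<dots> = (\<Prod>b\<in>(Basis::(real^'d) set). if n b = 0 then complex_of_real (2 * pi) else 0)"
    unfolding \<phi>_def integral_exp_period ..
  also have "\<dots> = (if k = 0 then (2*pi) ^ CARD('d) else 0)"
    unfolding n0 by (auto simp: prod_zero_iff)
  finally show ?thesis by simp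
qed

abbreviation cube_closure :: "(real^'d) set" where
  "cube_closure \<equiv> cbox 0 (\<chi> i. 2 * pi)"

lemma torus_cube_subset_closure: "torus_cube \<subseteq> (cube_closure :: (real^'d) set)"
  by (auto simp: torus_cube_def mem_box_cart less_imp_le)

lemma box_subset_torus_cube: "box 0 (\<chi> i. 2 * pi) \<subseteq> (torus_cube :: (real^'d) set)"
  by (auto simp: torus_cube_def mem_box_cart less_imp_le)

lemma emeasure_torus_cube: "emeasure lborel (torus_cube :: (real^'d) set) = ennreal ((2 * pi) ^ CARD('d))"
proof -
  have fin: "emeasure lborel (torus_cube :: (real^'d) set) < \<infinity>"
    by (rule order_le_less_trans[OF emeasure_mono[OF torus_cube_subset_closure] emeasure_lborel_cbox_finite]) simp
  have "(LINT x:(torus_cube::(real^'d) set)|lborel. expk 0 x) = complex_of_real (measure lborel (torus_cube :: (real^'d) set))"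
    using fin by (simp add: set_lebesgue_integral_def scaleR_conv_of_real)
  then have "complex_of_real (measure lborel (torus_cube :: (real^'d) set)) = complex_of_real ((2 * pi) ^ CARD('d))"
    using integral_expk[where k = "0 :: int^'d"] by simp
  then have "measure lborel (torus_cube :: (real^'d) set) = (2 * pi) ^ CARD('d)"
    unfolding of_real_eq_iff .
  then show ?thesis using fin by (simp add: emeasure_eq_ennreal_measure)
qed

lemma set_integrable_torus:
  fixes f :: "real^'d \<Rightarrow> 'b::{banach, second_countable_topology}"
  assumes "continuous_on UNIV f"
  shows "set_integrable lborel torus_cube f"
proof -
  have "set_integrable lborel cube_closure f"
    using assms continuous_on_subset[OF assms] unfolding set_integrable_def
    by (intro borel_integrable_compact) auto
  then show ?thesis
    by (rule set_integrable_subset) (use torus_cube_subset_closure in auto)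
qed

lemma torus_integral_sum:
  fixes f :: "'i \<Rightarrow> real^'d \<Rightarrow> complex"
  assumes "\<And>i. i \<in> I \<Longrightarrow> continuous_on UNIV (f i)"
  shows "(LINT x:torus_cube|lborel. \<Sum>i\<in>I. f i x) = (\<Sum>i\<in>I. LINT x:torus_cube|lborel. f i x)"
  unfolding set_lebesgue_integral_def scaleR_sum_right
  by (rule Bochner_Integration.integral_sum)
     (use set_integrable_torus[OF assms] in \<open>auto simp: set_integrable_def\<close>)

lemma norm_torus_integral_le:
  fixes f :: "real^'d \<Rightarrow> 'b::{banach, second_countable_topology}"
  assumes "continuous_on UNIV f" "\<And>x. x \<in> torus_cube \<Longrightarrow> norm (f x) \<le> C"
  shows "norm (LINT x:torus_cube|lborel. f x) \<le> C * (2 * pi) ^ CARD('d)"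
proof -
  have "norm (LINT x:torus_cube|lborel. f x) \<le> (LINT x:torus_cube|lborel. norm (f x))"
    using set_integral_norm_bound[OF set_integrable_torus[OF assms(1)]] by simp
  also have "\<dots> \<le> (LINT x:(torus_cube::(real^'d) set)|lborel. C)"
    using assms by (intro set_integral_mono set_integrable_torus continuous_intros) auto
  also have "\<dots> = C * (2 * pi) ^ CARD('d)"
    by (subst set_integral_const) (auto simp: emeasure_torus_cube measure_def)
  finally show ?thesis .
qed

lemma norm_fhat_le:
  fixes f :: "real^'d \<Rightarrow> complex"
  assumes "continuous_on UNIV f" "\<And>x. x \<in> torus_cube \<Longrightarrow> cmod (f x) \<le> C"
  shows "cmod (fhat f k) \<le> C"
proof -
  have "cmod (LINT x:torus_cube|lborel. f x * expk (- k) x) \<le> C * (2 * pi) ^ CARD('d)"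
    using assms by (intro norm_torus_integral_le continuous_intros) (auto simp: norm_mult)
  then show ?thesis unfolding fhat_alt by (simp add: field_simps)
qed

lemma fhat_diff:
  fixes f :: "real^'d \<Rightarrow> complex"
  assumes "continuous_on UNIV f" "continuous_on UNIV g"
  shows "fhat (\<lambda>x. f x - g x) k = fhat f k - fhat g k"
  unfolding fhat_alt left_diff_distrib
  by (subst set_integral_diff(2)) (use assms in \<open>auto intro!: set_integrable_torus continuous_intros simp: scaleR_diff_right\<close>)

lemma fhat_sum:
  fixes f :: "'i \<Rightarrow> real^'d \<Rightarrow> complex"
  assumes "\<And>i. i \<in> I \<Longrightarrow> continuous_on UNIV (f i)"
  shows "fhat (\<lambda>x. \<Sum>i\<in>I. f i x) k = (\<Sum>i\<in>I. fhat (f i) k)"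
  unfolding fhat_alt sum_distrib_right
  by (subst torus_integral_sum) (use assms in \<open>auto intro!: continuous_intros simp: scaleR_sum_right\<close>)

lemma fhat_trig_sum:
  fixes c :: "int^'d \<Rightarrow> complex"
  assumes "finite B"
  shows "fhat (\<lambda>x. \<Sum>k\<in>B. c k * expk k x) l = (if l \<in> B then c l else 0)"
proof -
  have one: "fhat (\<lambda>x. c k * expk k x) l = (if k = l then c l else 0)" for k
  proof -
    have "fhat (\<lambda>x. c k * expk k x) l = (1 / (2*pi) ^ CARD('d)) *\<^sub>R (c k * (LINT x:torus_cube|lborel. expk (k - l) x))"
      unfolding fhat_alt using expk_add[of k "- l"] by (simp add: mult.assoc)
    then show ?thesis by (simp add: integral_expk scaleR_conv_of_real)
  qed
  have "fhat (\<lambda>x. \<Sum>k\<in>B. c k * expk k x) l = (\<Sum>k\<in>B. fhat (\<lambda>x. c k * expk k x) l)"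
    by (rule fhat_sum) (intro continuous_intros)
  then show ?thesis using assms by (simp add: one)
qed

lemma torus_parseval:
  fixes c :: "int^'d \<Rightarrow> complex"
  assumes B: "finite B"
  shows "(LINT x:torus_cube|lborel. (cmod (\<Sum>k\<in>B. c k * expk k x))\<^sup>2) = (2 * pi) ^ CARD('d) * (\<Sum>k\<in>B. (cmod (c k))\<^sup>2)"
proof -
  have "complex_of_real (LINT x:torus_cube|lborel. (cmod (\<Sum>k\<in>B. c k * expk k x))\<^sup>2)
      = (LINT x:torus_cube|lborel. (\<Sum>k\<in>B. \<Sum>l\<in>B. c k * cnj (c l) * expk (k - l) x))"
    unfolding norm_trig_sum_square[symmetric] by (rule set_integral_complex_of_real[symmetric])
  also have "\<dots> = (\<Sum>k\<in>B. \<Sum>l\<in>B. c k * cnj (c l) * (LINT x:torus_cube|lborel. expk (k - l) x))"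
    by (simp add: torus_integral_sum continuous_intros)
  also have "\<dots> = of_real (\<Sum>k\<in>B. (cmod (c k))\<^sup>2) * complex_of_real ((2*pi) ^ CARD('d))"
    by (rule sum_sum_diagonal[where E = "\<lambda>k. LINT x:torus_cube|lborel. expk k x", OF B]) (simp add: integral_expk)
  also have "\<dots> = complex_of_real ((2 * pi) ^ CARD('d) * (\<Sum>k\<in>B. (cmod (c k))\<^sup>2))" by simp
  finally show ?thesis unfolding of_real_eq_iff .
qed

text \<open>On the cube |g|^2 is dominated by the continuous function 2 |p|^2 + 2 \<epsilon>^2, p
  being the polynomial, whose integral Parseval evaluates.\<close>

lemma L2norm_trig_perturbation_le:
  fixes c :: "int^'d \<Rightarrow> complex"
  assumes B: "finite B" and g: "\<And>x. x \<in> torus_cube \<Longrightarrow> cmod (g x - (\<Sum>k\<in>B. c k * expk k x)) \<le> \<epsilon>"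
    and D: "0 \<le> D" "2 * (\<Sum>k\<in>B. (cmod (c k))\<^sup>2) + 2 * \<epsilon>\<^sup>2 \<le> D\<^sup>2"
  shows "L2norm g \<le> ennreal D"
proof -
  let ?p = "\<lambda>x. \<Sum>k\<in>B. c k * expk k x"
  let ?V = "(2 * pi) ^ CARD('d) :: real"
  have cont: "continuous_on UNIV (\<lambda>x. 2 * (cmod (?p x))\<^sup>2 + 2 * \<epsilon>\<^sup>2)" by (intro continuous_intros)
  have pt: "(cmod (g x))\<^sup>2 \<le> 2 * (cmod (?p x))\<^sup>2 + 2 * \<epsilon>\<^sup>2" if "x \<in> torus_cube" for x
  proof -
    have "cmod (g x) \<le> cmod (?p x) + \<epsilon>" using g[OF that] norm_triangle_ineq2[of "g x" "?p x"] by linarith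
    then have "(cmod (g x))\<^sup>2 \<le> (cmod (?p x) + \<epsilon>)\<^sup>2" by (intro power_mono) auto
    also have "\<dots> \<le> 2 * (cmod (?p x))\<^sup>2 + 2 * \<epsilon>\<^sup>2" using sum_squares_bound[of "cmod (?p x)" \<epsilon>] by (simp add: power2_sum)
    finally show ?thesis .
  qed
  have int: "integrable lborel (\<lambda>x. indicator torus_cube x *\<^sub>R (2 * (cmod (?p x))\<^sup>2 + 2 * \<epsilon>\<^sup>2))"
    using set_integrable_torus[OF cont] unfolding set_integrable_def .
  have "(\<integral>\<^sup>+ x. ennreal ((cmod (g x))\<^sup>2) * indicator torus_cube x \<partial>lborel)
      \<le> (\<integral>\<^sup>+ x. ennreal (indicator torus_cube x *\<^sub>R (2 * (cmod (?p x))\<^sup>2 + 2 * \<epsilon>\<^sup>2)) \<partial>lborel)"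
    using pt by (intro nn_integral_mono) (auto simp: indicator_def simp del: ennreal_plus intro!: ennreal_leI)
  also have "\<dots> = ennreal (LINT x:torus_cube|lborel. 2 * (cmod (?p x))\<^sup>2 + 2 * \<epsilon>\<^sup>2)"
    unfolding set_lebesgue_integral_def by (rule nn_integral_eq_integral[OF int]) (auto simp: indicator_def)
  also have "(LINT x:torus_cube|lborel. 2 * (cmod (?p x))\<^sup>2 + 2 * \<epsilon>\<^sup>2)
      = 2 * (LINT x:torus_cube|lborel. (cmod (?p x))\<^sup>2) + (LINT x:(torus_cube::(real^'d) set)|lborel. 2 * \<epsilon>\<^sup>2)"
    by (subst set_integral_add(2)) (auto intro!: set_integrable_torus continuous_intros)
  also have "\<dots> = ?V * (2 * (\<Sum>k\<in>B. (cmod (c k))\<^sup>2) + 2 * \<epsilon>\<^sup>2)"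
    unfolding torus_parseval[OF B] by (subst set_integral_const) (auto simp: emeasure_torus_cube measure_def algebra_simps)
  finally have "(\<integral>\<^sup>+ x. ennreal ((cmod (g x))\<^sup>2) * indicator torus_cube x \<partial>lborel) \<le> ennreal (?V * D\<^sup>2)"
    by (rule order_trans) (use D in \<open>auto intro!: ennreal_leI mult_left_mono\<close>)
  then have "ennreal (1 / ?V) * (\<integral>\<^sup>+ x. ennreal ((cmod (g x))\<^sup>2) * indicator torus_cube x \<partial>lborel)
      \<le> ennreal (1 / ?V) * ennreal (?V * D\<^sup>2)"
    by (intro mult_left_mono) auto
  also have "\<dots> = ennreal (D\<^sup>2)" by (simp flip: ennreal_mult')
  finally have le: "ennreal (1 / ?V) * (\<integral>\<^sup>+ x. ennreal ((cmod (g x))\<^sup>2) * indicator torus_cube x \<partial>lborel) \<le> ennreal (D\<^sup>2)" .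
  then have "enn2real (ennreal (1 / ?V) * (\<integral>\<^sup>+ x. ennreal ((cmod (g x))\<^sup>2) * indicator torus_cube x \<partial>lborel)) \<le> D\<^sup>2"
    by (intro enn2real_leI) auto
  then have "sqrt (enn2real (ennreal (1 / ?V) * (\<integral>\<^sup>+ x. ennreal ((cmod (g x))\<^sup>2) * indicator torus_cube x \<partial>lborel))) \<le> D"
    using D(1) by (simp add: real_le_lsqrt)
  then show ?thesis using le unfolding L2norm_def Let_def by (auto intro!: ennreal_leI simp: top_unique)
qed

section \<open>Density of trigonometric polynomials and uniqueness of Fourier coefficients\<close>

inductive trig_poly :: "(real^'d \<Rightarrow> complex) \<Rightarrow> bool" where
  monom: "trig_poly (\<lambda>x. c * expk k x)"
| add: "trig_poly p \<Longrightarrow> trig_poly q \<Longrightarrow> trig_poly (\<lambda>x. p x + q x)"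

lemma trig_poly_const: "trig_poly (\<lambda>x. c)"
  using trig_poly.monom[of c 0] by simp

lemma trig_poly_sum: "finite I \<Longrightarrow> (\<And>i. i \<in> I \<Longrightarrow> trig_poly (p i)) \<Longrightarrow> trig_poly (\<lambda>x. \<Sum>i\<in>I. p i x)"
  by (induction rule: finite_induct) (auto intro: trig_poly.add trig_poly_const)

lemma trig_poly_mult:
  assumes "trig_poly p" "trig_poly q"
  shows "trig_poly (\<lambda>x. p x * q x)"
  using assms(1)
proof induction
  case (monom c k)
  from assms(2) show ?case
  proof induction
    case (monom c' l)
    have "(\<lambda>x. c * expk k x * (c' * expk l x)) = (\<lambda>x. (c * c') * expk (k + l) x)"
      by (simp add: expk_add mult_ac)
    then show ?case by (simp only: trig_poly.monom)
  qed (simp add: distrib_left trig_poly.add)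
qed (simp add: distrib_right trig_poly.add)

lemma continuous_trig_poly: "trig_poly p \<Longrightarrow> continuous_on UNIV p"
  by (induction rule: trig_poly.induct) (auto intro!: continuous_intros)

definition torus_map :: "real^'d \<Rightarrow> complex^'d" where
  "torus_map x = (\<chi> i. exp (\<i> * complex_of_real (x$i)))"

text \<open>The real coordinates of \<open>torus_map x\<close> are cos x_i and sin x_i, combinations
  of two exponentials; sums and products stay trigonometric polynomials.\<close>

lemma trig_poly_real_polynomial:
  fixes q :: "complex^'d \<Rightarrow> real"
  assumes "real_polynomial_function q"
  shows "trig_poly (\<lambda>x. complex_of_real (q (torus_map x)))"
  using assms
proof induction
  case (linear q)
  interpret q: bounded_linear q by fact
  have coord: "trig_poly (\<lambda>x. complex_of_real (torus_map x \<bullet> b))" if "b \<in> Basis" for b :: "complex^'d"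
  proof -
    obtain i w where b: "b = axis i w" "w \<in> Basis" using \<open>b \<in> Basis\<close> by (auto simp: Basis_vec_def)
    have e1: "expk (axis i 1) x = exp (\<i> * complex_of_real (x$i))" for x :: "real^'d"
    proof -
      have "kx (axis i 1) x = (\<Sum>j\<in>UNIV. if j = i then x$j else 0)"
        unfolding kx_def by (intro sum.cong) (auto simp: axis_def)
      then show ?thesis unfolding expk_def by simp
    qed
    have e2: "expk (- axis i 1) x = cnj (exp (\<i> * complex_of_real (x$i)))" for x :: "real^'d"
      unfolding cnj_expk[symmetric] e1 ..
    have t: "trig_poly (\<lambda>x. c * expk (axis i 1) x + c' * expk (- axis i 1) x)" for c c'
      by (intro trig_poly.intros)
    consider "w = 1" | "w = \<i>" using b by (auto simp: Basis_complex_def)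
    then show ?thesis
    proof cases
      case 1
      have "(\<lambda>x. complex_of_real (torus_map x \<bullet> b)) = (\<lambda>x. 1/2 * expk (axis i 1) x + 1/2 * expk (- axis i 1) x)"
        unfolding e1 e2 b 1 torus_map_def by (auto simp: inner_axis complex_eq_iff inner_complex_def)
      then show ?thesis by (simp only: t)
    next
      case 2
      have "(\<lambda>x. complex_of_real (torus_map x \<bullet> b)) = (\<lambda>x. (- \<i>/2) * expk (axis i 1) x + (\<i>/2) * expk (- axis i 1) x)"
        unfolding e1 e2 b 2 torus_map_def by (auto simp: inner_axis complex_eq_iff inner_complex_def)
      then show ?thesis by (simp only: t)
    qed
  qed
  have "q (torus_map x) = (\<Sum>b\<in>Basis. (torus_map x \<bullet> b) * q b)" for x
    by (subst euclidean_representation[symmetric]) (simp add: q.sum q.scaleR)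
  then have "(\<lambda>x. complex_of_real (q (torus_map x))) = (\<lambda>x. \<Sum>b\<in>Basis. complex_of_real (torus_map x \<bullet> b) * complex_of_real (q b))"
    by simp
  moreover have "trig_poly (\<lambda>x. \<Sum>b\<in>Basis. complex_of_real (torus_map x \<bullet> b) * complex_of_real (q b))"
    by (intro trig_poly_sum trig_poly_mult coord trig_poly_const) auto
  ultimately show ?case by (simp only:)
qed (auto intro: trig_poly_const trig_poly.add trig_poly_mult)

lemma periodic_shift_int:
  fixes f :: "real^'d \<Rightarrow> 'b" and n :: int
  assumes per: "\<And>x i. f (x + (2*pi) *\<^sub>R axis i 1) = f x"
  shows "f (x + (2 * pi * real_of_int n) *\<^sub>R axis i 1) = f x"
proof -
  have nat: "f (y + (2 * pi * real m) *\<^sub>R axis i 1) = f y" for y and m :: nat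
  proof (induction m)
    case (Suc m)
    have "y + (2 * pi * real (Suc m)) *\<^sub>R axis i 1 = (y + (2 * pi * real m) *\<^sub>R axis i 1) + (2*pi) *\<^sub>R axis i 1"
      by (simp add: algebra_simps flip: scaleR_left_distrib)
    then show ?case using per Suc by metis
  qed simp
  show ?thesis
  proof (cases "n \<ge> 0")
    case True
    then show ?thesis using nat[of x "nat n"] by simp
  next
    case False
    then show ?thesis using nat[of "x + (2 * pi * real_of_int n) *\<^sub>R axis i 1" "nat (- n)"] by simp
  qed
qed

lemma periodic_factors_through_torus_map:
  fixes f :: "real^'d \<Rightarrow> 'b"
  assumes per: "\<And>x i. f (x + (2*pi) *\<^sub>R axis i 1) = f x" and eq: "torus_map x = torus_map y"
  shows "f x = f y"
proof -
  have "\<exists>n::int. x$i = y$i + 2 * pi * real_of_int n" for i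
  proof -
    have "exp (\<i> * complex_of_real (x$i)) = exp (\<i> * complex_of_real (y$i))"
      using eq by (auto simp: torus_map_def vec_eq_iff)
    then show ?thesis unfolding exp_eq by (auto simp: complex_eq_iff mult_ac)
  qed
  then obtain n :: "'d \<Rightarrow> int" where n: "\<And>i. x$i = y$i + 2 * pi * real_of_int (n i)" by metis
  have "f (y + (\<Sum>i\<in>S. (2 * pi * real_of_int (n i)) *\<^sub>R axis i 1)) = f y" if "finite S" for S
    using that
  proof (induction S)
    case (insert i S)
    then show ?case
      using periodic_shift_int[of f "y + (\<Sum>i\<in>S. (2 * pi * real_of_int (n i)) *\<^sub>R axis i 1)" "n i" i, OF per]
      by (simp add: add_ac)
  qed simp
  moreover have "y + (\<Sum>i\<in>UNIV. (2 * pi * real_of_int (n i)) *\<^sub>R axis i 1) = x"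
    by (simp add: vec_eq_iff n axis_def if_distrib cong: if_cong)
  ultimately show ?thesis by (metis finite)
qed

text \<open>A periodic function factors through the compact torus \<open>{z. |z i| = 1}\<close>, on which Stone-Weierstrass
  applies to polynomials in the real coordinates of \<open>z\<close>.\<close>

lemma trig_poly_dense:
  fixes f :: "real^'d \<Rightarrow> complex"
  assumes cont: "continuous_on UNIV f" and per: "\<And>x i. f (x + (2*pi) *\<^sub>R axis i 1) = f x" and e: "e > 0"
  obtains p where "trig_poly p" "\<And>x. x \<in> cube_closure \<Longrightarrow> cmod (f x - p x) < e"
proof -
  let ?C = "cube_closure :: (real^'d) set"
  let ?T = "torus_map ` ?C"
  have ct: "continuous_on S (torus_map :: real^'d \<Rightarrow> _)" for S
    unfolding torus_map_def by (intro continuous_intros)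
  have comp: "compact ?T" by (intro compact_continuous_image ct compact_cbox)
  define G where "G z = f (SOME x. torus_map x = z)" for z
  have G: "G (torus_map x) = f x" for x
    unfolding G_def by (rule periodic_factors_through_torus_map[OF per]) (rule someI, rule refl)
  \<comment> \<open>The closed cube is compact, so \<open>torus_map\<close> sends closed subsets of
    it to closed sets; continuity therefore passes from f to G through preimages of closed
    sets.\<close>
  have "continuous_on ?T G"
    unfolding continuous_on_closed_vimage[OF compact_imp_closed[OF comp]]
  proof (intro allI impI)
    fix A :: "complex set" assume "closed A"
    have "G -` A \<inter> ?T = torus_map ` (f -` A \<inter> ?C)" using G by auto
    moreover have "closed (f -` A)" using \<open>closed A\<close> cont by (simp add: continuous_closed_vimage continuous_on_eq_continuous_at)
    then have "compact (f -` A \<inter> ?C)" by (intro closed_Int_compact compact_cbox)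
    ultimately show "closed (G -` A \<inter> ?T)" by (simp add: compact_imp_closed compact_continuous_image ct)
  qed
  from Stone_Weierstrass_polynomial_function[OF comp this e]
  obtain g where g: "polynomial_function g" "\<And>z. z \<in> ?T \<Longrightarrow> cmod (G z - g z) < e"
    by auto
  have "trig_poly (\<lambda>x. complex_of_real ((Re \<circ> g) (torus_map x)) + \<i> * complex_of_real ((Im \<circ> g) (torus_map x)))"
    using g(1) bounded_linear_Re bounded_linear_Im unfolding polynomial_function_def
    by (intro trig_poly.add trig_poly_mult trig_poly_const trig_poly_real_polynomial) blast+
  moreover have "complex_of_real ((Re \<circ> g) z) + \<i> * complex_of_real ((Im \<circ> g) z) = g z" for z
    by (simp add: complex_eq_iff)
  ultimately have "trig_poly (\<lambda>x. g (torus_map x))" by simp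
  moreover have "cmod (f x - g (torus_map x)) < e" if "x \<in> ?C" for x
    using g(2)[OF imageI[OF that]] unfolding G .
  ultimately show ?thesis by (rule that)
qed

text \<open>f is orthogonal to every trigonometric polynomial p, so the integral of |f|^2 equals
  that of f times the conjugate of f - p, which density makes arbitrarily small. Least squares uses
  point values, so vanishing at each point is wanted; continuity gives it.\<close>

lemma fourier_uniqueness:
  fixes f :: "real^'d \<Rightarrow> complex"
  assumes cont: "continuous_on UNIV f" and per: "\<And>x i. f (x + (2*pi) *\<^sub>R axis i 1) = f x"
    and zero: "\<And>k. fhat f k = 0" and x: "x \<in> torus_cube"
  shows "f x = 0"
proof -
  let ?C = "cube_closure :: (real^'d) set"
  let ?I = "LINT x:torus_cube|lborel. (cmod (f x))\<^sup>2"
  have orth: "(LINT x:torus_cube|lborel. f x * cnj (p x)) = 0" if "trig_poly p" for p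
    using that
  proof induction
    case (monom c k)
    have "(LINT x:torus_cube|lborel. f x * expk (- k) x) = 0" using zero[of k] unfolding fhat_alt by simp
    then show ?case by (simp add: cnj_expk mult.left_commute)
  next
    case (add p q)
    then show ?case
      by (simp add: distrib_left set_integral_add(2) set_integrable_torus continuous_intros cont continuous_trig_poly)
  qed
  have "compact (f ` ?C)" by (intro compact_continuous_image compact_cbox continuous_on_subset[OF cont]) auto
  then obtain M where M: "\<And>x. x \<in> ?C \<Longrightarrow> cmod (f x) \<le> M"
    using compact_imp_bounded[THEN bounded_iff[THEN iffD1]] by fastforce
  have bound: "?I \<le> M * e * (2*pi) ^ CARD('d)" if e: "e > 0" for e
  proof -
    obtain p where p: "trig_poly p" "\<And>x. x \<in> ?C \<Longrightarrow> cmod (f x - p x) < e"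
      using trig_poly_dense[OF cont per e] by blast
    have "complex_of_real ?I = (LINT x:torus_cube|lborel. f x * cnj (f x))"
      unfolding complex_norm_square[symmetric] by (rule set_integral_complex_of_real[symmetric])
    also have "\<dots> = (LINT x:torus_cube|lborel. f x * cnj (f x - p x)) + (LINT x:torus_cube|lborel. f x * cnj (p x))"
      by (subst set_integral_add(2)[symmetric])
         (auto intro!: set_integrable_torus continuous_intros cont continuous_trig_poly[OF p(1)] simp: algebra_simps)
    finally have "complex_of_real ?I = (LINT x:torus_cube|lborel. f x * cnj (f x - p x))" using orth[OF p(1)] by simp
    from arg_cong[OF this, of cmod]
    have "\<bar>?I\<bar> = cmod (LINT x:torus_cube|lborel. f x * cnj (f x - p x))" unfolding norm_of_real .
    also have "\<dots> \<le> M * e * (2*pi) ^ CARD('d)"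
    proof (rule norm_torus_integral_le)
      fix x :: "real^'d" assume "x \<in> torus_cube"
      then have xC: "x \<in> ?C" using torus_cube_subset_closure by blast
      have "0 \<le> M" using M[OF xC] norm_ge_zero order_trans by blast
      then show "cmod (f x * cnj (f x - p x)) \<le> M * e"
        unfolding norm_mult complex_mod_cnj using M[OF xC] p(2)[OF xC] by (intro mult_mono) auto
    qed (intro continuous_intros cont continuous_trig_poly p(1))
    finally show ?thesis by simp
  qed
  have "?I \<le> 0"
  proof (rule tendsto_lowerbound)
    show "((\<lambda>e. M * e * (2*pi) ^ CARD('d)) \<longlongrightarrow> 0) (at_right 0)"
      by (auto intro!: tendsto_eq_intros)
    show "\<forall>\<^sub>F e in at_right 0. ?I \<le> M * e * (2*pi) ^ CARD('d)"
      using bound by (auto simp: eventually_at_filter)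
  qed simp
  moreover have "?I \<ge> 0" unfolding set_lebesgue_integral_def by (intro integral_nonneg_AE) auto
  ultimately have "?I = 0" by simp
  moreover have "?I = integral torus_cube (\<lambda>x. (cmod (f x))\<^sup>2)"
    by (intro set_borel_integral_eq_integral set_integrable_torus continuous_intros cont)
  \<comment> \<open>The cube and its closure differ by a null set; on the closed box a continuous
    nonnegative function with integral 0 vanishes everywhere.\<close>
  moreover have "integral torus_cube (\<lambda>x. (cmod (f x))\<^sup>2) = integral ?C (\<lambda>x. (cmod (f x))\<^sup>2)"
  proof (rule integral_spike_set)
    have "negligible (?C - box 0 (\<chi> i. 2 * pi))" by (rule negligible_frontier_interval)
    then show "negligible {x \<in> torus_cube - ?C. (cmod (f x))\<^sup>2 \<noteq> 0}" "negligible {x \<in> ?C - torus_cube. (cmod (f x))\<^sup>2 \<noteq> 0}"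
      using torus_cube_subset_closure box_subset_torus_cube by (auto elim!: negligible_subset)
  qed
  ultimately have "integral ?C (\<lambda>x. (cmod (f x))\<^sup>2) = 0" by simp
  moreover have "continuous_on ?C (\<lambda>x. (cmod (f x))\<^sup>2)" by (intro continuous_intros continuous_on_subset[OF cont]) auto
  moreover have "(\<chi> i. pi) \<in> box 0 ((\<chi> i. 2 * pi) :: real^'d)" by (simp add: mem_box_cart)
  then have "box 0 (\<chi> i. 2 * pi) \<noteq> ({} :: (real^'d) set)" by blast
  ultimately have "\<forall>x\<in>?C. (cmod (f x))\<^sup>2 = 0" by (subst (asm) integral_cbox_eq_0_iff) auto
  then show ?thesis using x torus_cube_subset_closure by auto
qed

section \<open>Dyadic levels and hyperbolic crosses\<close>

text \<open>This is the index of the dyadic block containing a coordinate, so that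
  \<open>level k\<close> is the \<open>l_1\<close>-norm of the s with k in
  \<open>rho_block s\<close>.\<close>

definition bit_length :: "int \<Rightarrow> nat" where
  "bit_length n = (LEAST s. \<bar>n\<bar> < 2 ^ s)"

definition level :: "int^'d \<Rightarrow> nat" where
  "level k = (\<Sum>i\<in>UNIV. bit_length (k$i))"

lemma bit_length_eq_iff:
  "bit_length n = s \<longleftrightarrow> \<bar>n\<bar> < 2 ^ s \<and> (s = 0 \<or> 2 ^ (s - 1) \<le> \<bar>n\<bar>)"
proof -
  have "\<bar>n\<bar> < 2 ^ nat \<bar>n\<bar>"
    using of_nat_less_two_power[of "nat \<bar>n\<bar>", where ?'a = int] by simp
  then have 1: "\<bar>n\<bar> < 2 ^ bit_length n" unfolding bit_length_def by (rule LeastI)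
  have 2: "2 ^ t \<le> \<bar>n\<bar>" if "t < bit_length n" for t
    using not_less_Least[of t "\<lambda>s. \<bar>n\<bar> < 2 ^ s"] that unfolding bit_length_def by simp
  show ?thesis
  proof
    assume s: "bit_length n = s"
    have "s = 0 \<or> s - 1 < s" by auto
    then show "\<bar>n\<bar> < 2 ^ s \<and> (s = 0 \<or> 2 ^ (s - 1) \<le> \<bar>n\<bar>)" using 1 2 unfolding s by blast
  next
    assume *: "\<bar>n\<bar> < 2 ^ s \<and> (s = 0 \<or> 2 ^ (s - 1) \<le> \<bar>n\<bar>)"
    have "\<not> s < bit_length n" using 2[of s] * by auto
    moreover have "\<not> bit_length n < s"
    proof
      assume "bit_length n < s"
      then have "(2::int) ^ bit_length n \<le> 2 ^ (s - 1)" by (intro power_increasing) auto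
      then show False using 1 * \<open>bit_length n < s\<close> by linarith
    qed
    ultimately show "bit_length n = s" by simp
  qed
qed

lemma rho_block_eq: "rho_block s = {k. \<forall>i. bit_length (k$i) = s$i}"
proof -
  \<comment> \<open>For n = 0 the integer part of 1/2 is 0, so block 0 consists of the frequency 0
    alone.\<close>
  have fl: "\<lfloor>(2::real) powr (real n - 1)\<rfloor> = (if n = 0 then 0 else 2 ^ (n - 1))" for n :: nat
  proof (cases n)
    case 0
    then show ?thesis by (simp add: powr_minus)
  next
    case (Suc k)
    then have "(2::real) powr (real n - 1) = of_int (2 ^ k)" by (simp add: powr_realpow)
    then show ?thesis using Suc by (simp only: floor_of_int) simp
  qed
  show ?thesis unfolding rho_block_def fl bit_length_eq_iff
    by (intro Collect_cong all_cong1) auto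
qed

lemma abs_less_two_power_bit_length: "\<bar>n\<bar> < 2 ^ bit_length n"
  using bit_length_eq_iff[of n "bit_length n"] by simp

lemma card_bit_length: "finite {n. bit_length n = s}" "card {n. bit_length n = s} \<le> 2 ^ s"
proof -
  have *: "{n. bit_length n = s} \<subseteq> {0}" if "s = 0" using that by (auto simp: bit_length_eq_iff)
  have **: "{n. bit_length n = s} \<subseteq> {- (2 ^ s) <.. - (2 ^ (s - 1))} \<union> {2 ^ (s - 1) ..< 2 ^ s}" if "s \<noteq> 0"
    using that by (auto simp: bit_length_eq_iff)
  show "finite {n. bit_length n = s}"
    using finite_subset[OF *] finite_subset[OF **] by (cases "s = 0") auto
  show "card {n. bit_length n = s} \<le> 2 ^ s"
  proof (cases s)
    case 0
    then show ?thesis using card_mono[OF _ *] by simp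
  next
    case (Suc t)
    have "card {n. bit_length n = s} \<le> card ({- (2 ^ s) <.. - (2 ^ t)} \<union> {2 ^ t ..< 2 ^ s :: int})"
      using ** Suc by (intro card_mono) auto
    also have "\<dots> \<le> card {- (2 ^ s) <.. - (2 ^ t) :: int} + card {2 ^ t ..< 2 ^ s :: int}"
      by (rule card_Un_le)
    also have "\<dots> = 2 ^ s" using Suc by (simp add: nat_power_eq)
    finally show ?thesis .
  qed
qed

lemma card_vec_le:
  fixes A :: "'d::finite \<Rightarrow> 'b set"
  assumes "\<And>i. finite (A i)"
  shows "finite {k::'b^'d. \<forall>i. k$i \<in> A i}" "card {k::'b^'d. \<forall>i. k$i \<in> A i} \<le> (\<Prod>i\<in>UNIV. card (A i))"
proof -
  have inj: "inj_on vec_nth {k::'b^'d. \<forall>i. k$i \<in> A i}" by (auto simp: inj_on_def vec_eq_iff)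
  have sub: "vec_nth ` {k::'b^'d. \<forall>i. k$i \<in> A i} \<subseteq> PiE UNIV A" by auto
  have fin: "finite (PiE UNIV A)" using assms by (intro finite_PiE) auto
  show "finite {k::'b^'d. \<forall>i. k$i \<in> A i}" by (rule inj_on_finite[OF inj sub fin])
  show "card {k::'b^'d. \<forall>i. k$i \<in> A i} \<le> (\<Prod>i\<in>UNIV. card (A i))"
    using card_inj_on_le[OF inj sub fin] by (simp add: card_PiE)
qed

lemma finite_rho_block: "finite (rho_block s)"
  using card_vec_le(1)[of "\<lambda>i. {n. bit_length n = s$i}"] card_bit_length(1) unfolding rho_block_eq by simp

lemma card_rho_block_le: "card (rho_block s) \<le> 2 ^ (\<Sum>i\<in>UNIV. s$i)"
proof -
  have "card (rho_block s) \<le> (\<Prod>i\<in>UNIV. card {n. bit_length n = s$i})"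
    using card_vec_le(2)[of "\<lambda>i. {n. bit_length n = s$i}"] card_bit_length(1) unfolding rho_block_eq by simp
  also have "\<dots> \<le> (\<Prod>i\<in>UNIV. 2 ^ (s$i))" by (intro prod_mono) (simp add: card_bit_length)
  finally show ?thesis by (simp add: power_sum)
qed

text \<open>One coordinate is determined by the others. This is where the exponent d - 1 of the
  logarithm originates.\<close>

lemma compositions:
  "finite {s::nat^'d. (\<Sum>i\<in>UNIV. s$i) = j}"
  "card {s::nat^'d. (\<Sum>i\<in>UNIV. s$i) = j} \<le> (j + 1) ^ (CARD('d) - 1)"
proof -
  let ?S = "{s::nat^'d. (\<Sum>i\<in>UNIV. s$i) = j}"
  define i0 where "i0 = (SOME i::'d. True)"
  let ?R = "\<lambda>s::nat^'d. restrict (vec_nth s) (UNIV - {i0})"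
  have split: "s$i0 + (\<Sum>i\<in>UNIV - {i0}. s$i) = j" if "s \<in> ?S" for s
    using that by (simp add: sum.remove[of UNIV i0])
  have inj: "inj_on ?R ?S"
  proof (rule inj_onI)
    fix s t assume st: "s \<in> ?S" "t \<in> ?S" "?R s = ?R t"
    have eq: "s$i = t$i" if "i \<noteq> i0" for i using fun_cong[OF st(3), of i] that by simp
    then have "(\<Sum>i\<in>UNIV - {i0}. s$i) = (\<Sum>i\<in>UNIV - {i0}. t$i)" by (intro sum.cong) auto
    then have "s$i0 = t$i0" using split[OF st(1)] split[OF st(2)] by linarith
    then show "s = t" unfolding vec_eq_iff using eq by metis
  qed
  have sub: "?R ` ?S \<subseteq> PiE (UNIV - {i0}) (\<lambda>_. {..j})"
  proof -
    have "s$i \<le> j" if "s \<in> ?S" for s i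
      using that member_le_sum[of i UNIV "\<lambda>i. s$i"] by simp
    then show ?thesis by (intro image_subsetI) (simp only: restrict_PiE_iff, simp)
  qed
  have fin: "finite (PiE (UNIV - {i0}) (\<lambda>_. {..j}))" by (intro finite_PiE) auto
  show "finite ?S" by (rule inj_on_finite[OF inj sub fin])
  show "card ?S \<le> (j + 1) ^ (CARD('d) - 1)"
    using card_inj_on_le[OF inj sub fin] by (simp add: card_PiE card_Diff_singleton)
qed

lemma level_set_eq: "{k. level k = j} = (\<Union>s\<in>{s::nat^'d. (\<Sum>i\<in>UNIV. s$i) = j}. rho_block s)"
  unfolding rho_block_eq level_def by (auto intro!: exI[of _ "\<chi> i. bit_length (_ $ i)"])

lemma finite_level: "finite {k::int^'d. level k = j}"
  unfolding level_set_eq using compositions(1) finite_rho_block by blast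

lemma card_level_le: "card {k::int^'d. level k = j} \<le> 2 ^ j * (j + 1) ^ (CARD('d) - 1)"
proof -
  let ?S = "{s::nat^'d. (\<Sum>i\<in>UNIV. s$i) = j}"
  have "card {k::int^'d. level k = j} \<le> (\<Sum>s\<in>?S. card (rho_block s))"
    unfolding level_set_eq by (rule card_UN_le[OF compositions(1)])
  also have "\<dots> \<le> (\<Sum>s\<in>?S. 2 ^ j)" using card_rho_block_le by (intro sum_mono) force
  also have "\<dots> = 2 ^ j * card ?S" by simp
  also have "\<dots> \<le> 2 ^ j * (j + 1) ^ (CARD('d) - 1)" using compositions(2) by (intro mult_left_mono) auto
  finally show ?thesis .
qed

lemma finite_level_less: "finite {k::int^'d. level k < n}"
proof -
  have "{k::int^'d. level k < n} = (\<Union>j<n. {k. level k = j})" by auto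
  then show ?thesis by (simp add: finite_level)
qed

lemma card_level_less_le: "card {k::int^'d. level k < n} \<le> 2 ^ n * n ^ (CARD('d) - 1)"
proof -
  have "{k::int^'d. level k < n} = (\<Union>j<n. {k. level k = j})" by auto
  then have "card {k::int^'d. level k < n} \<le> (\<Sum>j<n. card {k::int^'d. level k = j})"
    by (simp add: card_UN_le)
  also have "\<dots> \<le> (\<Sum>j<n. 2 ^ j * n ^ (CARD('d) - 1))"
  proof (intro sum_mono)
    fix j assume "j \<in> {..<n}"
    then have "(j + 1) ^ (CARD('d) - 1) \<le> n ^ (CARD('d) - 1)" by (intro power_mono) auto
    then show "card {k::int^'d. level k = j} \<le> 2 ^ j * n ^ (CARD('d) - 1)"
      using card_level_le[where 'd = 'd, of j] by (meson le_trans mult_le_mono2)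
  qed
  also have "\<dots> = (2 ^ n - 1) * n ^ (CARD('d) - 1)"
  proof -
    have "(\<Sum>j<n. 2 ^ j) = 2 ^ n - (1::nat)" by (induction n) auto
    then show ?thesis by (simp flip: sum_distrib_right)
  qed
  also have "\<dots> \<le> 2 ^ n * n ^ (CARD('d) - 1)" by simp
  finally show ?thesis .
qed

lemma level_le_imp_hyp_cross: "level k \<le> J \<Longrightarrow> k \<in> hyp_cross (2 ^ J)"
proof -
  assume "level k \<le> J"
  have "(\<Prod>i\<in>UNIV. max \<bar>k$i\<bar> 1) \<le> (\<Prod>i\<in>UNIV. 2 ^ bit_length (k$i))"
    using abs_less_two_power_bit_length by (intro prod_mono) (auto simp: less_imp_le)
  also have "\<dots> = 2 ^ level k" by (simp add: level_def power_sum)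
  also have "\<dots> \<le> 2 ^ J" using \<open>level k \<le> J\<close> by (intro power_increasing) auto
  finally have "real_of_int (\<Prod>i\<in>UNIV. max \<bar>k$i\<bar> 1) \<le> real_of_int (2 ^ J)" by (rule of_int_le_iff[THEN iffD2])
  then show ?thesis unfolding hyp_cross_def mem_Collect_eq by (simp only: of_int_power of_int_numeral)
qed

lemma hyp_cross_coord_le:
  assumes "k \<in> hyp_cross (2 ^ J)"
  shows "\<bar>k$i\<bar> \<le> 2 ^ J"
proof -
  have "\<bar>k$i\<bar> \<le> max \<bar>k$i\<bar> 1 * 1" by simp
  also have "\<dots> \<le> max \<bar>k$i\<bar> 1 * (\<Prod>j\<in>UNIV - {i}. max \<bar>k$j\<bar> 1)"
    by (intro mult_left_mono prod_ge_1) auto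
  also have "\<dots> = (\<Prod>j\<in>UNIV. max \<bar>k$j\<bar> 1)" by (simp add: prod.remove[of UNIV i])
  also have "\<dots> \<le> 2 ^ J"
    using assms unfolding hyp_cross_def
    by (metis (mono_tags, lifting) mem_Collect_eq of_int_le_iff of_int_numeral of_int_power)
  finally show ?thesis .
qed

text \<open>A box is coarser than the hyperbolic cross, but grid orthogonality asks for
  coordinatewise bounds, and the sampling sees the number of frequencies only through its
  logarithm.\<close>

definition freq_cube :: "nat \<Rightarrow> (int^'d) set" where
  "freq_cube H = {k. \<forall>i. \<bar>k$i\<bar> \<le> int H}"

lemma freq_cube_card:
  "finite (freq_cube H :: (int^'d) set)" "card (freq_cube H :: (int^'d) set) \<le> (2 * H + 1) ^ CARD('d)"
proof -
  have "freq_cube H = {k::int^'d. \<forall>i. k$i \<in> {- int H .. int H}}" by (auto simp: freq_cube_def abs_le_iff) (metis minus_le_iff)+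
  moreover have "card {- int H .. int H} = 2 * H + 1" by simp
  ultimately show "finite (freq_cube H :: (int^'d) set)" "card (freq_cube H :: (int^'d) set) \<le> (2 * H + 1) ^ CARD('d)"
    using card_vec_le[of "\<lambda>_::'d. {- int H .. int H}"] by simp_all
qed

lemma hyp_cross_subset_freq_cube: "hyp_cross (2 ^ J) \<subseteq> freq_cube (2 ^ J)"
  using hyp_cross_coord_le unfolding freq_cube_def by force

text \<open>Guarantees room for filling K up to exactly v frequencies; those on one axis
  suffice.\<close>

lemma card_hyp_cross_ge: "2 ^ J \<le> card (hyp_cross (2 ^ J) :: (int^'d) set)"
proof -
  define i0 where "i0 = (SOME i::'d. True)"
  let ?A = "(\<lambda>n. axis i0 (int n) :: int^'d) ` {1..2 ^ J}"
  have "inj_on (\<lambda>n. axis i0 (int n) :: int^'d) {1..2 ^ J}" by (auto simp: inj_on_def axis_eq_axis)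
  then have "card ?A = 2 ^ J" by (simp add: card_image)
  moreover have "?A \<subseteq> hyp_cross (2 ^ J)"
  proof safe
    fix n :: nat assume n: "n \<in> {1..2 ^ J}"
    have "(\<Prod>i\<in>UNIV. max \<bar>(axis i0 (int n) :: int^'d)$i\<bar> 1) = (\<Prod>i\<in>UNIV. if i = i0 then int n else 1)"
      using n by (intro prod.cong) (auto simp: axis_def)
    also have "\<dots> = int n" by simp
    finally have "real_of_int (\<Prod>i\<in>UNIV. max \<bar>(axis i0 (int n) :: int^'d)$i\<bar> 1) = real n" by simp
    also have "\<dots> \<le> 2 ^ J" using n by (metis atLeastAtMost_iff of_nat_le_iff of_nat_numeral of_nat_power)
    finally show "(axis i0 (int n) :: int^'d) \<in> hyp_cross (2 ^ J)" unfolding hyp_cross_def by blast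
  qed
  then have "card ?A \<le> card (hyp_cross (2 ^ J) :: (int^'d) set)"
    by (rule card_mono[OF finite_subset[OF hyp_cross_subset_freq_cube freq_cube_card(1)]])
  ultimately show ?thesis by simp
qed

section \<open>Fourier series of functions in the class\<close>

lemma f_level_eq:
  fixes f :: "real^'b \<Rightarrow> complex"
  shows "f_level f j x = (\<Sum>k\<in>{k. level k = j}. fhat f k * expk k x)"
proof -
  have "rho_block s \<inter> rho_block t = {}" if st: "s \<noteq> t" for s t :: "nat^'b"
  proof -
    obtain i where "s$i \<noteq> t$i" using st by (auto simp: vec_eq_iff)
    then show ?thesis unfolding rho_block_eq by fastforce
  qed
  then show ?thesis
    unfolding f_level_def delta_s_def level_set_eq
    by (intro sum.UNION_disjoint[symmetric] compositions(1) ballI impI) (simp_all add: finite_rho_block)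
qed

definition level_bound :: "real \<Rightarrow> real \<Rightarrow> nat \<Rightarrow> real" where
  "level_bound a q j = 2 powr (- a * real j) * real (max j 1) powr q"

lemma level_bound_nonneg: "0 \<le> level_bound a q j"
  by (simp add: level_bound_def)

lemma W_class_level_le:
  fixes f :: "real^'d \<Rightarrow> complex"
  assumes "f \<in> W_class a b"
  shows "(\<Sum>k\<in>{k. level k = j}. cmod (fhat f k)) \<le> level_bound a ((real CARD('d) - 1) * b) j"
proof -
  let ?L = "{k::int^'d. level k = j}"
  have fh: "fhat (f_level f j) k = (if k \<in> ?L then fhat f k else 0)" for k
    unfolding f_level_eq[abs_def] by (rule fhat_trig_sum[OF finite_level])
  have "ennreal (\<Sum>k\<in>?L. cmod (fhat f k)) = (\<Sum>k\<in>?L. ennreal (cmod (fhat f k)))"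
    by (simp add: sum_ennreal)
  also have "\<dots> = (\<Sum>k\<in>?L. ennreal (cmod (fhat (f_level f j) k)))"
    by (intro sum.cong) (auto simp: fh)
  also have "\<dots> = infsum (\<lambda>k. ennreal (cmod (fhat (f_level f j) k))) ?L"
    by (rule infsum_finite[symmetric, OF finite_level])
  also have "\<dots> = Anorm (f_level f j)"
    unfolding Anorm_def by (rule infsum_cong_neutral) (auto simp: fh)
  also have "\<dots> \<le> ennreal (level_bound a ((real CARD('d) - 1) * b) j)"
    using assms unfolding W_class_def level_bound_def by auto
  finally show ?thesis using level_bound_nonneg by (simp add: ennreal_le_iff)
qed

lemma expk_periodic: "expk k (x + (2*pi) *\<^sub>R axis i 1) = expk k x"
proof -
  have "kx k (x + (2*pi) *\<^sub>R axis i 1) = (\<Sum>j\<in>UNIV. real_of_int (k$j) * x$j + (if j = i then real_of_int (k$j) * (2*pi) else 0))"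
    unfolding kx_def by (intro sum.cong refl) (auto simp: axis_def distrib_left)
  then have "kx k (x + (2*pi) *\<^sub>R axis i 1) = kx k x + real_of_int (k$i) * (2*pi)"
    by (simp add: sum.distrib kx_def)
  then have "expk k (x + (2*pi) *\<^sub>R axis i 1) = expk k x * exp (\<i> * complex_of_real (real_of_int (k$i) * (2*pi)))"
    unfolding expk_def by (simp add: distrib_left exp_add)
  also have "exp (\<i> * complex_of_real (real_of_int (k$i) * (2*pi))) = 1" by (auto simp: exp_eq_1)
  finally show ?thesis by simp
qed

text \<open>By the Weierstrass M-test the level sums converge uniformly to a continuous periodic g.
  It has the Fourier coefficients of f, so it is f by uniqueness, and the remainder is bounded by
  the tail of the majorant.\<close>

lemma W_class_fourier_tail:
  fixes f :: "real^'d \<Rightarrow> complex"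
  assumes f: "f \<in> W_class a b" and sm: "summable (level_bound a ((real CARD('d) - 1) * b))"
    and x: "x \<in> torus_cube"
  shows "cmod (f x - (\<Sum>k\<in>{k. level k < n}. fhat f k * expk k x))
      \<le> (\<Sum>j. level_bound a ((real CARD('d) - 1) * b) (j + n))"
proof -
  let ?A = "level_bound a ((real CARD('d) - 1) * b)"
  have cf: "continuous_on UNIV f" and pf: "\<And>x i. f (x + (2*pi) *\<^sub>R axis i 1) = f x"
    using f by (auto simp: W_class_def)
  have F: "cmod (f_level f j y) \<le> ?A j" for j y
  proof -
    have "cmod (f_level f j y) \<le> (\<Sum>k\<in>{k. level k = j}. cmod (fhat f k))"
      unfolding f_level_eq by (rule sum_norm_le) (simp add: norm_mult)
    then show ?thesis using W_class_level_le[OF f, of j] by linarith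
  qed
  have summ: "summable (\<lambda>j. f_level f j y)" for y
    by (rule summable_comparison_test'[OF sm, of 0]) (simp add: F)
  define S where "S n y = (\<Sum>j<n. f_level f j y)" for n y
  define g where "g y = (\<Sum>j. f_level f j y)" for y
  have S: "S n y = (\<Sum>k\<in>{k. level k < n}. fhat f k * expk k y)" for n y
  proof -
    have "{k::int^'d. level k < n} = (\<Union>j<n. {k. level k = j})" by auto
    then show ?thesis unfolding S_def f_level_eq
      by (simp only:) (rule sum.UNION_disjoint[symmetric], auto simp: finite_level)
  qed
  have cS: "continuous_on UNIV (S n)" for n
    unfolding S_def f_level_eq by (intro continuous_intros)
  have "uniform_limit UNIV S g sequentially"
    unfolding S_def[abs_def] g_def by (rule Weierstrass_m_test[OF _ sm]) (simp add: F)
  note ul = this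
  have cg: "continuous_on UNIV g"
    by (rule uniform_limit_theorem[OF _ ul]) (use cS in auto)
  have tail: "cmod (g y - S n y) \<le> (\<Sum>j. ?A (j + n))" for n y
  proof -
    have "g y - S n y = (\<Sum>j. f_level f (j + n) y)"
      unfolding g_def S_def using suminf_split_initial_segment[OF summ, of y n] by simp
    also have "cmod \<dots> \<le> (\<Sum>j. ?A (j + n))"
      by (rule norm_suminf_le) (use F sm in \<open>auto simp: summable_iff_shift\<close>)
    finally show ?thesis .
  qed
  have zero: "fhat (\<lambda>y. f y - g y) l = 0" for l
  proof -
    \<comment> \<open>Once n exceeds the level of l, the partial sum has the same l-th coefficient
      as f; only the uniformly small remainder of g is left.\<close>
    have le: "cmod (fhat (\<lambda>y. f y - g y) l) \<le> (\<Sum>j. ?A (j + n))" if n: "n > level l" for n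
    proof -
      have "fhat (S n) l = fhat f l"
        unfolding S[abs_def] using n by (simp add: fhat_trig_sum[OF finite_level_less])
      then have "fhat (\<lambda>y. f y - g y) l = - fhat (\<lambda>y. g y - S n y) l"
        by (simp add: fhat_diff cf cg cS)
      moreover have "cmod (fhat (\<lambda>y. g y - S n y) l) \<le> (\<Sum>j. ?A (j + n))"
        by (rule norm_fhat_le) (use tail in \<open>auto intro!: continuous_intros cg cS\<close>)
      ultimately show ?thesis by simp
    qed
    have "(\<lambda>n. \<Sum>j. ?A (j + n)) \<longlonglongrightarrow> 0" by (rule suminf_exist_split2[OF sm])
    then have "cmod (fhat (\<lambda>y. f y - g y) l) \<le> 0"
      by (rule tendsto_lowerbound) (use le in \<open>auto simp: eventually_at_top_dense\<close>)
    then show ?thesis by simp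
  qed
  have "f x - g x = 0"
  proof (rule fourier_uniqueness[OF _ _ zero x])
    show "continuous_on UNIV (\<lambda>y. f y - g y)" by (intro continuous_intros cf cg)
    show "f (y + (2*pi) *\<^sub>R axis i 1) - g (y + (2*pi) *\<^sub>R axis i 1) = f y - g y" for y i
      unfolding g_def f_level_eq pf expk_periodic ..
  qed
  then show ?thesis using tail[of x n] unfolding S by simp
qed

section \<open>Least squares recovery\<close>

lemma sum_sq_norm_diff_le:
  fixes x y :: "'i \<Rightarrow> complex"
  shows "(\<Sum>i\<in>I. (cmod (x i - y i))\<^sup>2) \<le> 2 * (\<Sum>i\<in>I. (cmod (x i))\<^sup>2) + 2 * (\<Sum>i\<in>I. (cmod (y i))\<^sup>2)"
proof -
  have "(cmod (x i - y i))\<^sup>2 \<le> 2 * (cmod (x i))\<^sup>2 + 2 * (cmod (y i))\<^sup>2" for i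
  proof -
    have "(cmod (x i - y i))\<^sup>2 \<le> (cmod (x i) + cmod (y i))\<^sup>2"
      by (intro power_mono norm_triangle_ineq4) auto
    also have "\<dots> \<le> 2 * (cmod (x i))\<^sup>2 + 2 * (cmod (y i))\<^sup>2"
      using sum_squares_bound[of "cmod (x i)" "cmod (y i)"] by (simp add: power2_sum)
    finally show ?thesis .
  qed
  then have "(\<Sum>i\<in>I. (cmod (x i - y i))\<^sup>2) \<le> (\<Sum>i\<in>I. 2 * (cmod (x i))\<^sup>2 + 2 * (cmod (y i))\<^sup>2)" by (rule sum_mono)
  then show ?thesis by (simp add: sum.distrib sum_distrib_left)
qed

lemma sum_square_le_card_mult:
  fixes a :: "'i \<Rightarrow> real"
  assumes "finite A" "K \<subseteq> A" "\<And>i. i \<in> A - K \<Longrightarrow> a i = 0"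
  shows "(\<Sum>i\<in>A. a i)\<^sup>2 \<le> real (card K) * (\<Sum>i\<in>A. (a i)\<^sup>2)"
proof -
  have "(\<Sum>i\<in>A. a i) = (\<Sum>i\<in>K. 1 * a i)" "(\<Sum>i\<in>A. (a i)\<^sup>2) = (\<Sum>i\<in>K. (a i)\<^sup>2)"
    using assms by (auto intro!: sum.mono_neutral_right)
  then show ?thesis using Cauchy_Schwarz_ineq_sum[of "\<lambda>_. 1" a K] by simp
qed

text \<open>Compare u with g, the part of the polynomial on K. By minimality both f - u and f - g
  are empirically small, hence so is w = u - g. As w lives on K, the lower discretization bound
  transfers this to \<open>L_2\<close>. Finally f - u is the tail plus p - w, where p is the part
  off K.\<close>

lemma least_squares_error_le:
  fixes f :: "real^'d \<Rightarrow> complex" and x :: "nat \<Rightarrow> real^'d" and m :: nat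
    and B :: "(int^'d) set" and c :: "int^'d \<Rightarrow> complex"
  defines "emp \<equiv> \<lambda>c. (\<Sum>j<m. (cmod (\<Sum>k\<in>B. c k * expk k (x j)))\<^sup>2) / real m"
  assumes B: "finite B" and m: "m > 0" and x: "\<And>j. x j \<in> torus_cube"
    and low: "\<And>c. (\<Sum>k\<in>B. (cmod (c k))\<^sup>2) \<le> 108 * emp c + \<eta> * (\<Sum>k\<in>B. cmod (c k))\<^sup>2"
    and up: "\<And>c. emp c \<le> 108 * (\<Sum>k\<in>B. (cmod (c k))\<^sup>2) + \<eta> * (\<Sum>k\<in>B. cmod (c k))\<^sup>2"
    and \<eta>: "0 \<le> \<eta>" "\<eta> * real (card K) \<le> 1/2"
    and K: "K \<subseteq> B"
    and f: "\<And>y. y \<in> torus_cube \<Longrightarrow> cmod (f y - (\<Sum>k\<in>B. c k * expk k y)) \<le> \<epsilon>"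
    and \<delta>: "\<epsilon>\<^sup>2 \<le> \<delta>" "(\<Sum>k\<in>B - K. (cmod (c k))\<^sup>2) \<le> 2 * \<delta>" "\<eta> * (\<Sum>k\<in>B - K. cmod (c k))\<^sup>2 \<le> \<delta>"
    and u: "u \<in> LS_set m x (trig_span K) f"
  shows "L2norm (\<lambda>y. f y - u y) \<le> ennreal (1500 * sqrt \<delta>)"
proof -
  obtain b where b: "u = (\<lambda>y. \<Sum>k\<in>K. b k * expk k y)" using u unfolding LS_set_def trig_span_def by auto
  let ?g = "\<lambda>y. \<Sum>k\<in>K. c k * expk k y"
  define p where "p k = (if k \<in> K then 0 else c k)" for k
  define w where "w k = (if k \<in> K then b k - c k else 0)" for k
  let ?P = "\<lambda>y. \<Sum>k\<in>B. p k * expk k y"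
  let ?W = "\<lambda>y. \<Sum>k\<in>B. w k * expk k y"
  have \<delta>0: "0 \<le> \<delta>" using \<delta>(1) zero_le_power2[of \<epsilon>] by linarith
  have split: "(\<Sum>k\<in>B. c k * expk k y) = ?g y + ?P y" for y
  proof -
    have "?g y = (\<Sum>k\<in>B. (if k \<in> K then c k else 0) * expk k y)"
      using K B by (intro sum.mono_neutral_cong_left) auto
    moreover have "(\<Sum>k\<in>B. c k * expk k y) = (\<Sum>k\<in>B. (if k \<in> K then c k else 0) * expk k y) + ?P y"
      unfolding p_def sum.distrib[symmetric] by (intro sum.cong) auto
    ultimately show ?thesis by simp
  qed
  have W: "?W y = u y - ?g y" for y
  proof -
    have "?W y = (\<Sum>k\<in>K. (b k - c k) * expk k y)"
      unfolding w_def using K B by (intro sum.mono_neutral_cong_right) auto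
    then show ?thesis unfolding b by (simp add: left_diff_distrib sum_subtractf)
  qed
  have p2: "(\<Sum>k\<in>B. (cmod (p k))\<^sup>2) \<le> 2 * \<delta>"
  proof -
    have "(\<Sum>k\<in>B. (cmod (p k))\<^sup>2) = (\<Sum>k\<in>B - K. (cmod (c k))\<^sup>2)"
      unfolding p_def using B by (intro sum.mono_neutral_cong_right) auto
    then show ?thesis using \<delta>(2) by simp
  qed
  have p1: "\<eta> * (\<Sum>k\<in>B. cmod (p k))\<^sup>2 \<le> \<delta>"
  proof -
    have "(\<Sum>k\<in>B. cmod (p k)) = (\<Sum>k\<in>B - K. cmod (c k))"
      unfolding p_def using B by (intro sum.mono_neutral_cong_right) auto
    then show ?thesis using \<delta>(3) by simp
  qed
  have empP: "(\<Sum>j<m. (cmod (?P (x j)))\<^sup>2) \<le> 217 * \<delta> * real m"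
  proof -
    have "emp p \<le> 217 * \<delta>" using up[of p] p1 p2 by linarith
    then show ?thesis using m unfolding emp_def by (simp add: field_simps)
  qed
  have fg: "(\<Sum>j<m. (cmod (f (x j) - ?g (x j)))\<^sup>2) \<le> 436 * \<delta> * real m"
  proof -
    have R: "(\<Sum>j<m. (cmod (f (x j) - (\<Sum>k\<in>B. c k * expk k (x j))))\<^sup>2) \<le> \<delta> * real m"
    proof -
      have "(\<Sum>j<m. (cmod (f (x j) - (\<Sum>k\<in>B. c k * expk k (x j))))\<^sup>2) \<le> (\<Sum>j<m. \<delta>)"
        by (intro sum_mono order_trans[OF power_mono[OF f[OF x]] \<delta>(1)]) auto
      then show ?thesis by (simp add: mult.commute)
    qed
    have "(\<Sum>j<m. (cmod ((f (x j) - (\<Sum>k\<in>B. c k * expk k (x j))) - (- ?P (x j))))\<^sup>2)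
        \<le> 2 * (\<Sum>j<m. (cmod (f (x j) - (\<Sum>k\<in>B. c k * expk k (x j))))\<^sup>2) + 2 * (\<Sum>j<m. (cmod (- ?P (x j)))\<^sup>2)"
      by (rule sum_sq_norm_diff_le)
    also have "\<dots> \<le> 436 * \<delta> * real m" using R empP by simp
    finally show ?thesis unfolding split by (simp add: algebra_simps)
  qed
  have "(\<Sum>j<m. (cmod (f (x j) - u (x j)))\<^sup>2) \<le> (\<Sum>j<m. (cmod (f (x j) - ?g (x j)))\<^sup>2)"
  proof -
    have "?g \<in> trig_span K" unfolding trig_span_def by blast
    then have "emp_err m x f u \<le> emp_err m x f ?g" using u unfolding LS_set_def by blast
    then show ?thesis using m unfolding emp_err_def by (simp add: divide_le_cancel)
  qed
  then have fu: "(\<Sum>j<m. (cmod (f (x j) - u (x j)))\<^sup>2) \<le> 436 * \<delta> * real m" using fg by linarith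
  have "(\<Sum>j<m. (cmod ((f (x j) - ?g (x j)) - (f (x j) - u (x j))))\<^sup>2) \<le> 1744 * \<delta> * real m"
    using sum_sq_norm_diff_le[of "\<lambda>j. f (x j) - ?g (x j)" "\<lambda>j. f (x j) - u (x j)" "{..<m}"] fg fu by linarith
  then have empW: "emp w \<le> 1744 * \<delta>"
    unfolding emp_def W using m by (simp add: field_simps)
  \<comment> \<open>Cauchy-Schwarz on K and \<eta> |K| <= 1/2 bound the error term by half of the
    left side, which absorbs it; so 376704 = 2 * 108 * 1744.\<close>
  have w2: "(\<Sum>k\<in>B. (cmod (w k))\<^sup>2) \<le> 376704 * \<delta>"
  proof -
    let ?w = "\<Sum>k\<in>B. (cmod (w k))\<^sup>2"
    have "\<eta> * (\<Sum>k\<in>B. cmod (w k))\<^sup>2 \<le> \<eta> * (real (card K) * ?w)"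
      using K B \<eta>(1) by (intro mult_left_mono sum_square_le_card_mult) (auto simp: w_def)
    also have "\<dots> \<le> 1/2 * ?w"
      unfolding mult.assoc[symmetric] using \<eta>(2) by (intro mult_right_mono sum_nonneg) auto
    finally show ?thesis using low[of w] empW by linarith
  qed
  show ?thesis
  proof (rule L2norm_trig_perturbation_le[OF B])
    fix y :: "real^'d" assume y: "y \<in> torus_cube"
    have "f y - u y - (\<Sum>k\<in>B. (p k - w k) * expk k y) = f y - (\<Sum>k\<in>B. c k * expk k y)"
      unfolding left_diff_distrib sum_subtractf W split by simp
    then show "cmod (f y - u y - (\<Sum>k\<in>B. (p k - w k) * expk k y)) \<le> \<epsilon>" using f[OF y] by (simp only:)
  next
    have "(\<Sum>k\<in>B. (cmod (p k - w k))\<^sup>2) \<le> 753412 * \<delta>"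
      using sum_sq_norm_diff_le[of p w B] p2 w2 by linarith
    then have "2 * (\<Sum>k\<in>B. (cmod (p k - w k))\<^sup>2) + 2 * \<epsilon>\<^sup>2 \<le> 2250000 * \<delta>" using \<delta>(1) \<delta>0 by linarith
    then show "2 * (\<Sum>k\<in>B. (cmod (p k - w k))\<^sup>2) + 2 * \<epsilon>\<^sup>2 \<le> (1500 * sqrt \<delta>)\<^sup>2"
      using \<delta>0 by (simp add: power_mult_distrib)
  qed (use \<delta>0 in simp)
qed

text \<open>Coefficients outside \<open>K\<close> are small, so their \<open>\<ell>\<^sub>2\<close>-norm is controlled by the \<open>\<ell>\<^sub>1\<close>-norm \<open>D\<close>.\<close>

lemma sparse_support_selection:
  fixes h :: "int^'d \<Rightarrow> complex"
  assumes v: "v > 0" "2 * card {k::int^'d. level k < n} \<le> v" "v \<le> card (hyp_cross (2 ^ J) :: (int^'d) set)" and nJ: "n \<le> J"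
    and D: "D > 0" "(\<Sum>k\<in>{k. n \<le> level k \<and> level k \<le> J}. cmod (h k)) \<le> D"
  obtains K where "K \<subseteq> hyp_cross (2 ^ J)" "card K = v" "{k. level k < n} \<subseteq> K"
    "\<And>k. n \<le> level k \<Longrightarrow> level k \<le> J \<Longrightarrow> k \<notin> K \<Longrightarrow> cmod (h k) \<le> 2 * D / real v"
proof -
  let ?T = "{k::int^'d. n \<le> level k \<and> level k \<le> J}"
  let ?S = "{k \<in> ?T. cmod (h k) > 2 * D / real v}"
  have finT: "finite ?T" by (rule finite_subset[OF _ finite_level_less[of "Suc J"]]) auto
  \<comment> \<open>Markov's inequality: at most v/2 coefficients exceed 2 D / v. The other half of
    the budget v is for the levels below n.\<close>
  have "real (card ?S) * (2 * D / real v) \<le> (\<Sum>k\<in>?S. cmod (h k))"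
    using sum_mono[of ?S "\<lambda>_. 2 * D / real v" "\<lambda>k. cmod (h k)"] by simp
  also have "\<dots> \<le> (\<Sum>k\<in>?T. cmod (h k))" using finT by (intro sum_mono2) auto
  also have "\<dots> \<le> D" by (rule D(2))
  finally have "D * (2 * real (card ?S)) \<le> D * real v" using v(1) by (simp add: field_simps)
  then have S: "2 * card ?S \<le> v" using D(1) by simp
  let ?K = "{k::int^'d. level k < n} \<union> ?S"
  have "card ?K \<le> v" using card_Un_le[of "{k::int^'d. level k < n}" ?S] v(2) S by linarith
  moreover have "?K \<subseteq> hyp_cross (2 ^ J)" using level_le_imp_hyp_cross nJ by auto
  moreover have "finite (hyp_cross (2 ^ J) :: (int^'d) set)"
    by (rule finite_subset[OF hyp_cross_subset_freq_cube freq_cube_card(1)])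
  ultimately obtain K where "?K \<subseteq> K" "K \<subseteq> hyp_cross (2 ^ J)" "card K = v"
    using exists_subset_between[of ?K v "hyp_cross (2 ^ J)"] v(3) by blast
  then show ?thesis by (intro that[of K]) force+
qed

lemma frequency_cube_discretization:
  fixes J t m :: nat
  defines "q \<equiv> (J + 2) * CARD('d) + 2"
  defines "\<eta> \<equiv> 4 * (18 * (real t + 1) * (256 * (real q)\<^sup>2 + real t + 2) / real m + 3 * (1/4) ^ t)"
  assumes m: "m > 0"
  obtains x :: "nat \<Rightarrow> real^'d" where "\<And>j. x j \<in> torus_cube"
    "\<And>c. (\<Sum>k\<in>freq_cube (2 ^ J). (cmod (c k))\<^sup>2)
       \<le> 108 * ((\<Sum>j<m. (cmod (\<Sum>k\<in>freq_cube (2 ^ J). c k * expk k (x j)))\<^sup>2) / real m) + \<eta> * (\<Sum>k\<in>freq_cube (2 ^ J). cmod (c k))\<^sup>2"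
    "\<And>c. (\<Sum>j<m. (cmod (\<Sum>k\<in>freq_cube (2 ^ J). c k * expk k (x j)))\<^sup>2) / real m
       \<le> 108 * (\<Sum>k\<in>freq_cube (2 ^ J). (cmod (c k))\<^sup>2) + \<eta> * (\<Sum>k\<in>freq_cube (2 ^ J). cmod (c k))\<^sup>2"
proof -
  let ?B = "freq_cube (2 ^ J) :: (int^'d) set"
  \<comment> \<open>Larger than twice the box radius 2^J, as orthogonality demands; being a power of
    2, it makes four times the number of grid points exactly 2^q.\<close>
  let ?P = "2 ^ (J + 2) :: nat"
  let ?G = "grid ?P :: ('d \<Rightarrow> nat) set"
  have cG: "card ?G = 2 ^ ((J + 2) * CARD('d))" by (simp only: card_grid power_mult)
  then have G: "?G \<noteq> {}" by (metis card.empty power_not_zero zero_neq_numeral)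
  have cB: "card ?B \<le> card ?G"
  proof -
    have "card ?B \<le> (2 * 2 ^ J + 1) ^ CARD('d)" by (rule freq_cube_card)
    also have "\<dots> \<le> ?P ^ CARD('d)" by (intro power_mono) auto
    finally show ?thesis by (simp add: card_grid)
  qed
  have qG: "ln (4 * real (card ?G)) \<le> real q"
  proof -
    have "4 * real (card ?G) = 2 ^ q" unfolding cG q_def by (simp add: power_add)
    then have "ln (4 * real (card ?G)) = real q * ln 2" by (simp add: ln_realpow)
    also have "\<dots> \<le> real q * 1" using ln_2_less_1 by (intro mult_left_mono) auto
    finally show ?thesis by simp
  qed
  have qB: "ln (4 * real (card ?B)) \<le> real q"
  proof (cases "card ?B = 0")
    case False
    then have "ln (4 * real (card ?B)) \<le> ln (4 * real (card ?G))" using cB by (subst ln_le_cancel_iff) auto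
    then show ?thesis using qG by linarith
  qed simp
  obtain \<xi> :: "nat \<Rightarrow> 'd \<Rightarrow> nat" where \<xi>: "\<forall>j. \<xi> j \<in> ?G" and cmp: "\<forall>c.
      (\<Sum>g\<in>?G. (cmod (\<Sum>k\<in>?B. c k * expk k (grid_point ?P g)))\<^sup>2) / real (card ?G)
        \<le> 108 * ((\<Sum>j<m. (cmod (\<Sum>k\<in>?B. c k * expk k (grid_point ?P (\<xi> j))))\<^sup>2) / real m) + \<eta> * (\<Sum>k\<in>?B. cmod (c k))\<^sup>2 \<and>
      (\<Sum>j<m. (cmod (\<Sum>k\<in>?B. c k * expk k (grid_point ?P (\<xi> j))))\<^sup>2) / real m
        \<le> 108 * ((\<Sum>g\<in>?G. (cmod (\<Sum>k\<in>?B. c k * expk k (grid_point ?P g)))\<^sup>2) / real (card ?G)) + \<eta> * (\<Sum>k\<in>?B. cmod (c k))\<^sup>2"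
    using universal_discretization[OF freq_cube_card(1) finite_grid G _ qG qB m,
        where e = "\<lambda>k g. expk k (grid_point ?P g)" and t = t] unfolding \<eta>_def by auto
  have pars: "(\<Sum>g\<in>?G. (cmod (\<Sum>k\<in>?B. c k * expk k (grid_point ?P g)))\<^sup>2) / real (card ?G) = (\<Sum>k\<in>?B. (cmod (c k))\<^sup>2)" for c
    by (rule grid_parseval[OF freq_cube_card(1), where H = "2 ^ J"]) (auto simp: freq_cube_def)
  note cmp' = cmp[unfolded pars, rule_format]
  show ?thesis
  proof (rule that[of "\<lambda>j. grid_point ?P (\<xi> j)"])
    show "grid_point ?P (\<xi> j) \<in> torus_cube" for j using \<xi> by (intro grid_point_in_torus_cube) blast
  qed (use cmp' in blast)+
qed

section \<open>Choice of the parameters\<close>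

text \<open>Half of the decay \<open>2^(-a i)\<close> of the level bounds makes the sum over the levels converge, the
  other half is left to absorb the factor \<open>v^(-1/2)\<close> beyond the last level used.\<close>

definition tail_weight :: "real \<Rightarrow> real \<Rightarrow> nat \<Rightarrow> real" where
  "tail_weight a B i = 2 powr (- a / 2 * real i) * (2 * (real i + 1)) powr \<bar>B\<bar>"

lemma summable_tail_weight:
  assumes "a > 0"
  shows "summable (tail_weight a B)"
proof (rule summable_comparison_test_bigo)
  show "summable (\<lambda>i. norm ((2 powr (- a / 4)) ^ i))"
    using assms by (auto intro!: summable_geometric simp: powr_less_one)
  have "(\<lambda>i. 2 powr (- a / 2 * real i) * (2 * (real i + 1)) powr \<bar>B\<bar>) \<in> O(\<lambda>i. 2 powr (- a / 4 * real i))"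
    using assms by real_asymp
  then show "tail_weight a B \<in> O(\<lambda>i. (2 powr (- a / 4)) ^ i)"
    unfolding tail_weight_def by (simp add: powr_powr powr_realpow[symmetric])
qed

text \<open>Since b is any real number the exponent may have either sign, so the ratio is bounded on
  both sides.\<close>

lemma powr_le_of_ratio_bounds:
  fixes y z R :: real
  assumes "y > 0" "z > 0" "R \<ge> 1" "y \<le> R * z" "z \<le> R * y"
  shows "y powr B \<le> z powr B * R powr \<bar>B\<bar>"
proof (cases "B \<ge> 0")
  case True
  then have "y powr B \<le> (R * z) powr B" using assms by (intro powr_mono2) auto
  then show ?thesis using True assms by (simp add: powr_mult mult.commute)
next
  case False
  then have "y powr B \<le> (z / R) powr B" using assms by (intro powr_mono2') (auto simp: field_simps)
  also have "\<dots> = z powr B * R powr \<bar>B\<bar>" using False assms by (simp add: powr_divide powr_minus field_simps)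
  finally show ?thesis .
qed

text \<open>The value at level n is split off, leaving a factor that depends on i only; constants
  thus become uniform in n. Using n + 1 avoids a base 0.\<close>

lemma level_bound_le:
  assumes "a > 0"
  shows "level_bound a B (n + i)
    \<le> 2 powr (- a * real n) * (real n + 1) powr B * (2 powr (- a / 2 * real i) * tail_weight a B i)"
proof -
  have "real (max (n + i) 1) powr B \<le> (real n + 1) powr B * (2 * (real i + 1)) powr \<bar>B\<bar>"
  proof (rule powr_le_of_ratio_bounds)
    show "real (max (n + i) 1) \<le> 2 * (real i + 1) * (real n + 1)"
      by (auto simp: max_def algebra_simps)
    have "real n + 1 \<le> 2 * 1 * real (max (n + i) 1)" by (auto simp: max_def)
    also have "\<dots> \<le> 2 * (real i + 1) * real (max (n + i) 1)" by (intro mult_right_mono) auto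
    finally show "real n + 1 \<le> 2 * (real i + 1) * real (max (n + i) 1)" .
  qed auto
  then have "level_bound a B (n + i) \<le> 2 powr (- a * real (n + i)) * ((real n + 1) powr B * (2 * (real i + 1)) powr \<bar>B\<bar>)"
    unfolding level_bound_def by (rule mult_left_mono) simp
  also have "2 powr (- a * real (n + i)) = 2 powr (- a * real n) * (2 powr (- a / 2 * real i) * 2 powr (- a / 2 * real i))"
    by (simp add: powr_add[symmetric] algebra_simps)
  finally show ?thesis unfolding tail_weight_def by (simp add: mult_ac)
qed

lemma level_bound_tail:
  fixes a B :: real and n r :: nat
  assumes a: "a > 0"
  defines "A \<equiv> 2 powr (- a * real n) * (real n + 1) powr B"
  shows "summable (level_bound a B)"
    and "(\<Sum>i. level_bound a B (i + (n + r))) \<le> A * 2 powr (- a / 2 * real r) * suminf (tail_weight a B)"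
proof -
  note sw = summable_tail_weight[OF a, of B]
  have w0: "0 \<le> tail_weight a B i" for i unfolding tail_weight_def by simp
  have A0: "0 \<le> A" unfolding A_def by simp
  \<comment> \<open>Stated for arbitrary n and r because summability uses the instance n = r =
    0.\<close>
  have le: "level_bound a B (i + (n + r)) \<le> A * 2 powr (- a / 2 * real r) * tail_weight a B (i + r)"
    if A: "A = 2 powr (- a * real n) * (real n + 1) powr B" for A and n r i :: nat
  proof -
    have "level_bound a B (n + (i + r)) \<le> A * (2 powr (- a / 2 * real (i + r)) * tail_weight a B (i + r))"
      unfolding A by (rule level_bound_le[OF a])
    also have "\<dots> \<le> A * (2 powr (- a / 2 * real r) * tail_weight a B (i + r))"
    proof -
      have "- a / 2 * real (i + r) \<le> - a / 2 * real r" using a by (intro mult_left_mono_neg) auto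
      then have "2 powr (- a / 2 * real (i + r)) \<le> 2 powr (- a / 2 * real r)" by (rule powr_mono) simp
      then show ?thesis unfolding A by (intro mult_left_mono mult_right_mono w0) auto
    qed
    finally show ?thesis by (simp add: add_ac mult_ac)
  qed
  have swr: "summable (\<lambda>i. tail_weight a B (i + r))" for r using sw by (simp add: summable_iff_shift)
  show sm: "summable (level_bound a B)"
  proof (rule summable_comparison_test')
    show "summable (\<lambda>i. 2 powr (- a * real 0) * (real 0 + 1) powr B * 2 powr (- a / 2 * real 0) * tail_weight a B i)"
      using sw by (intro summable_mult)
    show "norm (level_bound a B i) \<le> 2 powr (- a * real 0) * (real 0 + 1) powr B * 2 powr (- a / 2 * real 0) * tail_weight a B i"
      if "i \<ge> 0" for i
      using le[OF refl, where n = 0 and r = 0 and i = i] level_bound_nonneg[of a B i] by simp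
  qed
  have "(\<Sum>i. level_bound a B (i + (n + r))) \<le> (\<Sum>i. A * 2 powr (- a / 2 * real r) * tail_weight a B (i + r))"
    using le[of A n] sm swr unfolding A_def by (intro suminf_le summable_mult) (auto simp: summable_iff_shift)
  also have "\<dots> = A * 2 powr (- a / 2 * real r) * (\<Sum>i. tail_weight a B (i + r))"
    using swr by (rule suminf_mult)
  also have "(\<Sum>i. tail_weight a B (i + r)) \<le> suminf (tail_weight a B)"
    using suminf_split_initial_segment[OF sw, of r] sum_nonneg[of "{..<r}" "tail_weight a B"] w0 by simp
  finally show "(\<Sum>i. level_bound a B (i + (n + r))) \<le> A * 2 powr (- a / 2 * real r) * suminf (tail_weight a B)"
    using A0 by (simp add: mult_left_mono)
qed

text \<open>n is a last index at which the low levels fill at most half of v. Since n + 1 <= 2^n,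
  the polynomial factor changes log v by a constant factor only, so n + 1 and log v are comparable
  in both directions.\<close>

lemma dyadic_level_choice:
  fixes v D :: nat
  assumes v: "v \<ge> 2" and D: "D \<ge> 1"
  obtains n where "2 * (2 ^ n * n ^ (D - 1)) \<le> v" "v < 2 * (2 ^ (n + 1) * (n + 1) ^ (D - 1))"
    "real n + 1 \<le> log 2 (real v)" "log 2 (real v) \<le> (real D + 1) * (real n + 1)"
proof -
  let ?P = "\<lambda>n. 2 * (2 ^ n * n ^ (D - 1)) \<le> v"
  \<comment> \<open>For D = 1 the factor is 0^0 = 1, and the claim is v >= 2.\<close>
  have P0: "?P 0" using v by (cases "D - 1") auto
  have "\<not> ?P v"
  proof
    assume "?P v"
    moreover have "v < 2 ^ v" by simp
    moreover have "1 \<le> v ^ (D - 1)" using v by simp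
    then have "2 ^ v * 1 \<le> 2 ^ v * v ^ (D - 1)" by (intro mult_left_mono) auto
    ultimately show False by linarith
  qed
  moreover have "?P n" if "\<And>m. ?P m \<Longrightarrow> ?P (Suc m)" for n
    by (induction n) (rule P0, erule that)
  ultimately obtain n where n: "?P n" "\<not> ?P (Suc n)" by blast
  have up: "2 ^ (n + 1) \<le> v"
  proof (cases "n = 0")
    case False
    then have "2 ^ n * 1 \<le> 2 ^ n * n ^ (D - 1)" by (intro mult_left_mono) auto
    then have "2 * 2 ^ n \<le> v" using n(1) by linarith
    then show ?thesis by simp
  qed (use v in simp)
  have lo: "v \<le> 2 ^ ((D + 1) * (n + 1))"
  proof -
    have "n + 1 \<le> 2 ^ n" using less_exp[of n] by (simp add: Suc_le_eq)
    then have "(n + 1) ^ (D - 1) \<le> 2 ^ (n * (D - 1))" unfolding power_mult by (rule power_mono) simp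
    then have "2 * (2 ^ (n + 1) * (n + 1) ^ (D - 1)) \<le> 2 ^ (n + 2 + n * (D - 1))"
      by (simp add: power_add)
    also have "\<dots> \<le> 2 ^ ((D + 1) * (n + 1))"
    proof (intro power_increasing)
      obtain e where "D = Suc e" using D by (cases D) auto
      then show "n + 2 + n * (D - 1) \<le> (D + 1) * (n + 1)" by simp
    qed simp
    finally show ?thesis using n(2) by simp
  qed
  show ?thesis
  proof (rule that[of n])
    have "2 powr (real n + 1) = real (2 ^ (n + 1))" by (simp add: powr_add powr_realpow)
    also have "\<dots> \<le> real v" using up by (simp only: of_nat_le_iff)
    finally show "real n + 1 \<le> log 2 (real v)" using v by (simp add: le_log_iff)
    have "real v \<le> real (2 ^ ((D + 1) * (n + 1)))" using lo by (simp only: of_nat_le_iff)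
    also have "\<dots> = 2 powr (real ((D + 1) * (n + 1)))"
      by (simp only: powr_realpow zero_less_numeral of_nat_power of_nat_numeral)
    finally have "log 2 (real v) \<le> real ((D + 1) * (n + 1))" using v by (simp add: log_le_iff)
    then show "log 2 (real v) \<le> (real D + 1) * (real n + 1)" by (simp add: algebra_simps)
  qed (use n in simp_all)
qed

text \<open>D bounds the Wiener norm from level n on, r counts the extra levels that are kept, and t
  the layers of the discretization. The tail beyond level n + r is of order D * 2^(-a r / 2) in the
  supremum norm, so v <= 2^(a r) brings it to D / sqrt v; v <= 2^r makes the cross large
  enough.\<close>

lemma W_class_sparse_recovery:
  fixes a b :: real and n r v m t :: nat
  defines "q \<equiv> (real CARD('d) - 1) * b"
  defines "D \<equiv> 2 powr (- a * real n) * (real n + 1) powr q * suminf (tail_weight a q)"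
  defines "N \<equiv> (n + r + 2) * CARD('d) + 2"
  assumes a: "a > 0" and v: "v > 0"
    and small: "2 * (2 ^ n * n ^ (CARD('d) - 1)) \<le> v" and large: "v \<le> 2 ^ r" and r: "v \<le> 2 powr (a * real r)"
    and t: "8 * v \<le> 2 ^ t" and m: "288 * real v * (real t + 1) * (256 * (real N)\<^sup>2 + real t + 2) \<le> real m"
  shows "rho_ls m v (W_class a b :: (real^'d \<Rightarrow> complex) set) (2 ^ (n + r)) \<le> ennreal (1500 * (D / sqrt (real v)))"
proof -
  let ?J = "n + r"
  let ?B = "freq_cube (2 ^ ?J) :: (int^'d) set"
  define \<eta> where "\<eta> = 4 * (18 * (real t + 1) * (256 * (real N)\<^sup>2 + real t + 2) / real m + 3 * (1/4) ^ t)"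
  have rv: "real v > 0" using v by simp
  have "0 < 288 * real v * (real t + 1) * (256 * (real N)\<^sup>2 + real t + 2)"
    using rv by (intro mult_pos_pos) (auto intro: add_nonneg_pos)
  then have m0: "real m > 0" using m by linarith
  obtain x :: "nat \<Rightarrow> real^'d" where x: "\<And>j. x j \<in> torus_cube"
    and low: "\<And>c. (\<Sum>k\<in>?B. (cmod (c k))\<^sup>2)
       \<le> 108 * ((\<Sum>j<m. (cmod (\<Sum>k\<in>?B. c k * expk k (x j)))\<^sup>2) / real m) + \<eta> * (\<Sum>k\<in>?B. cmod (c k))\<^sup>2"
    and up: "\<And>c. (\<Sum>j<m. (cmod (\<Sum>k\<in>?B. c k * expk k (x j)))\<^sup>2) / real m
       \<le> 108 * (\<Sum>k\<in>?B. (cmod (c k))\<^sup>2) + \<eta> * (\<Sum>k\<in>?B. cmod (c k))\<^sup>2"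
    using frequency_cube_discretization[where 'd = 'd and J = ?J and t = t and m = m] m0
    unfolding \<eta>_def N_def by auto
  have \<eta>0: "\<eta> \<ge> 0" unfolding \<eta>_def by simp
  \<comment> \<open>Sampling and truncation get 1/4 each: 288 = 4 * 72 for the former, 8 v <= 2^t
    for the latter.\<close>
  have \<eta>v: "\<eta> * real v \<le> 1/2"
  proof -
    define Y where "Y = (real t + 1) * (256 * (real N)\<^sup>2 + real t + 2) / real m"
    have "72 * Y * real v \<le> 1/4"
      using m m0 unfolding Y_def by (simp add: field_simps)
    moreover have "12 * (1/4) ^ t * real v \<le> 1/4"
    proof -
      have tv: "8 * real v \<le> 2 ^ t" using t by (metis of_nat_le_iff of_nat_mult of_nat_numeral of_nat_power)
      have "64 * real v \<le> (8 * real v) * (8 * real v)" using v by simp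
      also have "\<dots> \<le> 2 ^ t * 2 ^ t" using tv rv by (intro mult_mono) auto
      also have "\<dots> = 4 ^ t" by (simp flip: power_mult_distrib)
      finally show ?thesis by (simp add: power_divide field_simps)
    qed
    moreover have "\<eta> = 72 * Y + 12 * (1/4) ^ t" unfolding \<eta>_def Y_def by simp
    ultimately show ?thesis by (simp add: distrib_right)
  qed
  have "summable (tail_weight a q)" by (rule summable_tail_weight[OF a])
  then have "suminf (tail_weight a q) > 0"
    by (rule suminf_pos) (simp add: tail_weight_def)
  then have D0: "D > 0" unfolding D_def by simp
  define \<delta> where "\<delta> = D\<^sup>2 / real v"
  have \<delta>: "sqrt \<delta> = D / sqrt (real v)" unfolding \<delta>_def using D0 by (simp add: real_sqrt_divide)
  have shift: "summable (\<lambda>j. level_bound a q (j + k))" for k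
    by (simp only: summable_iff_shift level_bound_tail(1)[OF a])
  \<comment> \<open>Level n + r itself is kept, so the tail starts at n + r + 1.\<close>
  define \<epsilon> where "\<epsilon> = (\<Sum>j. level_bound a q (j + (n + (r + 1))))"
  have \<epsilon>: "0 \<le> \<epsilon>" "\<epsilon>\<^sup>2 \<le> \<delta>"
  proof -
    show \<epsilon>0: "0 \<le> \<epsilon>" unfolding \<epsilon>_def
      by (intro suminf_nonneg shift level_bound_nonneg)
    have "\<epsilon> \<le> 2 powr (- a * real n) * (real n + 1) powr q * 2 powr (- a / 2 * real (r + 1)) * suminf (tail_weight a q)"
      unfolding \<epsilon>_def by (rule level_bound_tail(2)[OF a])
    also have "\<dots> = D * 2 powr (- a / 2 * real (r + 1))" unfolding D_def by (simp add: mult_ac)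
    finally have "\<epsilon>\<^sup>2 \<le> (D * 2 powr (- a / 2 * real (r + 1)))\<^sup>2" using \<epsilon>0 by (rule power_mono)
    also have "\<dots> = D\<^sup>2 * 2 powr (- a * real (r + 1))"
    proof -
      have "- a / 2 * real (r + 1) + - a / 2 * real (r + 1) = - a * real (r + 1)" by simp
      then have "(2 powr (- a / 2 * real (r + 1)))\<^sup>2 = 2 powr (- a * real (r + 1))"
        by (simp only: power2_eq_square powr_add[symmetric])
      then show ?thesis by (simp only: power_mult_distrib)
    qed
    also have "\<dots> \<le> D\<^sup>2 * (1 / real v)"
    proof (intro mult_left_mono)
      have "a * real r \<le> a * real (r + 1)" using a by simp
      then have "2 powr (a * real r) \<le> 2 powr (a * real (r + 1))" by (rule powr_mono) simp
      then have "real v \<le> 2 powr (a * real (r + 1))" using r by linarith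
      then have "1 / 2 powr (a * real (r + 1)) \<le> 1 / real v" using rv by (intro divide_left_mono) auto
      then show "2 powr (- a * real (r + 1)) \<le> 1 / real v" by (simp only: mult_minus_left powr_minus_divide)
    qed simp
    finally show "\<epsilon>\<^sup>2 \<le> \<delta>" unfolding \<delta>_def by simp
  qed
  have recover: "\<exists>K. K \<subseteq> hyp_cross (2 ^ ?J) \<and> card K = v \<and>
      (\<forall>u\<in>LS_set m x (trig_span K) f. L2norm (\<lambda>y. f y - u y) \<le> ennreal (1500 * sqrt \<delta>))"
    if f: "f \<in> W_class a b" for f :: "real^'d \<Rightarrow> complex"
  proof -
    let ?T = "{k::int^'d. n \<le> level k \<and> level k \<le> ?J}"
    have T: "(\<Sum>k\<in>?T. cmod (fhat f k)) \<le> D"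
    proof -
      have "?T = (\<Union>j\<in>{..<r + 1}. {k. level k = j + n})"
      proof (intro equalityI subsetI)
        fix k :: "int^'d" assume "k \<in> ?T"
        then have "level k - n \<in> {..<r + 1}" "level k = (level k - n) + n" by auto
        then show "k \<in> (\<Union>j\<in>{..<r + 1}. {k. level k = j + n})" by blast
      qed auto
      then have "(\<Sum>k\<in>?T. cmod (fhat f k)) = (\<Sum>j<r + 1. \<Sum>k\<in>{k. level k = j + n}. cmod (fhat f k))"
        by (simp only:) (rule sum.UNION_disjoint, auto simp: finite_level)
      also have "\<dots> \<le> (\<Sum>j<r + 1. level_bound a q (j + n))"
        unfolding q_def by (intro sum_mono W_class_level_le[OF f])
      also have "\<dots> \<le> (\<Sum>j. level_bound a q (j + n))"
        by (intro sum_le_suminf shift level_bound_nonneg) auto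
      also have "\<dots> \<le> D" using level_bound_tail(2)[OF a, of q n 0] unfolding D_def by simp
      finally show ?thesis .
    qed
    have card0: "2 * card {k::int^'d. level k < n} \<le> v"
      using card_level_less_le[where 'd = 'd, of n] small by linarith
    have cardJ: "v \<le> card (hyp_cross (2 ^ ?J) :: (int^'d) set)"
    proof -
      have "(2::nat) ^ r \<le> 2 ^ ?J" by (rule power_increasing) auto
      then have "v \<le> 2 ^ ?J" using large by linarith
      then show ?thesis using card_hyp_cross_ge[where 'd = 'd, of ?J] by linarith
    qed
    obtain K where K: "K \<subseteq> hyp_cross (2 ^ ?J)" "card K = v" "{k. level k < n} \<subseteq> K"
      and rest: "\<And>k. n \<le> level k \<Longrightarrow> level k \<le> ?J \<Longrightarrow> k \<notin> K \<Longrightarrow> cmod (fhat f k) \<le> 2 * D / real v"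
      using sparse_support_selection[OF v card0 cardJ _ D0 T] by auto
    define c where "c k = (if level k \<le> ?J then fhat f k else 0)" for k
    have KB: "K \<subseteq> ?B" using K(1) hyp_cross_subset_freq_cube by blast
    have TB: "{k. level k \<le> ?J} \<subseteq> ?B" using level_le_imp_hyp_cross hyp_cross_subset_freq_cube by blast
    \<comment> \<open>The box also contains frequencies of higher level, where c is 0, and those of
      level below n lie in K.\<close>
    have cut: "(\<Sum>k\<in>?B - K. \<phi> (c k)) = (\<Sum>k\<in>?T - K. \<phi> (fhat f k))" if "\<phi> 0 = (0::real)" for \<phi>
    proof -
      have "n \<le> level k" if "k \<notin> K" for k using that K(3) by (meson CollectI not_less subsetD)
      then show ?thesis
        using that TB freq_cube_card(1) unfolding c_def by (intro sum.mono_neutral_cong_right) auto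
    qed
    have finT: "finite ?T" by (rule finite_subset[OF _ finite_level_less[of "Suc ?J"]]) auto
    have c1: "(\<Sum>k\<in>?B - K. cmod (c k)) \<le> D"
    proof -
      have "(\<Sum>k\<in>?B - K. cmod (c k)) = (\<Sum>k\<in>?T - K. cmod (fhat f k))" by (rule cut) simp
      also have "\<dots> \<le> (\<Sum>k\<in>?T. cmod (fhat f k))" using finT by (intro sum_mono2) auto
      finally show ?thesis using T by linarith
    qed
    have c2: "(\<Sum>k\<in>?B - K. (cmod (c k))\<^sup>2) \<le> 2 * \<delta>"
    proof -
      have "(\<Sum>k\<in>?B - K. (cmod (c k))\<^sup>2) = (\<Sum>k\<in>?T - K. (cmod (fhat f k))\<^sup>2)" by (rule cut) simp
      also have "\<dots> \<le> (\<Sum>k\<in>?T - K. 2 * D / real v * cmod (fhat f k))"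
        unfolding power2_eq_square using rest by (intro sum_mono mult_right_mono) auto
      also have "\<dots> \<le> (\<Sum>k\<in>?T. 2 * D / real v * cmod (fhat f k))"
        using finT D0 rv by (intro sum_mono2) auto
      also have "\<dots> \<le> 2 * D / real v * D"
        unfolding sum_distrib_left[symmetric] using T D0 rv by (intro mult_left_mono) auto
      finally show ?thesis unfolding \<delta>_def by (simp add: power2_eq_square)
    qed
    have "\<eta> * (\<Sum>k\<in>?B - K. cmod (c k))\<^sup>2 \<le> \<eta> * D\<^sup>2"
      using \<eta>0 c1 by (intro mult_left_mono power_mono sum_nonneg) auto
    also have "\<dots> = \<eta> * real v * \<delta>" unfolding \<delta>_def using rv by simp
    also have "\<dots> \<le> 1 * \<delta>" using \<eta>v D0 unfolding \<delta>_def by (intro mult_right_mono) auto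
    finally have c3: "\<eta> * (\<Sum>k\<in>?B - K. cmod (c k))\<^sup>2 \<le> \<delta>" by simp
    have near: "cmod (f y - (\<Sum>k\<in>?B. c k * expk k y)) \<le> \<epsilon>" if "y \<in> torus_cube" for y
    proof -
      have "(\<Sum>k\<in>?B. c k * expk k y) = (\<Sum>k\<in>{k. level k < n + (r + 1)}. fhat f k * expk k y)"
        using TB freq_cube_card(1) unfolding c_def by (intro sum.mono_neutral_cong_right) auto
      then show ?thesis
        using W_class_fourier_tail[OF f level_bound_tail(1)[OF a] that, of "n + (r + 1)"] unfolding \<epsilon>_def q_def by simp
    qed
    have "L2norm (\<lambda>y. f y - u y) \<le> ennreal (1500 * sqrt \<delta>)" if "u \<in> LS_set m x (trig_span K) f" for u
      by (rule least_squares_error_le[OF freq_cube_card(1) _ x low up \<eta>0 _ KB near \<epsilon>(2) c2 c3 that])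
         (use m0 \<eta>v K(2) in auto)
    then show ?thesis using K by blast
  qed
  have "rho_ls m v (W_class a b :: (real^'d \<Rightarrow> complex) set) (2 ^ ?J)
      \<le> (SUP f\<in>(W_class a b :: (real^'d \<Rightarrow> complex) set). INF K\<in>{K. K \<subseteq> (hyp_cross (2 ^ ?J) :: (int^'d) set) \<and> card K = v}.
           SUP u\<in>LS_set m x (trig_span K) f. L2norm (\<lambda>y. f y - u y))"
    unfolding rho_ls_def by (rule INF_lower) (use x in auto)
  also have "\<dots> \<le> ennreal (1500 * sqrt \<delta>)"
  proof (rule SUP_least)
    fix f :: "real^'d \<Rightarrow> complex" assume "f \<in> W_class a b"
    from recover[OF this] obtain K where K: "K \<subseteq> hyp_cross (2 ^ ?J)" "card K = v"
      "\<forall>u\<in>LS_set m x (trig_span K) f. L2norm (\<lambda>y. f y - u y) \<le> ennreal (1500 * sqrt \<delta>)" by blast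
    show "(INF K\<in>{K. K \<subseteq> (hyp_cross (2 ^ ?J) :: (int^'d) set) \<and> card K = v}.
        SUP u\<in>LS_set m x (trig_span K) f. L2norm (\<lambda>y. f y - u y)) \<le> ennreal (1500 * sqrt \<delta>)"
      by (rule INF_lower2[of K]) (use K in \<open>auto intro: SUP_least\<close>)
  qed
  finally show ?thesis unfolding \<delta> .
qed

lemma powr_comparable_le:
  fixes x y R :: real
  assumes "x > 0" "x \<le> y" "y \<le> R * x"
  shows "x powr Q \<le> y powr Q * R powr \<bar>Q\<bar>"
proof (rule powr_le_of_ratio_bounds)
  have "1 * x \<le> R * x" using assms(2,3) by linarith
  then show R: "R \<ge> 1" using assms(1) by (simp only: mult_le_cancel_right_pos)
  have "1 * y \<le> R * y" using R assms(1,2) by (intro mult_right_mono) linarith+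
  then show "x \<le> R * y" using assms(2) by linarith
qed (use assms in auto)

theorem theorem5p1:
  fixes a :: real
  assumes "a > 0"
  shows "\<exists>c c'. \<forall>b::real. \<exists>C'. \<forall>v::nat. v \<ge> 2 \<longrightarrow>
     (\<exists>M::real. real (card (hyp_cross M :: (int^'d) set)) \<le> real v powr c \<and>
        (\<forall>m::nat. real m \<ge> c' * real v * (ln (2 * real v)) ^ 4 \<longrightarrow>
           rho_ls m v (W_class a b :: (real^'d \<Rightarrow> complex) set) M
             \<le> ennreal (C' * real v powr (- a - 1/2) *
                  ln (real v) powr ((real CARD('d) - 1) * (a + b) + 1/2))))"
proof -
  define d where "d = CARD('d)"
  have d1: "d \<ge> 1" unfolding d_def by (simp add: Suc_le_eq)
  then have d1r: "real d - 1 = real (d - 1)" by (simp add: of_nat_diff)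
  \<comment> \<open>Bounds N by \<kappa> log_2 v: n is below log_2 v, r about (1 + 1/a) log_2 v, and
    log_2 v >= 1 absorbs additive constants. Since the cross has at most 2^N elements, \<kappa> is
    also the exponent c.\<close>
  define \<kappa> where "\<kappa> = (5 + 1/a) * real d + 2"
  \<comment> \<open>With l = log_2 v: 1728 = 288 * 6 from t + 1 <= 6 l, 16 = 2^4 from l <= 2 ln(2
    v), and 7 from t + 2 <= 7 l^2.\<close>
  define c' where "c' = 1728 * 16 * (256 * \<kappa>\<^sup>2 + 7)"
  \<comment> \<open>4^a comes from v < 4 * 2^n (n + 1)^(d - 1), the power of d + 1 from replacing n
    + 1 by log_2 v, and the power of ln 2 from the change of base.\<close>
  define C where "C b = 1500 * suminf (tail_weight a ((real d - 1) * b)) * 4 powr a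
      * (real d + 1) powr \<bar>(real d - 1) * (a + b)\<bar> * ln 2 powr (- ((real d - 1) * (a + b)) - 1/2)" for b
  have "\<exists>M::real. real (card (hyp_cross M :: (int^'d) set)) \<le> real v powr \<kappa> \<and>
        (\<forall>m::nat. real m \<ge> c' * real v * (ln (2 * real v)) ^ 4 \<longrightarrow>
           rho_ls m v (W_class a b :: (real^'d \<Rightarrow> complex) set) M
             \<le> ennreal (C b * real v powr (- a - 1/2) *
                  ln (real v) powr ((real CARD('d) - 1) * (a + b) + 1/2)))" if v: "v \<ge> 2" for b and v :: nat
  proof -
    define l where "l = log 2 (real v)"
    have rv: "real v \<ge> 2" using v by simp
    have vl: "real v = 2 powr l" unfolding l_def using rv by simp
    have l1: "l \<ge> 1" unfolding l_def using rv by (simp add: le_log_iff)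
    obtain n where n: "2 * (2 ^ n * n ^ (d - 1)) \<le> v" "v < 2 * (2 ^ (n + 1) * (n + 1) ^ (d - 1))"
      "real n + 1 \<le> l" "l \<le> (real d + 1) * (real n + 1)"
      using dyadic_level_choice[OF v d1] unfolding l_def by metis
    \<comment> \<open>The two summands of 1 + 1/a give l <= r and l <= a r respectively.\<close>
    define r where "r = nat \<lceil>(1 + 1/a) * l\<rceil>"
    define t where "t = nat \<lceil>l\<rceil> + 3"
    define N where "N = (n + r + 2) * d + 2"
    have r: "(1 + 1/a) * l \<le> real r" "real r \<le> (1 + 1/a) * l + 1"
    proof -
      have "0 \<le> (1 + 1/a) * l" using assms l1 by simp
      then have "real r = real_of_int \<lceil>(1 + 1/a) * l\<rceil>" unfolding r_def by simp
      then show "(1 + 1/a) * l \<le> real r" "real r \<le> (1 + 1/a) * l + 1" by linarith+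
    qed
    have t: "l + 3 \<le> real t" "real t \<le> l + 4"
    proof -
      have "real t = real_of_int \<lceil>l\<rceil> + 3" using l1 unfolding t_def by simp
      then show "l + 3 \<le> real t" "real t \<le> l + 4" by linarith+
    qed
    have rl: "l \<le> real r" and rla: "l \<le> a * real r"
    proof -
      have "0 \<le> 1/a * l" using assms l1 by simp
      then show "l \<le> real r" using r(1) by (simp add: distrib_right)
      have "a * ((1 + 1/a) * l) = a * l + l" using assms by (simp add: field_simps)
      moreover have "a * ((1 + 1/a) * l) \<le> a * real r" using r(1) assms by (intro mult_left_mono) auto
      moreover have "0 \<le> a * l" using assms l1 by simp
      ultimately show "l \<le> a * real r" by linarith
    qed
    have large: "v \<le> 2 ^ r"
    proof -
      have "real v \<le> 2 powr real r" unfolding vl using rl by (intro powr_mono) auto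
      then show ?thesis by (simp add: powr_realpow)
    qed
    have rr: "real v \<le> 2 powr (a * real r)" unfolding vl using rla by (intro powr_mono) auto
    have tt: "8 * v \<le> 2 ^ t"
    proof -
      have "8 * real v = 2 powr (l + 3)" unfolding vl by (simp add: powr_add)
      also have "\<dots> \<le> 2 powr real t" using t(1) by (intro powr_mono) auto
      also have "\<dots> = 2 ^ t" by (simp add: powr_realpow)
      finally have "real (8 * v) \<le> real (2 ^ t)" by simp
      then show ?thesis by (simp only: of_nat_le_iff)
    qed
    have N: "real N \<le> \<kappa> * l"
    proof -
      have "real (n + r + 2) \<le> (5 + 1/a) * l"
        using n(3) r(2) l1 by (simp add: algebra_simps)
      then have "real (n + r + 2) * real d \<le> (5 + 1/a) * l * real d" by (intro mult_right_mono) auto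
      then show ?thesis using l1 unfolding N_def \<kappa>_def by (simp add: algebra_simps)
    qed
    have card: "real (card (hyp_cross (2 ^ (n + r)) :: (int^'d) set)) \<le> real v powr \<kappa>"
    proof -
      have "card (hyp_cross (2 ^ (n + r)) :: (int^'d) set) \<le> card (freq_cube (2 ^ (n + r)) :: (int^'d) set)"
        by (rule card_mono[OF freq_cube_card(1) hyp_cross_subset_freq_cube])
      also have "\<dots> \<le> (2 * 2 ^ (n + r) + 1) ^ d" unfolding d_def by (rule freq_cube_card)
      also have "\<dots> \<le> (2 ^ (n + r + 2)) ^ d" by (intro power_mono) auto
      also have "\<dots> \<le> 2 ^ N" unfolding N_def power_mult[symmetric] by (intro power_increasing) auto
      finally have "real (card (hyp_cross (2 ^ (n + r)) :: (int^'d) set)) \<le> 2 powr real N"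
        by (simp add: powr_realpow flip: of_nat_le_iff)
      also have "\<dots> \<le> 2 powr (l * \<kappa>)" using N by (intro powr_mono) (auto simp: mult.commute)
      also have "\<dots> = real v powr \<kappa>" unfolding vl by (simp add: powr_powr)
      finally show ?thesis .
    qed
    have samples: "288 * real v * (real t + 1) * (256 * (real N)\<^sup>2 + real t + 2) \<le> real m"
      if m: "real m \<ge> c' * real v * (ln (2 * real v)) ^ 4" for m
    proof -
      have ll: "l \<le> 2 * ln (2 * real v)"
      proof -
        have "ln 2 \<ge> (1/2 :: real)" using ln2_ge_two_thirds by simp
        moreover have "l * ln 2 = ln (real v)" unfolding l_def log_def by simp
        moreover have "ln (real v) \<le> ln (2 * real v)" using rv by (subst ln_le_cancel_iff) auto
        ultimately show ?thesis using l1 mult_left_mono[of "1/2" "ln 2" l] by linarith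
      qed
      have t6: "real t + 1 \<le> 6 * l" using t(2) l1 by simp
      have l2: "l \<le> l\<^sup>2" using l1 by (simp add: power2_eq_square)
      have "(real N)\<^sup>2 \<le> (\<kappa> * l)\<^sup>2" using N by (intro power_mono) auto
      then have "256 * (real N)\<^sup>2 + real t + 2 \<le> (256 * \<kappa>\<^sup>2 + 7) * l\<^sup>2"
        using t(2) l2 l1 by (simp add: power_mult_distrib algebra_simps)
      then have "(real t + 1) * (256 * (real N)\<^sup>2 + real t + 2) \<le> (6 * l) * ((256 * \<kappa>\<^sup>2 + 7) * l\<^sup>2)"
        using t6 l1 by (intro mult_mono) auto
      also have "\<dots> = 6 * (256 * \<kappa>\<^sup>2 + 7) * l ^ 3" by (simp add: power2_eq_square power3_eq_cube)
      also have "\<dots> \<le> 6 * (256 * \<kappa>\<^sup>2 + 7) * l ^ 4"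
        using l1 by (intro mult_left_mono power_increasing) auto
      also have "\<dots> \<le> 6 * (256 * \<kappa>\<^sup>2 + 7) * (2 * ln (2 * real v)) ^ 4"
        using ll l1 by (intro mult_left_mono power_mono) auto
      finally have "288 * real v * ((real t + 1) * (256 * (real N)\<^sup>2 + real t + 2))
          \<le> 288 * real v * (6 * (256 * \<kappa>\<^sup>2 + 7) * (2 * ln (2 * real v)) ^ 4)"
        by (intro mult_left_mono) auto
      also have "\<dots> = c' * real v * (ln (2 * real v)) ^ 4" unfolding c'_def by (simp add: power_mult_distrib)
      finally show ?thesis using m by (simp add: mult.assoc)
    qed
    have bound: "1500 * (2 powr (- a * real n) * (real n + 1) powr ((real d - 1) * b)
          * suminf (tail_weight a ((real d - 1) * b)) / sqrt (real v))
        \<le> C b * real v powr (- a - 1/2) * ln (real v) powr ((real d - 1) * (a + b) + 1/2)"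
    proof -
      define S where "S = suminf (tail_weight a ((real d - 1) * b))"
      define Q where "Q = (real d - 1) * (a + b)"
      define x where "x = real n + 1"
      have x: "x > 0" "x \<le> l" "l \<le> (real d + 1) * x" using n unfolding x_def by auto
      have S0: "S \<ge> 0" unfolding S_def
        by (intro suminf_nonneg summable_tail_weight[OF assms]) (simp add: tail_weight_def)
      \<comment> \<open>As n + 1 no longer fits, 2^n is at least v / (4 (n + 1)^(d - 1)). Its power
        -a contributes the part (d - 1) a of the logarithmic exponent; the part (d - 1) b is already
        in D.\<close>
      have p1: "2 powr (- a * real n) \<le> 4 powr a * x powr ((real d - 1) * a) * real v powr (- a)"
      proof -
        have "real v \<le> real (2 * (2 ^ (n + 1) * (n + 1) ^ (d - 1)))" using n(2) by (simp only: of_nat_le_iff less_imp_le)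
        also have "\<dots> = 4 * 2 ^ n * x ^ (d - 1)" unfolding x_def by (simp add: add.commute)
        also have "\<dots> = 4 * 2 powr real n * x powr (real d - 1)" using x(1) by (simp add: d1r powr_realpow)
        finally have "real v powr a \<le> (4 * 2 powr real n * x powr (real d - 1)) powr a"
          using assms by (intro powr_mono2) auto
        also have "\<dots> = 4 powr a * 2 powr (a * real n) * x powr ((real d - 1) * a)"
          using x(1) by (simp add: powr_mult powr_powr mult.commute)
        finally show ?thesis using rv by (simp add: powr_minus field_simps)
      qed
      have p2: "x powr Q \<le> l powr Q * (real d + 1) powr \<bar>Q\<bar>"
        by (rule powr_comparable_le[OF x])
      have lv: "ln (real v) > 0" using rv by simp
      \<comment> \<open>Since log_2 v >= 1, raising the exponent by 1/2 only enlarges the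
        power.\<close>
      have p3: "l powr Q \<le> ln (real v) powr (Q + 1/2) * ln 2 powr (- Q - 1/2)"
      proof -
        have "l powr Q = (ln (real v) / ln 2) powr Q" unfolding l_def log_def ..
        also have "\<dots> \<le> (ln (real v) / ln 2) powr (Q + 1/2)"
          using l1 unfolding l_def log_def by (intro powr_mono) auto
        also have "\<dots> = ln (real v) powr (Q + 1/2) * ln 2 powr (- (Q + 1/2))"
          using lv powr_divide[of "ln (real v)" "ln 2" "Q + 1/2"] unfolding powr_minus_divide by simp
        finally show ?thesis by simp
      qed
      have p4: "x powr Q \<le> (ln (real v) powr (Q + 1/2) * ln 2 powr (- Q - 1/2)) * (real d + 1) powr \<bar>Q\<bar>"
        by (rule order_trans[OF p2 mult_right_mono[OF p3]]) simp
      have "1500 * (2 powr (- a * real n) * x powr ((real d - 1) * b) * S / sqrt (real v))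
          \<le> 1500 * ((4 powr a * x powr ((real d - 1) * a) * real v powr (- a)) * x powr ((real d - 1) * b) * S / sqrt (real v))"
        using p1 S0 by (intro mult_left_mono divide_right_mono mult_right_mono) auto
      also have "\<dots> = 1500 * 4 powr a * S * (real v powr (- a) * real v powr (- (1/2))) * (x powr ((real d - 1) * a) * x powr ((real d - 1) * b))"
        using rv by (simp add: powr_minus powr_half_sqrt field_simps)
      also have "\<dots> = 1500 * 4 powr a * S * real v powr (- a - 1/2) * x powr Q"
        unfolding powr_add[symmetric] Q_def by (simp add: distrib_left)
      also have "\<dots> \<le> 1500 * 4 powr a * S * real v powr (- a - 1/2)
          * ((ln (real v) powr (Q + 1/2) * ln 2 powr (- Q - 1/2)) * (real d + 1) powr \<bar>Q\<bar>)"
        using p4 S0 by (intro mult_left_mono) auto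
      also have "\<dots> = C b * real v powr (- a - 1/2) * ln (real v) powr (Q + 1/2)"
        unfolding C_def S_def Q_def by (simp add: mult_ac)
      finally show ?thesis unfolding x_def S_def Q_def .
    qed
    have "rho_ls m v (W_class a b :: (real^'d \<Rightarrow> complex) set) (2 ^ (n + r))
             \<le> ennreal (C b * real v powr (- a - 1/2) * ln (real v) powr ((real d - 1) * (a + b) + 1/2))"
      if m: "real m \<ge> c' * real v * (ln (2 * real v)) ^ 4" for m
    proof -
      have "rho_ls m v (W_class a b :: (real^'d \<Rightarrow> complex) set) (2 ^ (n + r))
          \<le> ennreal (1500 * (2 powr (- a * real n) * (real n + 1) powr ((real d - 1) * b)
            * suminf (tail_weight a ((real d - 1) * b)) / sqrt (real v)))"
        unfolding d_def
        by (rule W_class_sparse_recovery[OF assms _ _ large rr tt])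
           (use v n(1) samples[OF m] in \<open>auto simp: d_def N_def\<close>)
      then show ?thesis using ennreal_leI[OF bound] by (rule order_trans)
    qed
    then show ?thesis using card unfolding d_def by blast
  qed
  then show ?thesis by blast
qed

end
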